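(* Fix $c>0$, let ${\rm Po}(c)$ be a Poisson random variable with mean $c$, and fix an integer $q\ge2$. For each $n\ge1$ let $\eta$ (possibly depending on $n$) be a Poisson measure on a Borel space $(Z,\mathscr{Z})$ with $\sigma$-finite non-atomic control measure $\mu$ (possibly $\mu=\mu_n$), and let \[F_n=x_n+B_n+I_q(f_n),\quad n\ge1,\] be $\mathbb{Z}_+$-valued random variables, where $x_n$ are positive reals, $f_n\in L^2_s(\mu^q)$, and $\{B_n\}$ is a smooth vanishing perturbation (see context). Assume $x_n\to c$ and $E[I_q(f_n)^2]\to c$, and moreover: (i) for every $n$, the kernel $f_n$ verifies the integrand assumption stated in the context; (ii) for every $r=1,\dots,q$ and every $l=1,\dots,r\wedge(q-1)$, $\|f_n\star_r^l f_n\|_{L^2(\mu^{2q-r-l})}\to0$ as $n\to\infty$; (iii) $\sup_n\|f_n\|_{L^4(\mu^q)}<\infty$ and, as $n\to\infty$, \[\int_{Z^q}\big(f_n^2+(q!)^2f_n^4-2\,q!\,f_n^3\big)\,d\mu^q\longrightarrow0.\] Then $d_{TV}(F_n,{\rm Po}(c))\to0$ as $n\to\infty$.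
   Context: A Poisson measure $\eta$ with control $\mu$: $\eta(B)$ Poisson with mean $\mu(B)$, independent over disjoint sets; $\hat\eta=\eta-\mu$; $I_q(f)$ is the multiple Wiener-Itô integral of order $q$ with respect to $\hat\eta$; $L^2_s(\mu^q)$ denotes symmetric functions in $L^2(\mu^q)$. Every $F\in L^2(P)$ has a chaotic decomposition $F=E[F]+\sum_{k\ge1}I_k(f_k)$; ${\rm dom}\,D$ consists of $F$ with $\sum_k k\,k!\|f_k\|^2<\infty$, $D_zF=\sum_k kI_{k-1}(f_k(z,\cdot))$, and $L^{-1}F=-\sum_k\frac1kI_k(f_k)$. A sequence $\{B_n\}\subset L^2(P)$ is a smooth vanishing perturbation if $B_n,L^{-1}B_n\in{\rm dom}\,D$ for all $n$ and $E[B_n^2]\to0$, $E[\|DB_n\|^2_{L^2(\mu)}]\to0$, $E[\|DL^{-1}B_n\|^2_{L^2(\mu)}]\to0$, $E[\|DB_n\|^4_{L^4(\mu)}]\to0$, $E[\|DL^{-1}B_n\|^4_{L^4(\mu)}]\to0$. Contractions: for $f\in L^2_s(\mu^p)$, $g\in L^2_s(\mu^q)$, $r\le p\wedge q$, $l\le r$, $f\star_r^lg(\gamma_1..\gamma_{r-l},t_1..t_{p-r},s_1..s_{q-r})=\int_{Z^l}f(z_1..z_l,\gamma,t)g(z_1..z_l,\gamma,s)\,\mu^l(dz)$ (for $l=0$, no integration: the product with the $r$ variables identified). Integrand assumption on $f\in L^2_s(\mu^q)$: (a) for every $r=1,\dots,q$, $f\star_q^{q-r}f\in L^2(\mu^r)$;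 (b) every contraction $|f|\star_r^l|f|$ ($r=1..q$, $l=1..r$) is well-defined and finite at every point of $Z^{2q-r-l}$; (c) for every $k=1,\dots,2q-2$ and $(r,l)$ with $k=2q-2-r-l$, $\int_Z\big[\big(\int_{Z^k}(f(z,\cdot)\star_r^lf(z,\cdot))^2d\mu^k\big)^{1/2}\big]\mu(dz)<\infty$, where $f(z,\cdot)$ is $(z_1,\dots,z_{q-1})\mapsto f(z,z_1,\dots,z_{q-1})$. $d_{TV}$ is the total variation distance between laws on $\mathbb{Z}_+$. *)

theory Defs
  imports "HOL-Probability.Probability"
begin

abbreviation powM :: "'z measure \<Rightarrow> nat \<Rightarrow> (nat \<Rightarrow> 'z) measure" where
  "powM mu q \<equiv> PiM {..<q} (\<lambda>_. mu)"

definition sym_L2 :: "'z measure \<Rightarrow> nat \<Rightarrow> ((nat \<Rightarrow> 'z) \<Rightarrow> real) \<Rightarrow> bool" where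
  "sym_L2 mu q f \<longleftrightarrow>
     f \<in> borel_measurable (powM mu q) \<and>
     integrable (powM mu q) (\<lambda>x. (f x)\<^sup>2) \<and>
     (\<forall>x\<in>space (powM mu q). \<forall>p. p permutes {..<q} \<longrightarrow> f (\<lambda>i. x (p i)) = f x)"

text \<open>Contraction of f (order p) and g (order q), with r identified variables of which l
  are integrated out: a function of the 2*... = p+q-r-l variables
  (gamma_1..gamma_(r-l), t_1..t_(p-r), s_1..s_(q-r)) stored in this order.\<close>

definition contr :: "'z measure \<Rightarrow> nat \<Rightarrow> nat \<Rightarrow> nat \<Rightarrow> nat \<Rightarrow>
    ((nat \<Rightarrow> 'z) \<Rightarrow> real) \<Rightarrow> ((nat \<Rightarrow> 'z) \<Rightarrow> real) \<Rightarrow> (nat \<Rightarrow> 'z) \<Rightarrow> real" where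
  "contr mu p q r l f g y =
     (\<integral>z. f (restrict (\<lambda>i. if i < l then z i else y (i - l)) {..<p}) *
           g (restrict (\<lambda>i. if i < l then z i else if i < r then y (i - l)
                             else y (i - r + (p - l))) {..<q})
        \<partial>powM mu l)"

definition contr_abs_finite :: "'z measure \<Rightarrow> nat \<Rightarrow> nat \<Rightarrow> nat \<Rightarrow> nat \<Rightarrow>
    ((nat \<Rightarrow> 'z) \<Rightarrow> real) \<Rightarrow> ((nat \<Rightarrow> 'z) \<Rightarrow> real) \<Rightarrow> (nat \<Rightarrow> 'z) \<Rightarrow> bool" where
  "contr_abs_finite mu p q r l f g y \<longleftrightarrow>
     (\<integral>\<^sup>+z. ennreal (\<bar>f (restrict (\<lambda>i. if i < l then z i else y (i - l)) {..<p})\<bar> *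
           \<bar>g (restrict (\<lambda>i. if i < l then z i else if i < r then y (i - l)
                             else y (i - r + (p - l))) {..<q})\<bar>)
        \<partial>powM mu l) < \<infinity>"

definition slice :: "nat \<Rightarrow> ((nat \<Rightarrow> 'z) \<Rightarrow> real) \<Rightarrow> 'z \<Rightarrow> (nat \<Rightarrow> 'z) \<Rightarrow> real" where
  "slice q f z w = f (restrict (\<lambda>i. if i = 0 then z else w (i - 1)) {..<q})"

definition ennsqrt :: "ennreal \<Rightarrow> ennreal" where
  "ennsqrt x = (if x = \<infinity> then \<infinity> else ennreal (sqrt (enn2real x)))"

definition L2norm :: "'a measure \<Rightarrow> ('a \<Rightarrow> real) \<Rightarrow> ennreal" where
  "L2norm M g = ennsqrt (\<integral>\<^sup>+x. ennreal ((g x)\<^sup>2) \<partial>M)"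

definition L2 :: "'a measure \<Rightarrow> ('a \<Rightarrow> real) \<Rightarrow> bool" where
  "L2 M g \<longleftrightarrow> g \<in> borel_measurable M \<and> integrable M (\<lambda>x. (g x)\<^sup>2)"

definition integrand_assumption :: "'z measure \<Rightarrow> nat \<Rightarrow> ((nat \<Rightarrow> 'z) \<Rightarrow> real) \<Rightarrow> bool" where
  "integrand_assumption mu q f \<longleftrightarrow>
     (\<forall>r\<in>{1..q}. \<forall>l\<in>{1..r}. \<forall>y\<in>space (powM mu (2*q - r - l)).
         contr_abs_finite mu q q r l f f y) \<and>
     (\<forall>r\<in>{1..q}. L2 (powM mu r) (contr mu q q q (q - r) f f)) \<and>
     (\<forall>r l. r \<le> q - 1 \<and> l \<le> r \<and> 1 \<le> 2*q - 2 - r - l \<longrightarrow>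
         (\<integral>\<^sup>+z. L2norm (powM mu (2*q - 2 - r - l))
                  (contr mu (q - 1) (q - 1) r l (slice q f z) (slice q f z)) \<partial>mu) < \<infinity>)"

definition poisson_measure :: "'w measure \<Rightarrow> 'z measure \<Rightarrow> ('w \<Rightarrow> 'z measure) \<Rightarrow> bool" where
  "poisson_measure M mu eta \<longleftrightarrow>
     prob_space M \<and>
     (\<forall>\<omega>\<in>space M. sets (eta \<omega>) = sets mu) \<and>
     (\<forall>B\<in>sets mu. (\<lambda>\<omega>. emeasure (eta \<omega>) B) \<in> borel_measurable M) \<and>
     (\<forall>B\<in>sets mu. emeasure mu B < \<infinity> \<longrightarrow>
        (\<forall>k::nat. measure M {\<omega>\<in>space M. emeasure (eta \<omega>) B = of_nat k}
                  = exp (- measure mu B) * (measure mu B) ^ k / fact k)) \<and>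
     (\<forall>B\<in>sets mu. emeasure mu B = \<infinity> \<longrightarrow>
        (AE \<omega> in M. emeasure (eta \<omega>) B = \<infinity>)) \<and>
     (\<forall>(I::nat set) A. finite I \<longrightarrow> (\<forall>i\<in>I. A i \<in> sets mu) \<longrightarrow> disjoint_family_on A I \<longrightarrow>
        prob_space.indep_vars M (\<lambda>_. borel) (\<lambda>i \<omega>. emeasure (eta \<omega>) (A i)) I)"

text \<open>Elementary kernels: finite sums c * sym(1_{A_0 x ... x A_(q-1)}) with A_i pairwise
  disjoint of finite measure; their integral is c * prod_i (eta(A_i) - mu(A_i)).\<close>

definition elem_valid :: "'z measure \<Rightarrow> nat \<Rightarrow> (real \<times> (nat \<Rightarrow> 'z set)) list \<Rightarrow> bool" where
  "elem_valid mu q ts \<longleftrightarrow>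
     (\<forall>(c, A)\<in>set ts. (\<forall>i<q. A i \<in> sets mu \<and> emeasure mu (A i) < \<infinity>) \<and>
                       disjoint_family_on A {..<q})"

definition elem_kernel :: "nat \<Rightarrow> (real \<times> (nat \<Rightarrow> 'z set)) list \<Rightarrow> (nat \<Rightarrow> 'z) \<Rightarrow> real" where
  "elem_kernel q ts x =
     (\<Sum>(c, A)\<leftarrow>ts. c / fact q *
        (\<Sum>p\<in>{p. p permutes {..<q}}. \<Prod>i<q. indicator (A (p i)) (x i)))"

definition elem_int :: "'z measure \<Rightarrow> ('w \<Rightarrow> 'z measure) \<Rightarrow> nat \<Rightarrow>
    (real \<times> (nat \<Rightarrow> 'z set)) list \<Rightarrow> 'w \<Rightarrow> real" where
  "elem_int mu eta q ts \<omega> =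
     (\<Sum>(c, A)\<leftarrow>ts. c * (\<Prod>i<q. enn2real (emeasure (eta \<omega>) (A i)) - measure mu (A i)))"

text \<open>X is (a version of) I_q(f): the L^2(P)-limit of integrals of elementary kernels
  converging to f in L^2(mu^q).\<close>
definition is_mwi :: "'w measure \<Rightarrow> 'z measure \<Rightarrow> ('w \<Rightarrow> 'z measure) \<Rightarrow> nat \<Rightarrow>
    ((nat \<Rightarrow> 'z) \<Rightarrow> real) \<Rightarrow> ('w \<Rightarrow> real) \<Rightarrow> bool" where
  "is_mwi M mu eta q f X \<longleftrightarrow>
     X \<in> borel_measurable M \<and>
     (\<exists>ts. (\<forall>j. elem_valid mu q (ts j)) \<and>
        ((\<lambda>j. \<integral>\<^sup>+x. ennreal ((f x - elem_kernel q (ts j) x)\<^sup>2) \<partial>powM mu q) \<longlonglongrightarrow> 0) \<and>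
        ((\<lambda>j. \<integral>\<^sup>+\<omega>. ennreal ((X \<omega> - elem_int mu eta q (ts j) \<omega>)\<^sup>2) \<partial>M) \<longlonglongrightarrow> 0))"

definition chaos_dec :: "'w measure \<Rightarrow> 'z measure \<Rightarrow> ('w \<Rightarrow> 'z measure) \<Rightarrow>
    ('w \<Rightarrow> real) \<Rightarrow> (nat \<Rightarrow> (nat \<Rightarrow> 'z) \<Rightarrow> real) \<Rightarrow> bool" where
  "chaos_dec M mu eta F g \<longleftrightarrow>
     L2 M F \<and> (\<forall>k\<ge>1. sym_L2 mu k (g k)) \<and>
     (\<exists>X. (\<forall>k\<ge>1. is_mwi M mu eta k (g k) (X k)) \<and>
        ((\<lambda>N. \<integral>\<^sup>+\<omega>. ennreal ((F \<omega> - (\<integral>\<omega>'. F \<omega>' \<partial>M) - (\<Sum>k=1..N. X k \<omega>))\<^sup>2) \<partial>M)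
           \<longlonglongrightarrow> 0))"

definition in_domD :: "'z measure \<Rightarrow> (nat \<Rightarrow> (nat \<Rightarrow> 'z) \<Rightarrow> real) \<Rightarrow> bool" where
  "in_domD mu g \<longleftrightarrow>
     (\<Sum>k. ennreal (real k * fact k) * (\<integral>\<^sup>+x. ennreal ((g k x)\<^sup>2) \<partial>powM mu k)) < \<infinity>"

text \<open>DF (a jointly measurable random field on \<Omega> x Z) is the derivative of the random
  variable with chaos kernels g: DF(\<omega>,z) = sum_k k I_(k-1)(g k (z,.)), limit in L^2(P x mu).\<close>
definition is_D :: "'w measure \<Rightarrow> 'z measure \<Rightarrow> ('w \<Rightarrow> 'z measure) \<Rightarrow>
    (nat \<Rightarrow> (nat \<Rightarrow> 'z) \<Rightarrow> real) \<Rightarrow> ('w \<times> 'z \<Rightarrow> real) \<Rightarrow> bool" where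
  "is_D M mu eta g DF \<longleftrightarrow>
     DF \<in> borel_measurable (M \<Otimes>\<^sub>M mu) \<and>
     (\<exists>Y. (\<forall>k\<ge>1. Y k \<in> borel_measurable (M \<Otimes>\<^sub>M mu) \<and>
              (AE z in mu. is_mwi M mu eta (k - 1) (slice k (g k) z) (\<lambda>\<omega>. Y k (\<omega>, z)))) \<and>
        ((\<lambda>N. \<integral>\<^sup>+p. ennreal ((DF p - (\<Sum>k=1..N. real k * Y k p))\<^sup>2) \<partial>(M \<Otimes>\<^sub>M mu))
           \<longlonglongrightarrow> 0))"

definition Linv_kernels :: "(nat \<Rightarrow> (nat \<Rightarrow> 'z) \<Rightarrow> real) \<Rightarrow> nat \<Rightarrow> (nat \<Rightarrow> 'z) \<Rightarrow> real" where
  "Linv_kernels g k x = - g k x / real k"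

definition smooth_vanishing_perturbation :: "(nat \<Rightarrow> 'w measure) \<Rightarrow> (nat \<Rightarrow> 'z measure) \<Rightarrow>
    (nat \<Rightarrow> 'w \<Rightarrow> 'z measure) \<Rightarrow> (nat \<Rightarrow> 'w \<Rightarrow> real) \<Rightarrow> bool" where
  "smooth_vanishing_perturbation M mu eta B \<longleftrightarrow>
     (\<exists>g DB DLB.
        (\<forall>n. chaos_dec (M n) (mu n) (eta n) (B n) (g n) \<and>
             in_domD (mu n) (g n) \<and> in_domD (mu n) (Linv_kernels (g n)) \<and>
             is_D (M n) (mu n) (eta n) (g n) (DB n) \<and>
             is_D (M n) (mu n) (eta n) (Linv_kernels (g n)) (DLB n)) \<and>
        ((\<lambda>n. \<integral>\<^sup>+\<omega>. ennreal ((B n \<omega>)\<^sup>2) \<partial>M n) \<longlonglongrightarrow> 0) \<and>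
        ((\<lambda>n. \<integral>\<^sup>+p. ennreal ((DB n p)\<^sup>2) \<partial>(M n \<Otimes>\<^sub>M mu n)) \<longlonglongrightarrow> 0) \<and>
        ((\<lambda>n. \<integral>\<^sup>+p. ennreal ((DLB n p)\<^sup>2) \<partial>(M n \<Otimes>\<^sub>M mu n)) \<longlonglongrightarrow> 0) \<and>
        ((\<lambda>n. \<integral>\<^sup>+p. ennreal ((DB n p) ^ 4) \<partial>(M n \<Otimes>\<^sub>M mu n)) \<longlonglongrightarrow> 0) \<and>
        ((\<lambda>n. \<integral>\<^sup>+p. ennreal ((DLB n p) ^ 4) \<partial>(M n \<Otimes>\<^sub>M mu n)) \<longlonglongrightarrow> 0))"

definition non_atomic :: "'z measure \<Rightarrow> bool" where
  "non_atomic mu \<longleftrightarrow> (\<forall>A\<in>sets mu. 0 < emeasure mu A \<longrightarrow>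
      (\<exists>B\<in>sets mu. B \<subseteq> A \<and> 0 < emeasure mu B \<and> emeasure mu B < emeasure mu A))"

definition d_TV :: "nat measure \<Rightarrow> nat measure \<Rightarrow> real" where
  "d_TV P Q = (SUP A. \<bar>measure P A - measure Q A\<bar>)"

end

theory Submission
  imports Defs
begin

text \<open>
  Since \<open>B n\<close> vanishes in \<open>L\<^sup>2\<close>, the law of \<open>F n\<close> is governed by \<open>I_q (f n)\<close>. The third
  hypothesis says that \<open>f - q! f\<^sup>2\<close> vanishes in \<open>L\<^sup>2\<close>, so \<open>q! f\<close> is close to an indicator.
  Replacing \<open>f\<close> by an elementary kernel turns \<open>I_q f\<close> into a polynomial
  \<open>\<Sum>S. a S * (\<Prod>i\<in>S. N i - r i)\<close> in independent Poisson variables \<open>N i\<close> of means \<open>r i\<close>, where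
  \<open>S\<close> runs through the \<open>q\<close>-element sets of cells of a finite grid, and the coefficients \<open>a S\<close>
  may be rounded to \<open>0\<close> or \<open>1\<close>. Let \<open>\<A>\<close> be the family of sets with coefficient \<open>1\<close>, after removing
  those that contain a nonempty proper subset \<open>J\<close> lying in too many members of \<open>\<A>\<close>; the contractions
  \<open>f \<star>_q^l f\<close> bound the removed mass.

  The count \<open>U = \<Sum>S\<in>\<A>. \<Prod>i\<in>S. N i\<close> has mean \<open>\<lambda> = \<Sum>S\<in>\<A>. \<Prod>i\<in>S. r i\<close>, and its variance exceeds
  \<open>\<lambda>\<close> by a small quantity \<open>D\<close>. This \<open>D\<close> is at the same time the squared \<open>L\<^sup>2\<close> distance between
  \<open>U - \<lambda>\<close> and the rounded polynomial and, by the Mecke formula, a bound for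
  \<open>\<bar>(k + 1) P(U = k + 1) - \<lambda> P(U = k)\<bar>\<close>. As \<open>F n\<close> and \<open>U\<close> are integer valued,
  \<open>P(F n \<noteq> U) \<le> E (F n - U)\<^sup>2\<close>, so the same relation holds asymptotically for \<open>F n\<close> with \<open>c\<close> in
  place of \<open>\<lambda>\<close>. Together with tightness it forces convergence of the point probabilities to
  those of the Poisson law, and hence convergence in total variation.
\<close>

section \<open>Independent Poisson variables\<close>

text \<open>Contraction norms are not continuous under L2 convergence of kernels, so smallness of
  the contractions of \<open>f\<close> says nothing directly about those of an elementary kernel
  close to \<open>f\<close>. The partial sums \<open>H\<close> of the rounded kernel are therefore
  not compared with a contraction of the elementary kernel: the region where they are large is
  integrated against the contraction of \<open>f\<close> itself. This is why sets are pruned from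
  the family, and why the L2 accuracy \<tau> can be chosen freely. Rounding is what brings in the
  Stein-Chen method. With coefficients 0 and 1 the top chaos component of \<open>U\<close> has
  variance equal to the mean of \<open>U\<close>, and adding one point to each cell of a member of
  the family raises \<open>U\<close> by at least one. So the excess variance measures both how far
  \<open>U - \<lambda>\<close> is from its top component and how often the raise exceeds one. The
  threshold \<epsilon> must vanish more slowly than the squared contraction norms \<Phi>: the pruned
  mass is of order \<Phi> / \<epsilon>, up to terms in \<tau>, while the excess is of order
  \<epsilon>.\<close>

text \<open>Cells of measure zero occur, and \<^const>\<open>poisson_pmf\<close> is only meaningful for positive rates.\<close>

definition pois :: "real \<Rightarrow> nat pmf" where
  "pois r = (if r > 0 then poisson_pmf r else return_pmf 0)"

lemma pmf_pois: "0 \<le> r \<Longrightarrow> pmf (pois r) k = r ^ k / fact k * exp (- r)"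
  by (cases "r = 0") (auto simp: pois_def power_0_left)

text \<open>The recursion (n + 1) p(n + 1) = r p(n) of the Poisson weights, summed against
  \<open>g\<close>; the term n = 0 vanishes. Working in \<open>ennreal\<close> lets moments be read
  off before integrability is known.\<close>

lemma nn_integral_pois_mecke:
  assumes "0 \<le> r"
  shows "(\<integral>\<^sup>+n. of_nat n * g n \<partial>pois r) = ennreal r * (\<integral>\<^sup>+n. g (Suc n) \<partial>pois r)"
proof -
  have *: "ennreal (pmf (pois r) (Suc n)) * (of_nat (Suc n) * y)
      = ennreal r * (ennreal (pmf (pois r) n) * y)" for n and y :: ennreal
  proof -
    have "pmf (pois r) (Suc n) * real (Suc n) = r * pmf (pois r) n"
      using assms by (simp add: pmf_pois field_simps del: of_nat_Suc)
    then have "ennreal (pmf (pois r) (Suc n)) * of_nat (Suc n) = ennreal r * ennreal (pmf (pois r) n)"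
      using assms by (simp add: ennreal_mult'[symmetric] ennreal_of_nat_eq_real_of_nat del: of_nat_Suc)
    then show ?thesis by (simp add: mult.assoc[symmetric] del: of_nat_Suc)
  qed
  have "(\<integral>\<^sup>+n. of_nat n * g n \<partial>pois r) = (\<Sum>n. ennreal (pmf (pois r) n) * (of_nat n * g n))"
    by (simp add: nn_integral_measure_pmf nn_integral_count_space_nat)
  also have "\<dots> = (\<Sum>n. ennreal (pmf (pois r) (Suc n)) * (of_nat (Suc n) * g (Suc n)))"
    using suminf_offset[of "\<lambda>n. ennreal (pmf (pois r) n) * (of_nat n * g n)" 1] by simp
  also have "\<dots> = (\<Sum>n. ennreal r * (ennreal (pmf (pois r) n) * g (Suc n)))"
    by (simp only: *)
  also have "\<dots> = ennreal r * (\<Sum>n. ennreal (pmf (pois r) n) * g (Suc n))"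
    by simp
  also have "\<dots> = ennreal r * (\<integral>\<^sup>+n. g (Suc n) \<partial>pois r)"
    by (simp add: nn_integral_measure_pmf nn_integral_count_space_nat)
  finally show ?thesis .
qed

lemma pois_mean:
  assumes "0 \<le> r"
  shows "integrable (pois r) real" "(\<integral>n. real n \<partial>pois r) = r"
proof -
  have "(\<integral>\<^sup>+n. ennreal (real n) \<partial>pois r) = ennreal r"
    using nn_integral_pois_mecke[OF assms, of "\<lambda>_. 1"]
    by (simp add: ennreal_of_nat_eq_real_of_nat)
  then have "has_bochner_integral (pois r) real r"
    using assms by (intro has_bochner_integral_nn_integral) auto
  then show "integrable (pois r) real" "(\<integral>n. real n \<partial>pois r) = r"
    by (auto simp: has_bochner_integral_iff)
qed

lemma pois_second_moment:
  assumes "0 \<le> r"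
  shows "integrable (pois r) (\<lambda>n. (real n)\<^sup>2)" "(\<integral>n. (real n)\<^sup>2 \<partial>pois r) = r * r + r"
proof -
  have "(\<integral>\<^sup>+n. ennreal ((real n)\<^sup>2) \<partial>pois r) = (\<integral>\<^sup>+n. of_nat n * of_nat n \<partial>pois r)"
    by (intro nn_integral_cong) (simp add: power2_eq_square ennreal_mult ennreal_of_nat_eq_real_of_nat)
  also have "\<dots> = ennreal r * (\<integral>\<^sup>+n. of_nat n * 1 + 1 \<partial>pois r)"
    using nn_integral_pois_mecke[OF assms, of of_nat] by (simp add: add.commute)
  also have "(\<integral>\<^sup>+n. of_nat n * 1 + 1 \<partial>pois r) = ennreal r + 1"
    using nn_integral_pois_mecke[OF assms, of "\<lambda>_. 1"] by (subst nn_integral_add) auto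
  also have "ennreal r * (ennreal r + 1) = ennreal (r * r + r)"
    using assms by (simp add: algebra_simps ennreal_mult ennreal_plus)
  finally have "has_bochner_integral (pois r) (\<lambda>n. (real n)\<^sup>2) (r * r + r)"
    using assms by (intro has_bochner_integral_nn_integral) auto
  then show "integrable (pois r) (\<lambda>n. (real n)\<^sup>2)" "(\<integral>n. (real n)\<^sup>2 \<partial>pois r) = r * r + r"
    by (auto simp: has_bochner_integral_iff)
qed

lemma pois_centered:
  assumes "0 \<le> r"
  shows "integrable (pois r) (\<lambda>n. real n - r)" "(\<integral>n. real n - r \<partial>pois r) = 0"
    and "integrable (pois r) (\<lambda>n. (real n - r)\<^sup>2)" "(\<integral>n. (real n - r)\<^sup>2 \<partial>pois r) = r"
proof -
  note [simp] = pois_mean[OF assms] pois_second_moment[OF assms]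
  show "integrable (pois r) (\<lambda>n. real n - r)" "(\<integral>n. real n - r \<partial>pois r) = 0" by simp_all
  have eq: "(\<lambda>n. (real n - r)\<^sup>2) = (\<lambda>n. (real n)\<^sup>2 - 2 * r * real n + r\<^sup>2)"
    by (auto simp: power2_diff)
  show "integrable (pois r) (\<lambda>n. (real n - r)\<^sup>2)" "(\<integral>n. (real n - r)\<^sup>2 \<partial>pois r) = r"
    unfolding eq by (simp_all, simp add: power2_eq_square)
qed

lemma expectation_prod_Pi_pmf':
  fixes f :: "'i \<Rightarrow> 'a \<Rightarrow> real"
  assumes "finite I" "\<And>i. i \<in> I \<Longrightarrow> integrable (measure_pmf (p i)) (f i)"
  shows "(\<integral>v. (\<Prod>i\<in>I. f i (v i)) \<partial>Pi_pmf I d p) = (\<Prod>i\<in>I. \<integral>x. f i x \<partial>p i)"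
proof -
  let ?P = "measure_pmf (Pi_pmf I d p)"
  have comp: "map_pmf (\<lambda>v. v i) (Pi_pmf I d p) = p i" if "i \<in> I" for i
    using assms that by (simp add: Pi_pmf_component)
  have ind: "prob_space.indep_vars ?P (\<lambda>_. borel) (\<lambda>i v. f i (v i)) I"
    by (rule prob_space.indep_vars_compose2[OF measure_pmf.prob_space_axioms
          indep_vars_Pi_pmf[OF assms(1)]]) auto
  have "(\<integral>v. (\<Prod>i\<in>I. f i (v i)) \<partial>?P) = (\<Prod>i\<in>I. \<integral>v. f i (v i) \<partial>?P)"
  proof (rule prob_space.indep_vars_lebesgue_integral[OF measure_pmf.prob_space_axioms assms(1) ind])
    fix i assume i: "i \<in> I"
    show "integrable ?P (\<lambda>v. f i (v i))"
      using assms(2)[OF i] integrable_map_pmf_eq[of "\<lambda>v. v i" "Pi_pmf I d p" "f i"]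
      unfolding comp[OF i] by simp
  qed
  also have "\<dots> = (\<Prod>i\<in>I. \<integral>x. f i x \<partial>p i)"
  proof (rule prod.cong)
    fix i assume i: "i \<in> I"
    show "(\<integral>v. f i (v i) \<partial>?P) = (\<integral>x. f i x \<partial>p i)"
      using integral_map_pmf[of "\<lambda>v. v i" "Pi_pmf I d p" "f i"] unfolding comp[OF i] by simp
  qed simp
  finally show ?thesis .
qed

section \<open>Orthogonality of products of centred Poisson counts\<close>

locale poisson_vector =
  fixes I :: "'i set" and r :: "'i \<Rightarrow> real"
  assumes finite_I: "finite I" and r_nonneg: "\<And>i. 0 \<le> r i"
begin

definition P :: "('i \<Rightarrow> nat) pmf" where
  "P = Pi_pmf I 0 (\<lambda>i. pois (r i))"

definition w :: "'i set \<Rightarrow> real" where "w S = (\<Prod>i\<in>S. r i)"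

definition cprod :: "'i set \<Rightarrow> ('i \<Rightarrow> nat) \<Rightarrow> real" where
  "cprod S v = (\<Prod>i\<in>S. real (v i) - r i)"

lemma w_nonneg: "0 \<le> w S"
  unfolding w_def by (intro prod_nonneg) (auto simp: r_nonneg)

lemma finite_subset_I: "S \<subseteq> I \<Longrightarrow> finite S"
  using finite_I by (rule rev_finite_subset)

text \<open>Independence factorises the expectation over cells. A cell in exactly one of
  \<open>S\<close> and \<open>T\<close> contributes a centred factor of mean 0; if
  \<open>S = T\<close>, each of its cells contributes the variance \<open>r i\<close>.\<close>

lemma cprod_mult:
  assumes "S \<subseteq> I" "T \<subseteq> I"
  shows "integrable P (\<lambda>v. cprod S v * cprod T v)"
    and "(\<integral>v. cprod S v * cprod T v \<partial>P) = (if S = T then w S else 0)"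
proof -
  define f where "f i n = (if i \<in> S then real n - r i else 1) * (if i \<in> T then real n - r i else 1)"
    for i n
  have eq: "cprod S v * cprod T v = (\<Prod>i\<in>I. f i (v i))" for v
  proof -
    have "cprod S v = (\<Prod>i\<in>I. if i \<in> S then real (v i) - r i else 1)"
      "cprod T v = (\<Prod>i\<in>I. if i \<in> T then real (v i) - r i else 1)"
      unfolding cprod_def using assms finite_I
      by (simp_all add: prod.If_cases Int_absorb1)
    then show ?thesis by (simp add: f_def prod.distrib)
  qed
  have f_eq: "f i = (if i \<in> S \<and> i \<in> T then (\<lambda>n. (real n - r i)\<^sup>2)
      else if i \<in> S \<or> i \<in> T then (\<lambda>n. real n - r i) else (\<lambda>_. 1))" for i
    by (auto simp: f_def power2_eq_square)
  have int: "integrable (pois (r i)) (f i)" for i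
    unfolding f_eq using pois_centered[OF r_nonneg[of i]] by auto
  have E: "(\<integral>n. f i n \<partial>pois (r i)) = (if i \<in> S \<and> i \<in> T then r i else if i \<in> S \<or> i \<in> T then 0 else 1)" for i
    unfolding f_eq using pois_centered[OF r_nonneg[of i]] by auto
  show "integrable P (\<lambda>v. cprod S v * cprod T v)"
    unfolding eq P_def by (intro integrable_prod_Pi_pmf finite_I int)
  have "(\<integral>v. cprod S v * cprod T v \<partial>P)
      = (\<Prod>i\<in>I. if i \<in> S \<and> i \<in> T then r i else if i \<in> S \<or> i \<in> T then 0 else 1)"
    unfolding eq P_def by (subst expectation_prod_Pi_pmf') (auto simp: finite_I int E)
  also have "\<dots> = (if S = T then w S else 0)"
  proof (cases "S = T")
    case True
    then show ?thesis using assms finite_I by (simp add: w_def prod.If_cases Int_absorb1)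
  next
    case False
    then obtain i where "i \<in> I" "(i \<in> S) \<noteq> (i \<in> T)" using assms by blast
    then show ?thesis using finite_I False by (auto intro!: prod_zero)
  qed
  finally show "(\<integral>v. cprod S v * cprod T v \<partial>P) = (if S = T then w S else 0)" .
qed

lemma chaos_isometry:
  assumes "\<S> \<subseteq> Pow I"
  shows "integrable P (\<lambda>v. (\<Sum>S\<in>\<S>. c S * cprod S v)\<^sup>2)"
    and "(\<integral>v. (\<Sum>S\<in>\<S>. c S * cprod S v)\<^sup>2 \<partial>P) = (\<Sum>S\<in>\<S>. w S * (c S)\<^sup>2)"
proof -
  have fin: "finite \<S>" using assms finite_I by (meson finite_Pow_iff finite_subset)
  have eq: "(\<Sum>S\<in>\<S>. c S * cprod S v)\<^sup>2 = (\<Sum>S\<in>\<S>. \<Sum>T\<in>\<S>. c S * c T * (cprod S v * cprod T v))" for v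
    by (simp add: power2_eq_square sum_product mult_ac)
  have int: "integrable P (\<lambda>v. c S * c T * (cprod S v * cprod T v))" if "S \<in> \<S>" "T \<in> \<S>" for S T
    using assms that by (intro integrable_mult_right cprod_mult) auto
  show "integrable P (\<lambda>v. (\<Sum>S\<in>\<S>. c S * cprod S v)\<^sup>2)"
    unfolding eq by (intro Bochner_Integration.integrable_sum int)
  have "(\<integral>v. (\<Sum>S\<in>\<S>. c S * cprod S v)\<^sup>2 \<partial>P)
      = (\<Sum>S\<in>\<S>. \<Sum>T\<in>\<S>. c S * c T * (\<integral>v. cprod S v * cprod T v \<partial>P))"
    unfolding eq using int
    by (subst Bochner_Integration.integral_sum; simp)+
  also have "\<dots> = (\<Sum>S\<in>\<S>. \<Sum>T\<in>\<S>. if S = T then w S * (c S)\<^sup>2 else 0)"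
    using assms by (intro sum.cong refl) (auto simp: cprod_mult(2) subset_iff power2_eq_square)
  also have "\<dots> = (\<Sum>S\<in>\<S>. w S * (c S)\<^sup>2)"
    using fin by simp
  finally show "(\<integral>v. (\<Sum>S\<in>\<S>. c S * cprod S v)\<^sup>2 \<partial>P) = (\<Sum>S\<in>\<S>. w S * (c S)\<^sup>2)" .
qed

text \<open>Each factor is split as (v i - r i) + r i. This is the finite chaos expansion of a
  product of counts.\<close>

lemma prod_eq_sum_cprod:
  assumes "finite S"
  shows "(\<Prod>i\<in>S. real (v i)) = (\<Sum>J\<in>Pow S. cprod J v * w (S - J))"
  using prod_add[OF assms, of "\<lambda>i. real (v i) - r i" r] by (simp add: cprod_def w_def)

section \<open>The Mecke formula for a Poisson vector\<close>

lemma mecke_single: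
  assumes "i \<in> I"
  shows "(\<integral>\<^sup>+v. of_nat (v i) * g v \<partial>P) = ennreal (r i) * (\<integral>\<^sup>+v. g (v(i := Suc (v i))) \<partial>P)"
proof -
  have P_eq: "P = map_pmf (\<lambda>(y, f). f(i := y)) (pair_pmf (pois (r i)) (Pi_pmf (I - {i}) 0 (\<lambda>i. pois (r i))))"
    unfolding P_def using Pi_pmf_insert[of "I - {i}" i 0 "\<lambda>i. pois (r i)"] finite_I assms
    by (simp add: insert_absorb)
  let ?Q = "measure_pmf (Pi_pmf (I - {i}) 0 (\<lambda>i. pois (r i)))"
  \<comment> \<open>Coordinate \<open>i\<close> is integrated innermost, so that the one-variable
    formula applies with all others frozen.\<close>
  have swap: "(\<integral>\<^sup>+v. h v \<partial>P) = (\<integral>\<^sup>+f. \<integral>\<^sup>+y. h (f(i := y)) \<partial>pois (r i) \<partial>?Q)" for h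
  proof -
    have "(\<integral>\<^sup>+v. h v \<partial>P) = (\<integral>\<^sup>+z. h ((snd z)(i := fst z)) \<partial>pair_pmf (pois (r i)) (Pi_pmf (I - {i}) 0 (\<lambda>i. pois (r i))))"
      unfolding P_eq by (simp add: case_prod_unfold)
    also have "\<dots> = (\<integral>\<^sup>+z. h ((fst z)(i := snd z)) \<partial>pair_pmf (Pi_pmf (I - {i}) 0 (\<lambda>i. pois (r i))) (pois (r i)))"
      by (subst pair_commute_pmf) (simp add: case_prod_unfold)
    also have "\<dots> = (\<integral>\<^sup>+f. \<integral>\<^sup>+y. h (f(i := y)) \<partial>pois (r i) \<partial>?Q)"
      by (simp add: nn_integral_pair_pmf')
    finally show ?thesis .
  qed
  have "(\<integral>\<^sup>+v. of_nat (v i) * g v \<partial>P) = (\<integral>\<^sup>+f. \<integral>\<^sup>+y. of_nat y * g (f(i := y)) \<partial>pois (r i) \<partial>?Q)"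
    by (subst swap) simp
  also have "\<dots> = (\<integral>\<^sup>+f. ennreal (r i) * (\<integral>\<^sup>+y. g (f(i := Suc y)) \<partial>pois (r i)) \<partial>?Q)"
    by (simp add: nn_integral_pois_mecke[OF r_nonneg])
  also have "\<dots> = ennreal (r i) * (\<integral>\<^sup>+f. \<integral>\<^sup>+y. g (f(i := Suc y)) \<partial>pois (r i) \<partial>?Q)"
    by (simp add: nn_integral_cmult)
  also have "\<dots> = ennreal (r i) * (\<integral>\<^sup>+v. g (v(i := Suc (v i))) \<partial>P)"
    by (subst swap) simp
  finally show ?thesis .
qed

definition shift :: "'i set \<Rightarrow> ('i \<Rightarrow> nat) \<Rightarrow> 'i \<Rightarrow> nat" where
  "shift S v i = (if i \<in> S then Suc (v i) else v i)"

text \<open>The one-cell formula is applied once per cell. Raising \<open>j\<close> leaves the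
  product over the remaining cells unchanged, since \<open>j\<close> is not among them, so no
  correction terms arise.\<close>

lemma mecke:
  assumes "S \<subseteq> I"
  shows "(\<integral>\<^sup>+v. of_nat (\<Prod>i\<in>S. v i) * g v \<partial>P) = ennreal (w S) * (\<integral>\<^sup>+v. g (shift S v) \<partial>P)"
  using finite_subset_I[OF assms] assms
proof (induction S arbitrary: g rule: finite_induct)
  case empty
  have "shift {} = (\<lambda>v. v)" by (auto simp: shift_def fun_eq_iff)
  then show ?case by (simp add: w_def)
next
  case (insert j S)
  have pr: "(\<Prod>i\<in>S. (v(j := Suc (v j))) i) = (\<Prod>i\<in>S. v i)" for v :: "'i \<Rightarrow> nat"
    using insert.hyps by (intro prod.cong) auto
  have "(\<integral>\<^sup>+v. of_nat (\<Prod>i\<in>insert j S. v i) * g v \<partial>P)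
      = (\<integral>\<^sup>+v. of_nat (v j) * (of_nat (\<Prod>i\<in>S. v i) * g v) \<partial>P)"
    using insert.hyps by (simp add: mult.assoc)
  also have "\<dots> = ennreal (r j) * (\<integral>\<^sup>+v. of_nat (\<Prod>i\<in>S. v i) * g (v(j := Suc (v j))) \<partial>P)"
    using insert.prems by (subst mecke_single) (simp_all only: pr, auto)
  also have "\<dots> = ennreal (r j) * (ennreal (w S) * (\<integral>\<^sup>+v. g (shift (insert j S) v) \<partial>P))"
  proof -
    have "(shift S v)(j := Suc (shift S v j)) = shift (insert j S) v" for v
      using insert.hyps by (auto simp: shift_def)
    then show ?thesis using insert.prems by (subst insert.IH) auto
  qed
  also have "\<dots> = ennreal (w (insert j S)) * (\<integral>\<^sup>+v. g (shift (insert j S) v) \<partial>P)"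
    using insert.hyps w_nonneg[of S] by (simp add: w_def ennreal_mult r_nonneg mult.assoc)
  finally show ?case .
qed

section \<open>U-statistics of the counts and their chaos components\<close>

definition U :: "'i set set \<Rightarrow> ('i \<Rightarrow> nat) \<Rightarrow> nat" where
  "U \<S> v = (\<Sum>S\<in>\<S>. \<Prod>i\<in>S. v i)"

text \<open>The coefficient of \<open>cprod J\<close> in the chaos expansion of \<open>U\<close>:
  what is left of the members above \<open>J\<close> when their cells outside \<open>J\<close> are
  averaged.\<close>

definition H :: "'i set set \<Rightarrow> 'i set \<Rightarrow> real" where
  "H \<S> J = (\<Sum>S\<in>{S\<in>\<S>. J \<subseteq> S}. w (S - J))"

definition mid :: "nat \<Rightarrow> 'i set set" where
  "mid q = {J. J \<subseteq> I \<and> 1 \<le> card J \<and> card J < q}"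

text \<open>For a family of \<open>q\<close>-element sets, the part of the variance of
  \<open>U\<close> carried by the chaos orders strictly between 0 and \<open>q\<close>.\<close>

definition excess :: "'i set set \<Rightarrow> nat \<Rightarrow> real" where
  "excess \<S> q = (\<Sum>J\<in>mid q. w J * (H \<S> J)\<^sup>2)"

lemma H_nonneg: "0 \<le> H \<S> J"
  unfolding H_def by (intro sum_nonneg w_nonneg)

lemma finite_family: "\<S> \<subseteq> Pow I \<Longrightarrow> finite \<S>"
  using finite_I by (meson finite_Pow_iff finite_subset)

lemma w_Un_Diff: "J \<subseteq> S \<Longrightarrow> S \<subseteq> I \<Longrightarrow> w J * w (S - J) = w S"
  unfolding w_def using prod.subset_diff[of J S r] finite_subset_I by (simp add: mult.commute)

lemma U_eq_chaos:
  assumes "\<S> \<subseteq> Pow I"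
  shows "real (U \<S> v) = (\<Sum>J\<in>Pow I. H \<S> J * cprod J v)"
proof -
  have "real (U \<S> v) = (\<Sum>S\<in>\<S>. \<Sum>J\<in>Pow S. cprod J v * w (S - J))"
    unfolding U_def of_nat_sum of_nat_prod using assms finite_subset_I
    by (intro sum.cong refl prod_eq_sum_cprod) auto
  also have "\<dots> = (\<Sum>S\<in>\<S>. \<Sum>J\<in>{J\<in>Pow I. J \<subseteq> S}. cprod J v * w (S - J))"
    using assms by (intro sum.cong) auto
  also have "\<dots> = (\<Sum>J\<in>Pow I. \<Sum>S\<in>{S\<in>\<S>. J \<subseteq> S}. cprod J v * w (S - J))"
    using finite_family[OF assms] finite_I by (intro sum.swap_restrict) auto
  also have "\<dots> = (\<Sum>J\<in>Pow I. H \<S> J * cprod J v)"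
    by (simp add: H_def sum_distrib_left mult.commute)
  finally show ?thesis .
qed

text \<open>All members have \<open>q\<close> cells, so none contains another: \<open>H\<close> is 1
  on members, 0 on other sets with at least \<open>q\<close> cells, and the mean at the empty set.
  The order-\<open>q\<close> part has variance \<open>sum w \<S>\<close>, equal to the mean, because
  its coefficients satisfy 1^2 = 1.\<close>

lemma
  assumes S: "\<And>S. S \<in> \<S> \<Longrightarrow> S \<subseteq> I \<and> card S = q" and q: "1 \<le> q"
  shows U_centered: "real (U \<S> v) - sum w \<S> - (\<Sum>S\<in>\<S>. cprod S v) = (\<Sum>J\<in>mid q. H \<S> J * cprod J v)"
    and U_centered_sq: "integrable P (\<lambda>v. (real (U \<S> v) - sum w \<S>)\<^sup>2)"
      "(\<integral>v. (real (U \<S> v) - sum w \<S>)\<^sup>2 \<partial>P) = excess \<S> q + sum w \<S>"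
proof -
  have sub: "\<S> \<subseteq> Pow I" using S by auto
  have fin: "finite (mid q)" using finite_I by (auto simp: mid_def)
  have finS: "finite \<S>" using sub by (rule finite_family)
  have H_empty: "H \<S> {} = sum w \<S>" by (simp add: H_def)
  have H_S: "H \<S> J = 1" if "J \<in> \<S>" for J
  proof -
    have "T = J" if "T \<in> \<S>" "J \<subseteq> T" for T
      using S[OF \<open>J \<in> \<S>\<close>] S[OF \<open>T \<in> \<S>\<close>] \<open>J \<subseteq> T\<close> finite_subset_I[of T] card_subset_eq[of T J] by auto
    then have "{S\<in>\<S>. J \<subseteq> S} = {J}" using that by auto
    then show ?thesis by (simp add: H_def w_def)
  qed
  have H_0: "H \<S> J = 0" if "J \<subseteq> I" "J \<notin> mid q" "J \<noteq> {}" "J \<notin> \<S>" for J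
  proof -
    have fJ: "finite J" using that finite_subset_I by auto
    have "card J \<ge> q" using that fJ by (auto simp: mid_def Suc_le_eq card_gt_0_iff)
    have "\<not> J \<subseteq> T" if T: "T \<in> \<S>" for T
    proof
      assume "J \<subseteq> T"
      moreover have "finite T" using S[OF T] finite_subset_I by auto
      ultimately have "J = T" using \<open>card J \<ge> q\<close> S[OF T] card_seteq[of T J] by auto
      then show False using T \<open>J \<notin> \<S>\<close> by simp
    qed
    then have "{S\<in>\<S>. J \<subseteq> S} = {}" by auto
    then show ?thesis unfolding H_def by (simp only: sum.empty)
  qed
  have disj: "mid q \<inter> \<S> = {}" using S by (auto simp: mid_def)
  have emp: "{} \<notin> mid q" "{} \<notin> \<S>" using S[of "{}"] q by (auto simp: mid_def)
  have split: "(\<Sum>J\<in>Pow I. H \<S> J * cprod J v) = (\<Sum>J\<in>insert {} (mid q \<union> \<S>). H \<S> J * cprod J v)" for v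
    using sub finite_I by (intro sum.mono_neutral_right) (auto simp: mid_def H_0)
  have U: "real (U \<S> v) = sum w \<S> + ((\<Sum>J\<in>mid q. H \<S> J * cprod J v) + (\<Sum>S\<in>\<S>. cprod S v))" for v
    unfolding U_eq_chaos[OF sub] split using fin finS disj emp
    by (simp add: sum.union_disjoint H_empty H_S cprod_def[of "{}"])
  then show "real (U \<S> v) - sum w \<S> - (\<Sum>S\<in>\<S>. cprod S v) = (\<Sum>J\<in>mid q. H \<S> J * cprod J v)"
    by simp
  have U': "real (U \<S> v) - sum w \<S> = (\<Sum>J\<in>mid q \<union> \<S>. H \<S> J * cprod J v)" for v
    using U[of v] fin finS disj by (simp add: sum.union_disjoint H_S)
  have sub': "mid q \<union> \<S> \<subseteq> Pow I" using sub by (auto simp: mid_def)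
  show "integrable P (\<lambda>v. (real (U \<S> v) - sum w \<S>)\<^sup>2)"
    unfolding U' by (rule chaos_isometry[OF sub'])
  show "(\<integral>v. (real (U \<S> v) - sum w \<S>)\<^sup>2 \<partial>P) = excess \<S> q + sum w \<S>"
    unfolding U' chaos_isometry(2)[OF sub'] excess_def using fin finS disj
    by (simp add: sum.union_disjoint H_S)
qed

lemma prod_Suc_ge: "finite S \<Longrightarrow> S \<noteq> {} \<Longrightarrow> Suc (\<Prod>i\<in>S. v i) \<le> (\<Prod>i\<in>S. Suc (v i))"
proof (induction S rule: finite_ne_induct)
  case (insert x F)
  have "Suc (v x * prod v F) \<le> Suc (v x) * Suc (prod v F)" by simp
  also have "\<dots> \<le> Suc (v x) * (\<Prod>i\<in>F. Suc (v i))" using insert by (intro mult_le_mono) auto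
  finally show ?case using insert by simp
qed simp

text \<open>The product over \<open>S\<close> itself gains at least one when all its factors are
  raised, and no other product decreases.\<close>

lemma U_shift_ge:
  assumes "\<S> \<subseteq> Pow I" "S \<in> \<S>" "S \<noteq> {}"
  shows "Suc (U \<S> v) \<le> U \<S> (shift S v)"
proof -
  have fin: "finite \<S>" "finite S" using assms finite_family finite_subset_I by auto
  have "Suc (U \<S> v) = Suc (\<Prod>i\<in>S. v i) + (\<Sum>T\<in>\<S> - {S}. \<Prod>i\<in>T. v i)"
    unfolding U_def using fin assms by (subst sum.remove[of _ S]) auto
  also have "\<dots> \<le> (\<Prod>i\<in>S. shift S v i) + (\<Sum>T\<in>\<S> - {S}. \<Prod>i\<in>T. shift S v i)"
  proof (rule add_mono)
    have "(\<Prod>i\<in>S. shift S v i) = (\<Prod>i\<in>S. Suc (v i))" by (intro prod.cong) (auto simp: shift_def)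
    then show "Suc (\<Prod>i\<in>S. v i) \<le> (\<Prod>i\<in>S. shift S v i)" using prod_Suc_ge fin assms by simp
    show "(\<Sum>T\<in>\<S> - {S}. \<Prod>i\<in>T. v i) \<le> (\<Sum>T\<in>\<S> - {S}. \<Prod>i\<in>T. shift S v i)"
      by (intro sum_mono prod_mono) (auto simp: shift_def)
  qed
  also have "\<dots> = U \<S> (shift S v)"
    unfolding U_def using fin assms by (subst (2) sum.remove[of _ S]) auto
  finally show ?thesis .
qed

lemma U_mecke:
  assumes "\<S> \<subseteq> Pow I"
  shows "(\<integral>\<^sup>+v. of_nat (U \<S> v) * g v \<partial>P) = (\<Sum>S\<in>\<S>. ennreal (w S) * (\<integral>\<^sup>+v. g (shift S v) \<partial>P))"
proof -
  have "(\<integral>\<^sup>+v. of_nat (U \<S> v) * g v \<partial>P) = (\<integral>\<^sup>+v. (\<Sum>S\<in>\<S>. of_nat (\<Prod>i\<in>S. v i) * g v) \<partial>P)"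
    by (simp add: U_def sum_distrib_right)
  also have "\<dots> = (\<Sum>S\<in>\<S>. \<integral>\<^sup>+v. of_nat (\<Prod>i\<in>S. v i) * g v \<partial>P)"
    by (rule nn_integral_sum) simp
  also have "\<dots> = (\<Sum>S\<in>\<S>. ennreal (w S) * (\<integral>\<^sup>+v. g (shift S v) \<partial>P))"
    using assms by (intro sum.cong refl mecke) auto
  finally show ?thesis .
qed

text \<open>By the Mecke formula, \<open>E U\<^sup>2 = \<Sum>S. w S * E (U (v + 1\<^sub>S))\<close>, so the expected excess of
  \<open>U (v + 1\<^sub>S)\<close> over \<open>U v + 1\<close>, averaged over \<open>S\<close>, is the variance of \<open>U\<close> minus its mean.\<close>

lemma stein_chen_U:
  assumes S: "\<And>S. S \<in> \<S> \<Longrightarrow> S \<subseteq> I \<and> card S = q" and q: "1 \<le> q"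
  shows "\<bar>real (Suc k) * measure P {v. U \<S> v = Suc k} - sum w \<S> * measure P {v. U \<S> v = k}\<bar>
    \<le> excess \<S> q"
proof -
  have sub: "\<S> \<subseteq> Pow I" using S by auto
  have ne: "S \<noteq> {}" if "S \<in> \<S>" for S using S[OF that] q by auto
  let ?l = "sum w \<S>"
  have l0: "0 \<le> ?l" by (intro sum_nonneg w_nonneg)
  have wsum: "(\<Sum>S\<in>\<S>. ennreal (w S)) = ennreal ?l"
    by (intro sum_ennreal w_nonneg)
  have mean: "(\<integral>\<^sup>+v. of_nat (U \<S> v) \<partial>P) = ennreal ?l"
    using U_mecke[OF sub, of "\<lambda>_. 1"] wsum by simp
  have exc0: "0 \<le> excess \<S> q" unfolding excess_def by (intro sum_nonneg mult_nonneg_nonneg w_nonneg) auto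
  have sq: "(\<integral>\<^sup>+v. of_nat (U \<S> v) * of_nat (U \<S> v) \<partial>P) = ennreal (excess \<S> q + ?l + ?l\<^sup>2)"
  proof -
    have hb: "has_bochner_integral P (\<lambda>v. real (U \<S> v)) ?l"
      using mean l0 by (intro has_bochner_integral_nn_integral) (auto simp: ennreal_of_nat_eq_real_of_nat)
    have eq: "(\<lambda>v. real (U \<S> v) * real (U \<S> v))
        = (\<lambda>v. (real (U \<S> v) - ?l)\<^sup>2 + 2 * ?l * real (U \<S> v) - ?l\<^sup>2)"
      by (auto simp: power2_eq_square algebra_simps)
    have "has_bochner_integral P (\<lambda>v. real (U \<S> v) * real (U \<S> v)) (excess \<S> q + ?l + ?l\<^sup>2)"
      unfolding eq using hb U_centered_sq[OF S q]
      by (auto simp: has_bochner_integral_iff power2_eq_square)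
    then have "(\<integral>\<^sup>+v. ennreal (real (U \<S> v) * real (U \<S> v)) \<partial>P) = ennreal (excess \<S> q + ?l + ?l\<^sup>2)"
      by (subst nn_integral_eq_integral) (auto simp: has_bochner_integral_iff)
    then show ?thesis by (simp add: ennreal_mult ennreal_of_nat_eq_real_of_nat)
  qed
  \<comment> \<open>Truncated subtraction loses nothing for members \<open>S\<close>, because
    \<open>U_shift_ge\<close> bounds the shifted count from below by
    \<open>Suc (U \<S> v)\<close>.\<close>
  define R where "R S v = U \<S> (shift S v) - Suc (U \<S> v)" for S v
  have R: "U \<S> (shift S v) = R S v + Suc (U \<S> v)" if "S \<in> \<S>" for S v
    using U_shift_ge[OF sub that ne[OF that], of v] by (simp add: R_def)
  have "ennreal (excess \<S> q + ?l + ?l\<^sup>2) = (\<Sum>S\<in>\<S>. ennreal (w S) * (\<integral>\<^sup>+v. of_nat (U \<S> (shift S v)) \<partial>P))"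
    using sq U_mecke[OF sub, of "\<lambda>v. of_nat (U \<S> v)"] by simp
  also have "\<dots> = (\<Sum>S\<in>\<S>. ennreal (w S) * ((\<integral>\<^sup>+v. of_nat (R S v) \<partial>P) + (ennreal ?l + 1)))"
  proof (intro sum.cong refl arg_cong2[where f = times])
    fix S assume "S \<in> \<S>"
    then have "(\<integral>\<^sup>+v. of_nat (U \<S> (shift S v)) \<partial>P) = (\<integral>\<^sup>+v. of_nat (R S v) + (of_nat (U \<S> v) + 1) \<partial>P)"
      by (simp add: R add_ac)
    also have "\<dots> = (\<integral>\<^sup>+v. of_nat (R S v) \<partial>P) + ((\<integral>\<^sup>+v. of_nat (U \<S> v) \<partial>P) + 1)"
      by (simp add: nn_integral_add)
    finally show "(\<integral>\<^sup>+v. of_nat (U \<S> (shift S v)) \<partial>P) = (\<integral>\<^sup>+v. of_nat (R S v) \<partial>P) + (ennreal ?l + 1)"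
      by (simp add: mean)
  qed
  also have "\<dots> = (\<Sum>S\<in>\<S>. ennreal (w S) * (\<integral>\<^sup>+v. of_nat (R S v) \<partial>P)) + ennreal (?l + ?l\<^sup>2)"
    using l0 by (simp add: distrib_left sum.distrib sum_distrib_right[symmetric] wsum ennreal_plus
        ennreal_mult power2_eq_square add_ac)
  finally have exc: "ennreal (excess \<S> q) = (\<Sum>S\<in>\<S>. ennreal (w S) * (\<integral>\<^sup>+v. of_nat (R S v) \<partial>P))"
  proof -
    assume *: "ennreal (excess \<S> q + ?l + ?l\<^sup>2)
      = (\<Sum>S\<in>\<S>. ennreal (w S) * (\<integral>\<^sup>+v. of_nat (R S v) \<partial>P)) + ennreal (?l + ?l\<^sup>2)"
    have "ennreal (excess \<S> q + ?l + ?l\<^sup>2) = ennreal (excess \<S> q) + ennreal (?l + ?l\<^sup>2)"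
      using exc0 l0 ennreal_plus[of "excess \<S> q" "?l + ?l\<^sup>2"] by (simp only: add.assoc) simp
    with * show ?thesis
      using ennreal_add_left_cancel[of "ennreal (?l + ?l\<^sup>2)"] by (simp only: add.commute) simp
  qed
  let ?b = "\<lambda>S. measure P {v. U \<S> (shift S v) \<noteq> Suc (U \<S> v)}"
  \<comment> \<open>Markov's inequality: \<open>R S\<close> is a natural number, so its mean bounds
    the probability that it is nonzero.\<close>
  have bad: "(\<Sum>S\<in>\<S>. w S * ?b S) \<le> excess \<S> q"
  proof -
    have "ennreal (\<Sum>S\<in>\<S>. w S * ?b S) = (\<Sum>S\<in>\<S>. ennreal (w S) * emeasure P {v. U \<S> (shift S v) \<noteq> Suc (U \<S> v)})"
      by (subst sum_ennreal[symmetric]) (auto simp: w_nonneg ennreal_mult measure_pmf.emeasure_eq_measure)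
    also have "\<dots> \<le> (\<Sum>S\<in>\<S>. ennreal (w S) * (\<integral>\<^sup>+v. of_nat (R S v) \<partial>P))"
    proof (intro sum_mono mult_left_mono)
      fix S assume "S \<in> \<S>"
      have "emeasure P {v. U \<S> (shift S v) \<noteq> Suc (U \<S> v)} = (\<integral>\<^sup>+v. indicator {v. U \<S> (shift S v) \<noteq> Suc (U \<S> v)} v \<partial>P)"
        by simp
      also have "\<dots> \<le> (\<integral>\<^sup>+v. of_nat (R S v) \<partial>P)"
      proof (rule nn_integral_mono)
        fix v
        have "of_nat 1 \<le> (of_nat (R S v) :: ennreal)" if "R S v \<noteq> 0"
          using that by (intro of_nat_mono) simp
        then show "indicator {v. U \<S> (shift S v) \<noteq> Suc (U \<S> v)} v \<le> (of_nat (R S v) :: ennreal)"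
          using R[OF \<open>S \<in> \<S>\<close>, of v] by (auto simp: indicator_def)
      qed
      finally show "emeasure P {v. U \<S> (shift S v) \<noteq> Suc (U \<S> v)} \<le> (\<integral>\<^sup>+v. of_nat (R S v) \<partial>P)" .
    qed auto
    finally show ?thesis unfolding exc[symmetric] using exc0 by simp
  qed
  \<comment> \<open>The Mecke formula for the indicator of U = k + 1, on which the weight
    \<open>U\<close> is the constant k + 1.\<close>
  have main: "real (Suc k) * measure P {v. U \<S> v = Suc k}
      = (\<Sum>S\<in>\<S>. w S * measure P {v. U \<S> (shift S v) = Suc k})"
  proof -
    have "ennreal (real (Suc k) * measure P {v. U \<S> v = Suc k})
        = of_nat (Suc k) * (\<integral>\<^sup>+v. indicator {v. U \<S> v = Suc k} v \<partial>P)"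
      by (simp add: ennreal_mult measure_pmf.emeasure_eq_measure ennreal_of_nat_eq_real_of_nat del: of_nat_Suc)
    also have "\<dots> = (\<integral>\<^sup>+v. of_nat (U \<S> v) * indicator {v. U \<S> v = Suc k} v \<partial>P)"
      by (subst nn_integral_cmult[symmetric]) (auto intro!: nn_integral_cong simp: indicator_def simp del: of_nat_Suc)
    also have "\<dots> = (\<Sum>S\<in>\<S>. ennreal (w S) * (\<integral>\<^sup>+v. indicator {v. U \<S> (shift S v) = Suc k} v \<partial>P))"
    proof -
      have "indicator {v. U \<S> v = Suc k} (shift S v) = (indicator {v. U \<S> (shift S v) = Suc k} v :: ennreal)" for S v
        by (simp add: indicator_def)
      then show ?thesis by (simp only: U_mecke[OF sub])
    qed
    also have "\<dots> = ennreal (\<Sum>S\<in>\<S>. w S * measure P {v. U \<S> (shift S v) = Suc k})"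
      by (subst sum_ennreal[symmetric]) (auto simp: w_nonneg ennreal_mult measure_pmf.emeasure_eq_measure)
    finally show ?thesis
      by (subst (asm) ennreal_inj) (auto intro!: sum_nonneg mult_nonneg_nonneg w_nonneg)
  qed
  have diff: "\<bar>measure P {v. U \<S> (shift S v) = Suc k} - measure P {v. U \<S> v = k}\<bar> \<le> ?b S" for S
  proof -
    have "measure P {v. U \<S> (shift S v) = Suc k} \<le> measure P ({v. U \<S> v = k} \<union> {v. U \<S> (shift S v) \<noteq> Suc (U \<S> v)})"
      by (intro measure_pmf.finite_measure_mono) auto
    moreover have "measure P {v. U \<S> v = k} \<le> measure P ({v. U \<S> (shift S v) = Suc k} \<union> {v. U \<S> (shift S v) \<noteq> Suc (U \<S> v)})"
      by (intro measure_pmf.finite_measure_mono) auto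
    ultimately show ?thesis
      using measure_Un_le[of "{v. U \<S> v = k}" P "{v. U \<S> (shift S v) \<noteq> Suc (U \<S> v)}"]
        measure_Un_le[of "{v. U \<S> (shift S v) = Suc k}" P "{v. U \<S> (shift S v) \<noteq> Suc (U \<S> v)}"]
      by simp
  qed
  have "\<bar>real (Suc k) * measure P {v. U \<S> v = Suc k} - ?l * measure P {v. U \<S> v = k}\<bar>
      = \<bar>\<Sum>S\<in>\<S>. w S * (measure P {v. U \<S> (shift S v) = Suc k} - measure P {v. U \<S> v = k})\<bar>"
    unfolding main by (simp add: sum_distrib_right sum_subtractf right_diff_distrib)
  also have "\<dots> \<le> (\<Sum>S\<in>\<S>. w S * ?b S)"
    by (rule order_trans[OF sum_abs]) (intro sum_mono, simp add: abs_mult w_nonneg mult_left_mono diff)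
  finally show ?thesis using bad by simp
qed

section \<open>Rounding the coefficients and pruning the family\<close>

text \<open>Discarding the members of \<open>upper\<close> that contain a heavy set makes the excess small.\<close>

definition layer :: "nat \<Rightarrow> 'i set set" where
  "layer q = {S. S \<subseteq> I \<and> card S = q}"

definition upper :: "nat \<Rightarrow> ('i set \<Rightarrow> real) \<Rightarrow> 'i set set" where
  "upper q a = {S \<in> layer q. a S > 1/2}"

definition heavy :: "nat \<Rightarrow> ('i set \<Rightarrow> real) \<Rightarrow> real \<Rightarrow> 'i set set" where
  "heavy q a \<epsilon> = {J \<in> mid q. H (upper q a) J > \<epsilon>}"

definition sparse :: "nat \<Rightarrow> ('i set \<Rightarrow> real) \<Rightarrow> real \<Rightarrow> 'i set set" where
  "sparse q a \<epsilon> = {S \<in> upper q a. \<forall>J\<in>heavy q a \<epsilon>. \<not> J \<subseteq> S}"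

lemma finite_mid: "finite (mid q)" and finite_layer: "finite (layer q)"
  using finite_I by (auto simp: mid_def layer_def)

lemma H_mono: "\<S> \<subseteq> \<T> \<Longrightarrow> finite \<T> \<Longrightarrow> H \<S> J \<le> H \<T> J"
  unfolding H_def by (intro sum_mono2) (auto simp: w_nonneg)

lemma sum_w_H:
  assumes "\<S> \<subseteq> Pow I"
  shows "w J * H \<S> J = (\<Sum>S\<in>{S\<in>\<S>. J \<subseteq> S}. w S)"
  unfolding H_def sum_distrib_left using assms by (intro sum.cong refl w_Un_Diff) auto

text \<open>If some member of the pruned family contains \<open>J\<close>, then \<open>J\<close> is
  not heavy, so one factor \<open>H\<close> of the square is at most \<epsilon>. What is left sums
  \<open>w S\<close> over pairs of a member and a subset of it, with at most 2^q subsets for each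
  member.\<close>

lemma excess_sparse:
  assumes "0 \<le> \<epsilon>"
  shows "excess (sparse q a \<epsilon>) q \<le> \<epsilon> * 2 ^ q * sum w (sparse q a \<epsilon>)"
proof -
  let ?A = "sparse q a \<epsilon>"
  have sub: "?A \<subseteq> Pow I" "finite ?A" "finite (upper q a)" "?A \<subseteq> upper q a"
    using finite_layer[of q] finite_I by (auto simp: sparse_def upper_def layer_def)
  have H_le: "H ?A J \<le> \<epsilon>" if J: "J \<in> mid q" for J
  proof (cases "{S\<in>?A. J \<subseteq> S} = {}")
    case True
    then show ?thesis using assms unfolding H_def by (simp only: sum.empty)
  next
    case False
    then have "J \<notin> heavy q a \<epsilon>" by (auto simp: sparse_def)
    then have "H (upper q a) J \<le> \<epsilon>" using J by (auto simp: heavy_def)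
    then show ?thesis using H_mono[OF sub(4,3), of J] by simp
  qed
  have "excess ?A q \<le> (\<Sum>J\<in>mid q. \<epsilon> * (w J * H ?A J))"
    unfolding excess_def
  proof (rule sum_mono)
    fix J assume "J \<in> mid q"
    then have "H ?A J * H ?A J \<le> \<epsilon> * H ?A J" using H_le H_nonneg by (intro mult_right_mono) auto
    then have "w J * (H ?A J * H ?A J) \<le> w J * (\<epsilon> * H ?A J)" by (intro mult_left_mono w_nonneg)
    then show "w J * (H ?A J)\<^sup>2 \<le> \<epsilon> * (w J * H ?A J)" by (simp add: power2_eq_square mult_ac)
  qed
  also have "\<dots> = \<epsilon> * (\<Sum>J\<in>mid q. \<Sum>S\<in>{S\<in>?A. J \<subseteq> S}. w S)"
    by (simp add: sum_distrib_left[symmetric] sum_w_H[OF sub(1)])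
  also have "\<dots> = \<epsilon> * (\<Sum>S\<in>?A. \<Sum>J\<in>{J\<in>mid q. J \<subseteq> S}. w S)"
    using sum.swap_restrict[OF finite_mid[of q] sub(2), of "\<lambda>J S. w S" "\<lambda>J S. J \<subseteq> S"] by simp
  also have "\<dots> \<le> \<epsilon> * (\<Sum>S\<in>?A. 2 ^ q * w S)"
  proof (intro mult_left_mono sum_mono assms)
    fix S assume S: "S \<in> ?A"
    then have fS: "finite S" "card S = q" using sub(1) finite_subset_I by (auto simp: sparse_def upper_def layer_def)
    have "card {J\<in>mid q. J \<subseteq> S} \<le> card (Pow S)" using fS by (intro card_mono) auto
    then have "real (card {J\<in>mid q. J \<subseteq> S}) \<le> 2 ^ q" using fS by (simp add: card_Pow flip: of_nat_le_iff)
    then show "(\<Sum>J\<in>{J\<in>mid q. J \<subseteq> S}. w S) \<le> 2 ^ q * w S"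
      using w_nonneg by (simp add: mult_right_mono)
  qed
  finally show ?thesis by (simp add: sum_distrib_left mult_ac)
qed

text \<open>The error splits into rounding and pruning. Each pruned set contains a heavy
  \<open>J\<close>, so the pruned mass is at most the mass above each heavy \<open>J\<close>, summed
  over \<open>J\<close>.\<close>

lemma sparse_approx:
  "(\<Sum>S\<in>layer q. w S * (a S - indicator (sparse q a \<epsilon>) S)\<^sup>2)
    \<le> 2 * (\<Sum>S\<in>layer q. w S * (a S - (if a S > 1/2 then 1 else 0))\<^sup>2)
      + 2 * (\<Sum>J\<in>heavy q a \<epsilon>. w J * H (upper q a) J)"
proof -
  let ?A = "sparse q a \<epsilon>" and ?B = "upper q a" and ?G = "heavy q a \<epsilon>"
  have sub: "?B \<subseteq> Pow I" "finite ?B" "?A \<subseteq> ?B" "?B \<subseteq> layer q" "finite ?G"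
    using finite_layer[of q] finite_mid finite_I by (auto simp: sparse_def upper_def layer_def heavy_def)
  have pt: "(a S - indicator ?A S)\<^sup>2 \<le> 2 * (a S - (if a S > 1/2 then 1 else 0))\<^sup>2 + 2 * indicator (?B - ?A) S"
    if "S \<in> layer q" for S
  proof -
    \<comment> \<open>The case of a pruned set: its rounded value is 1, its final coefficient
      0.\<close>
    have "x\<^sup>2 \<le> 2 * (x - 1)\<^sup>2 + 2" for x :: real
      using zero_le_power2[of "x - 2"] by (simp add: power2_eq_square algebra_simps)
    then show ?thesis using that sub(3)
      by (auto simp: indicator_def upper_def)
  qed
  have "(\<Sum>S\<in>layer q. w S * (a S - indicator ?A S)\<^sup>2)
      \<le> (\<Sum>S\<in>layer q. w S * (2 * (a S - (if a S > 1/2 then 1 else 0))\<^sup>2 + 2 * indicator (?B - ?A) S))"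
    by (intro sum_mono mult_left_mono pt w_nonneg)
  also have "\<dots> = 2 * (\<Sum>S\<in>layer q. w S * (a S - (if a S > 1/2 then 1 else 0))\<^sup>2)
      + 2 * (\<Sum>S\<in>layer q. w S * indicator (?B - ?A) S)"
    by (simp add: sum.distrib sum_distrib_left algebra_simps)
  also have "(\<Sum>S\<in>layer q. w S * indicator (?B - ?A) S) = sum w (?B - ?A)"
    using sub finite_layer sum.mono_neutral_right[of "layer q" "?B - ?A" "\<lambda>S. w S * indicator (?B - ?A) S"]
    by (auto intro!: sum.cong)
  also have "sum w (?B - ?A) \<le> (\<Sum>S\<in>?B - ?A. \<Sum>J\<in>{J\<in>?G. J \<subseteq> S}. w S)"
  proof (rule sum_mono)
    fix S assume "S \<in> ?B - ?A"
    then obtain J where "J \<in> {J\<in>?G. J \<subseteq> S}" by (auto simp: sparse_def)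
    then show "w S \<le> (\<Sum>J\<in>{J\<in>?G. J \<subseteq> S}. w S)"
      using sub by (intro member_le_sum) (auto simp: w_nonneg)
  qed
  also have "\<dots> \<le> (\<Sum>S\<in>?B. \<Sum>J\<in>{J\<in>?G. J \<subseteq> S}. w S)"
    using sub by (intro sum_mono2) (auto simp: w_nonneg)
  also have "\<dots> = (\<Sum>J\<in>?G. sum w {S\<in>?B. J \<subseteq> S})"
    using sum.swap_restrict[OF sub(2,5), of "\<lambda>S J. w S" "\<lambda>S J. J \<subseteq> S"] by simp
  also have "\<dots> = (\<Sum>J\<in>?G. w J * H ?B J)" by (simp add: sum_w_H[OF sub(1)])
  finally show ?thesis by simp
qed

end

section \<open>Counts of a Poisson measure on a grid\<close>

text \<open>The Poisson probabilities of the finite values already add up to 1, which rules out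
  every other value, infinity included.\<close>

lemma poisson_measure_AE_nat:
  assumes pm: "poisson_measure M mu eta" and B: "B \<in> sets mu" "emeasure mu B < \<infinity>"
  shows "AE \<omega> in M. \<exists>k::nat. emeasure (eta \<omega>) B = of_nat k"
proof -
  interpret prob_space M using pm by (simp add: poisson_measure_def)
  have [measurable]: "(\<lambda>\<omega>. emeasure (eta \<omega>) B) \<in> borel_measurable M"
    using pm B by (auto simp: poisson_measure_def)
  let ?E = "\<lambda>k::nat. {\<omega>\<in>space M. emeasure (eta \<omega>) B = of_nat k}"
  let ?r = "measure mu B"
  have E: "?E k \<in> sets M" for k by measurable
  have "(\<lambda>k. measure M (?E k)) sums measure M (\<Union>k. ?E k)"
    using E by (intro finite_measure_UNION) (auto simp: disjoint_family_on_def)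
  moreover have "measure M (?E k) = exp (- ?r) * (?r ^ k /\<^sub>R fact k)" for k
    using pm B by (simp add: poisson_measure_def divide_inverse)
  moreover have "(\<lambda>k. exp (- ?r) * (?r ^ k /\<^sub>R fact k)) sums (exp (- ?r) * exp ?r)"
    by (intro sums_mult exp_converges)
  ultimately have "measure M (\<Union>k. ?E k) = 1"
    using sums_unique2 by (fastforce simp: mult_exp_exp)
  then have "AE \<omega> in M. \<omega> \<in> (\<Union>k. ?E k)"
    using E by (intro AE_prob_1) auto
  then show ?thesis by eventually_elim auto
qed

text \<open>The floor yields a natural number also on the null set where the mass is not an integer,
  and the value 0 from index \<open>m\<close> on matches the default of
  \<open>Pi_pmf\<close>.\<close>

definition counts :: "('w \<Rightarrow> 'z measure) \<Rightarrow> (nat \<Rightarrow> 'z set) \<Rightarrow> nat \<Rightarrow> 'w \<Rightarrow> nat \<Rightarrow> nat" where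
  "counts eta b m \<omega> i = (if i < m then nat \<lfloor>enn2real (emeasure (eta \<omega>) (b i))\<rfloor> else 0)"

text \<open>The function space is uncountable, but both laws are carried by the countable set of
  finitely supported sequences. It therefore suffices to compare point masses, and these factor by
  independence.\<close>

lemma
  assumes pm: "poisson_measure M mu eta"
    and b: "\<And>i. i < m \<Longrightarrow> b i \<in> sets mu" "\<And>i. i < m \<Longrightarrow> emeasure mu (b i) < \<infinity>"
    and disj: "disjoint_family_on b {..<m}"
  shows counts_AE: "AE \<omega> in M. \<forall>i<m. emeasure (eta \<omega>) (b i) = of_nat (counts eta b m \<omega> i)"
    and counts_measurable: "counts eta b m \<in> measurable M (count_space UNIV)"
    and counts_distr: "distr M (count_space UNIV) (counts eta b m)
      = measure_pmf (Pi_pmf {..<m} 0 (\<lambda>i. pois (measure mu (b i))))"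
proof -
  interpret prob_space M using pm by (simp add: poisson_measure_def)
  let ?N = "counts eta b m"
  let ?P = "Pi_pmf {..<m} 0 (\<lambda>i. pois (measure mu (b i)))"
  have [measurable]: "(\<lambda>\<omega>. emeasure (eta \<omega>) (b i)) \<in> borel_measurable M" if "i < m" for i
    using pm b(1)[OF that] by (auto simp: poisson_measure_def)
  have "AE \<omega> in M. \<forall>i\<in>{..<m}. \<exists>k::nat. emeasure (eta \<omega>) (b i) = of_nat k"
    using b by (intro AE_finite_allI poisson_measure_AE_nat[OF pm]) auto
  then show AE: "AE \<omega> in M. \<forall>i<m. emeasure (eta \<omega>) (b i) = of_nat (?N \<omega> i)"
  proof eventually_elim
    case (elim \<omega>)
    show ?case
    proof (intro allI impI)
      fix i assume "i < m"
      with elim obtain k :: nat where "emeasure (eta \<omega>) (b i) = of_nat k" by auto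
      then show "emeasure (eta \<omega>) (b i) = of_nat (?N \<omega> i)"
        using \<open>i < m\<close> by (simp add: counts_def ennreal_of_nat_eq_real_of_nat)
    qed
  qed
  define \<Omega> :: "(nat \<Rightarrow> nat) set" where "\<Omega> = range (\<lambda>xs i. if i < length xs then xs ! i else 0)"
  have cnt: "countable \<Omega>" unfolding \<Omega>_def by simp
  have in_\<Omega>: "v \<in> \<Omega>" if "\<And>i. i \<ge> m \<Longrightarrow> v i = 0" for v
    unfolding \<Omega>_def using that by (intro image_eqI[where x = "map v [0..<m]"]) (auto simp: fun_eq_iff not_less)
  have N_\<Omega>: "?N \<omega> \<in> \<Omega>" for \<omega> by (rule in_\<Omega>) (simp add: counts_def)
  have comp: "(\<lambda>\<omega>. ?N \<omega> i) \<in> measurable M (count_space UNIV)" for i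
    unfolding counts_def by (cases "i < m") simp_all
  have single: "{\<omega>\<in>space M. ?N \<omega> = v} \<in> sets M" for v
  proof -
    have "{\<omega>\<in>space M. ?N \<omega> = v} = {\<omega>\<in>space M. \<forall>i. ?N \<omega> i = v i}" by (auto simp: fun_eq_iff)
    also have "\<dots> \<in> sets M" using comp by measurable
    finally show ?thesis .
  qed
  have "?N \<in> measurable M (count_space \<Omega>)"
    using single N_\<Omega> by (subst measurable_count_space_eq_countable[OF cnt])
      (auto simp: vimage_def Int_def conj_commute)
  then show meas: "?N \<in> measurable M (count_space UNIV)"
    by (rule measurable_compose) simp
  show "distr M (count_space UNIV) ?N = measure_pmf ?P"
  proof (rule measure_eqI_countable_AE[where \<Omega> = \<Omega>])
    show "AE x in distr M (count_space UNIV) ?N. x \<in> \<Omega>"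
      using meas by (subst AE_distr_iff) (auto simp: N_\<Omega>)
    show "AE x in measure_pmf ?P. x \<in> \<Omega>"
      using set_Pi_pmf_subset[of "{..<m}" 0 "\<lambda>i. pois (measure mu (b i))"]
      by (auto simp: AE_measure_pmf_iff intro!: in_\<Omega>)
    fix v assume "v \<in> \<Omega>"
    have "emeasure (distr M (count_space UNIV) ?N) {v} = emeasure M {\<omega>\<in>space M. ?N \<omega> = v}"
      using meas by (subst emeasure_distr) (auto simp: vimage_def Int_def conj_commute)
    also have "\<dots> = ennreal (pmf ?P v)"
    proof (cases "\<forall>i\<ge>m. v i = 0")
      case False
      then obtain i where i: "i \<ge> m" "v i \<noteq> 0" by auto
      then have "{\<omega>\<in>space M. ?N \<omega> = v} = {}" by (auto simp: counts_def)
      moreover have "pmf ?P v = 0" using i by (intro pmf_Pi_outside) (auto intro!: exI[of _ i])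
      ultimately show ?thesis by (simp only: emeasure_empty ennreal_0)
    next
      case True
      let ?A = "{\<omega>\<in>space M. \<forall>i<m. emeasure (eta \<omega>) (b i) = of_nat (v i)}"
      have A: "?A \<in> sets M" by measurable
      have "emeasure M {\<omega>\<in>space M. ?N \<omega> = v} = emeasure M ?A"
      proof (rule emeasure_eq_AE)
        show "AE \<omega> in M. \<omega> \<in> {\<omega>\<in>space M. ?N \<omega> = v} \<longleftrightarrow> \<omega> \<in> ?A"
          using AE
        proof eventually_elim
          case (elim \<omega>)
          have "?N \<omega> = v \<longleftrightarrow> (\<forall>i<m. ?N \<omega> i = v i)"
            using True by (auto simp: fun_eq_iff counts_def not_less)
          then show ?case using elim by auto
        qed
      qed (use single A in auto)
      also have "\<dots> = ennreal (measure M ?A)" by (rule emeasure_eq_measure)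
      also have "measure M ?A = (\<Prod>i<m. pmf (pois (measure mu (b i))) (v i))"
      \<comment> \<open>An empty intersection is \<open>UNIV\<close> rather than
        \<open>space M\<close>, so the grid without cells is treated apart.\<close>
      proof (cases "m = 0")
        case True
        then show ?thesis by (simp add: prob_space)
      next
        case False
        have ind: "indep_vars (\<lambda>_. borel) (\<lambda>i \<omega>. emeasure (eta \<omega>) (b i)) {..<m}"
          using pm b disj by (auto simp: poisson_measure_def)
        have "?A = (\<Inter>i\<in>{..<m}. (\<lambda>\<omega>. emeasure (eta \<omega>) (b i)) -` {of_nat (v i)} \<inter> space M)"
          using False by auto
        also have "measure M \<dots> = (\<Prod>i<m. measure M ((\<lambda>\<omega>. emeasure (eta \<omega>) (b i)) -` {of_nat (v i)} \<inter> space M))"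
          using False by (intro indep_varsD_finite[OF ind]) auto
        also have "\<dots> = (\<Prod>i<m. pmf (pois (measure mu (b i))) (v i))"
        proof (intro prod.cong refl)
          fix i assume i: "i \<in> {..<m}"
          have "(\<lambda>\<omega>. emeasure (eta \<omega>) (b i)) -` {of_nat (v i)} \<inter> space M
              = {\<omega>\<in>space M. emeasure (eta \<omega>) (b i) = of_nat (v i)}" by auto
          then show "measure M ((\<lambda>\<omega>. emeasure (eta \<omega>) (b i)) -` {of_nat (v i)} \<inter> space M)
              = pmf (pois (measure mu (b i))) (v i)"
            using pm b i by (simp add: poisson_measure_def pmf_pois)
        qed
        finally show ?thesis .
      qed
      also have "\<dots> = pmf ?P v" using True by (subst pmf_Pi') auto
      finally show ?thesis .
    qed
    also have "\<dots> = emeasure ?P {v}" by (simp add: emeasure_pmf_single)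
    finally show "emeasure (distr M (count_space UNIV) ?N) {v} = emeasure ?P {v}" .
  qed (use cnt in auto)
qed

section \<open>Elementary kernels on a grid\<close>

text \<open>Two points are equivalent if they lie in the same members of \<open>\<A>\<close>; the
  cells are the classes inside the union of \<open>\<A>\<close>. Nonemptiness is recorded because it
  later prevents a cell from lying in two disjoint sets.\<close>

lemma finite_measure_atoms:
  assumes fin: "finite \<A>" and \<A>: "\<And>A. A \<in> \<A> \<Longrightarrow> A \<in> sets mu" "\<And>A. A \<in> \<A> \<Longrightarrow> emeasure mu A < \<infinity>"
  obtains m :: nat and b where
    "\<And>i. i < m \<Longrightarrow> b i \<in> sets mu" "\<And>i. i < m \<Longrightarrow> emeasure mu (b i) < \<infinity>"
    "\<And>i. i < m \<Longrightarrow> b i \<noteq> {}" "disjoint_family_on b {..<m}"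
    "\<And>A i. A \<in> \<A> \<Longrightarrow> i < m \<Longrightarrow> b i \<subseteq> A \<or> b i \<inter> A = {}"
    "\<And>A. A \<in> \<A> \<Longrightarrow> A = (\<Union>i\<in>{i. i < m \<and> b i \<subseteq> A}. b i)"
proof -
  define F where "F T = \<Inter>T - \<Union>(\<A> - T)" for T
  define atom where "atom x = F {A\<in>\<A>. x \<in> A}" for x
  have atom_mem: "y \<in> atom x \<longleftrightarrow> (\<forall>A\<in>\<A>. x \<in> A \<longleftrightarrow> y \<in> A)" for x y
    by (auto simp: atom_def F_def)
  have atom_eq: "atom y = atom x" if "y \<in> atom x" for x y
  proof -
    have "{A\<in>\<A>. y \<in> A} = {A\<in>\<A>. x \<in> A}" using that by (auto simp: atom_mem)
    then show ?thesis by (simp add: atom_def)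
  qed
  let ?P = "atom ` \<Union>\<A>"
  have finP: "finite ?P"
    by (rule finite_subset[of _ "F ` Pow \<A>"]) (auto simp: atom_def fin)
  obtain b where b: "bij_betw b {0..<card ?P} ?P"
    using ex_bij_betw_nat_finite[OF finP] by auto
  let ?m = "card ?P"
  have b_atom: "\<exists>x\<in>\<Union>\<A>. b i = atom x" if "i < ?m" for i
  proof -
    have "b i \<in> ?P" using bij_betwE[OF b] that by auto
    then show ?thesis by auto
  qed
  have atom_sets: "atom x \<in> sets mu" "atom x \<subseteq> A" if "x \<in> A" "A \<in> \<A>" for x A
  proof -
    have "atom x = (\<Inter>B\<in>{B\<in>\<A>. x \<in> B}. B) - \<Union>(\<A> - {B\<in>\<A>. x \<in> B})" by (simp add: atom_def F_def)
    also have "\<dots> \<in> sets mu"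
      using that fin \<A>(1) by (intro sets.Diff sets.finite_INT sets.finite_Union) auto
    finally show "atom x \<in> sets mu" .
    show "atom x \<subseteq> A" using that by (auto simp: atom_mem)
  qed
  show ?thesis
  proof (rule that[of ?m b])
    show "b i \<in> sets mu" "emeasure mu (b i) < \<infinity>" "b i \<noteq> {}" if i: "i < ?m" for i
    proof -
      obtain x A where x: "x \<in> A" "A \<in> \<A>" "b i = atom x" using b_atom[OF i] by auto
      show "b i \<in> sets mu" using atom_sets x by simp
      have "emeasure mu (b i) \<le> emeasure mu A" using atom_sets x \<A> by (intro emeasure_mono) auto
      then show "emeasure mu (b i) < \<infinity>" using \<A>(2)[OF x(2)] by simp
      show "b i \<noteq> {}" using x(3) atom_mem[of x x] by auto
    qed
    show "disjoint_family_on b {..<?m}"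
      unfolding disjoint_family_on_def
    proof (intro ballI impI)
      fix i j assume ij: "i \<in> {..<?m}" "j \<in> {..<?m}" "i \<noteq> j"
      then have "b i \<noteq> b j" using b by (auto simp: bij_betw_def inj_on_def)
      moreover obtain x where x: "b i = atom x" using b_atom[of i] ij by auto
      moreover obtain y where y: "b j = atom y" using b_atom[of j] ij by auto
      moreover have "atom x = atom y" if "z \<in> atom x" "z \<in> atom y" for z
        using atom_eq[OF that(1)] atom_eq[OF that(2)] by simp
      ultimately show "b i \<inter> b j = {}" by auto
    qed
    show "b i \<subseteq> A \<or> b i \<inter> A = {}" if A: "A \<in> \<A>" and i: "i < ?m" for A i
    proof -
      obtain x where "b i = atom x" using b_atom[OF i] by blast
      then show ?thesis using A by (cases "x \<in> A") (auto simp: atom_mem)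
    qed
    show "A = (\<Union>i\<in>{i. i < ?m \<and> b i \<subseteq> A}. b i)" if A: "A \<in> \<A>" for A
    proof (intro equalityI subsetI)
      fix x assume x: "x \<in> A"
      then have "atom x \<in> ?P" using A by auto
      then have "atom x \<in> b ` {0..<?m}" using bij_betw_imp_surj_on[OF b] by simp
      then obtain i where "i < ?m" "atom x = b i" by auto
      then show "x \<in> (\<Union>i\<in>{i. i < ?m \<and> b i \<subseteq> A}. b i)"
        using atom_sets(2)[OF x A] atom_mem[of x x] by auto
    qed auto
  qed
qed

lemma sum_list_sum_swap: "(\<Sum>x\<leftarrow>xs. \<Sum>S\<in>F. g x S) = (\<Sum>S\<in>F. \<Sum>x\<leftarrow>xs. g x S)"
  for g :: "'a \<Rightarrow> 'b \<Rightarrow> real"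
  by (induction xs) (auto simp: sum.distrib)

text \<open>Disjointness of the \<open>K i\<close> makes every choice function injective, so no
  power of a single \<open>\<nu> k\<close> occurs and the choices can be grouped by their
  image.\<close>

lemma prod_sum_disjoint_cells:
  fixes \<nu> :: "nat \<Rightarrow> real"
  assumes K: "\<And>i. i < q \<Longrightarrow> K i \<subseteq> {..<m}" and disj: "disjoint_family_on K {..<q}"
  shows "(\<Prod>i<q. \<Sum>k\<in>K i. \<nu> k) = (\<Sum>S\<in>{S. S \<subseteq> {..<m} \<and> card S = q}.
    real (card {\<kappa> \<in> {..<q} \<rightarrow>\<^sub>E S. bij_betw \<kappa> {..<q} S \<and> (\<forall>i<q. \<kappa> i \<in> K i)}) * (\<Prod>k\<in>S. \<nu> k))"
proof -
  have finK: "finite (K i)" if "i < q" for i using K[OF that] by (rule finite_subset) simp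
  let ?E = "PiE {..<q} K" and ?L = "{S. S \<subseteq> {..<m} \<and> card S = q}"
  have inj: "inj_on \<kappa> {..<q}" if "\<kappa> \<in> ?E" for \<kappa>
  proof (rule inj_onI, rule ccontr)
    fix i j assume ij: "i \<in> {..<q}" "j \<in> {..<q}" "\<kappa> i = \<kappa> j" "i \<noteq> j"
    have "\<kappa> i \<in> K i" "\<kappa> j \<in> K j" using ij(1,2) by (auto intro: PiE_mem[OF that])
    then have "\<kappa> i \<in> K i \<inter> K j" using ij by simp
    then show False using disj ij by (auto simp: disjoint_family_on_def)
  qed
  have "(\<Prod>i<q. \<Sum>k\<in>K i. \<nu> k) = (\<Sum>\<kappa>\<in>?E. \<Prod>i<q. \<nu> (\<kappa> i))"
    using finK by (intro prod_sum_PiE) auto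
  also have "\<dots> = (\<Sum>S\<in>?L. \<Sum>\<kappa>\<in>{\<kappa>\<in>?E. \<kappa> ` {..<q} = S}. \<Prod>i<q. \<nu> (\<kappa> i))"
  proof (rule sum.group[symmetric])
    show "finite ?E" using finK by (intro finite_PiE) auto
    show "(\<lambda>\<kappa>. \<kappa> ` {..<q}) ` ?E \<subseteq> ?L"
      using K inj by (fastforce simp: card_image PiE_iff)
  qed simp
  also have "\<dots> = (\<Sum>S\<in>?L. \<Sum>\<kappa>\<in>{\<kappa> \<in> {..<q} \<rightarrow>\<^sub>E S. bij_betw \<kappa> {..<q} S \<and> (\<forall>i<q. \<kappa> i \<in> K i)}. \<Prod>k\<in>S. \<nu> k)"
  proof (intro sum.cong refl)
    fix S assume "S \<in> ?L"
    show "{\<kappa>\<in>?E. \<kappa> ` {..<q} = S} = {\<kappa> \<in> {..<q} \<rightarrow>\<^sub>E S. bij_betw \<kappa> {..<q} S \<and> (\<forall>i<q. \<kappa> i \<in> K i)}"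
      using inj by (auto simp: bij_betw_def PiE_iff)
    fix \<kappa> assume "\<kappa> \<in> {\<kappa> \<in> {..<q} \<rightarrow>\<^sub>E S. bij_betw \<kappa> {..<q} S \<and> (\<forall>i<q. \<kappa> i \<in> K i)}"
    then show "(\<Prod>i<q. \<nu> (\<kappa> i)) = (\<Prod>k\<in>S. \<nu> k)"
      by (intro prod.reindex_bij_betw) auto
  qed
  finally show ?thesis by simp
qed

text \<open>The bijection sends \<open>p\<close> to \<open>\<kappa> \<circ> inv p\<close>. It
  reconciles two counts: the symmetrised kernel at a point of a box sums over permutations of
  coordinates, whereas the integral sums over assignments of cells to factors.\<close>

lemma card_permutes_eq_card_bijections:
  assumes \<kappa>: "inj_on \<kappa> {..<q}"
  shows "card {p. p permutes {..<q} \<and> (\<forall>i<q. R (\<kappa> i) (p i))}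
    = card {\<kappa>' \<in> {..<q} \<rightarrow>\<^sub>E (\<kappa> ` {..<q}). bij_betw \<kappa>' {..<q} (\<kappa> ` {..<q}) \<and> (\<forall>i<q. R (\<kappa>' i) i)}"
    (is "card ?A = card ?B")
proof (rule bij_betw_same_card)
  have bk: "bij_betw \<kappa> {..<q} (\<kappa> ` {..<q})" using \<kappa> by (rule inj_on_imp_bij_betw)
  let ?f = "\<lambda>p. restrict (\<kappa> \<circ> inv p) {..<q}"
  show "bij_betw ?f ?A ?B"
  proof (rule bij_betw_imageI)
    show "inj_on ?f ?A"
    proof (rule inj_onI)
      fix p p' assume p: "p \<in> ?A" "p' \<in> ?A" and eq: "?f p = ?f p'"
      have pi: "inv p permutes {..<q}" "inv p' permutes {..<q}" using p by (auto intro: permutes_inv)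
      have "inv p i = inv p' i" for i
      proof (cases "i < q")
        case True
        then have "\<kappa> (inv p i) = \<kappa> (inv p' i)" using fun_cong[OF eq, of i] by simp
        moreover have "inv p i \<in> {..<q}" "inv p' i \<in> {..<q}"
          using True permutes_in_image[OF pi(1)] permutes_in_image[OF pi(2)] by auto
        ultimately show ?thesis using \<kappa> by (auto simp: inj_on_def)
      next
        case False
        then show ?thesis using pi by (metis permutes_not_in lessThan_iff)
      qed
      then have "inv (inv p) = inv (inv p')" by (metis ext)
      moreover have "inv (inv p) = p" "inv (inv p') = p'" using p by (auto intro: permutes_inv_inv)
      ultimately show "p = p'" by (simp only:)
    qed
    show "?f ` ?A = ?B"
    proof (intro equalityI subsetI)
      fix \<kappa>' assume "\<kappa>' \<in> ?f ` ?A"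
      then obtain p where "p \<in> ?A" and "\<kappa>' = ?f p" by (rule imageE)
      then have p: "p permutes {..<q}" "\<forall>i<q. R (\<kappa> i) (p i)" "\<kappa>' = ?f p" by simp_all
      have pi: "inv p permutes {..<q}" by (rule permutes_inv[OF p(1)])
      have mem: "inv p i < q" if "i < q" for i using that permutes_in_image[OF pi, of i] by simp
      have "bij_betw (\<kappa> \<circ> inv p) {..<q} (\<kappa> ` {..<q})"
        by (rule bij_betw_trans[OF permutes_imp_bij[OF pi] bk])
      then have "bij_betw \<kappa>' {..<q} (\<kappa> ` {..<q})"
        unfolding p(3) by (rule bij_betw_cong[THEN iffD1, rotated]) simp
      moreover have "R (\<kappa>' i) i" if "i < q" for i
        using p(2) mem[OF that] that permutes_inverses(1)[OF p(1), of i] unfolding p(3) by fastforce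
      ultimately show "\<kappa>' \<in> ?B" using mem by (auto simp: p(3))
    next
      fix \<kappa>' assume k': "\<kappa>' \<in> ?B"
      let ?s = "\<lambda>i. if i < q then the_inv_into {..<q} \<kappa> (\<kappa>' i) else i"
      have b': "bij_betw \<kappa>' {..<q} (\<kappa> ` {..<q})" using k' by auto
      have inv_s: "\<kappa> (?s i) = \<kappa>' i" "?s i < q" if "i < q" for i
      proof -
        have "\<kappa>' i \<in> \<kappa> ` {..<q}" using b' that by (auto simp: bij_betw_def)
        then show "\<kappa> (?s i) = \<kappa>' i" "?s i < q"
          using that f_the_inv_into_f[OF \<kappa>] the_inv_into_into[OF \<kappa>, of "\<kappa>' i" "{..<q}"] by auto
      qed
      have "bij_betw (the_inv_into {..<q} \<kappa> \<circ> \<kappa>') {..<q} {..<q}"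
        by (rule bij_betw_trans[OF b' bij_betw_the_inv_into[OF bk]])
      then have "bij_betw ?s {..<q} {..<q}"
        by (rule bij_betw_cong[THEN iffD1, rotated]) simp
      then have s: "?s permutes {..<q}" by (rule bij_imp_permutes) auto
      let ?p = "inv ?s"
      have p: "?p permutes {..<q}" using s by (rule permutes_inv)
      have "R (\<kappa> i) (?p i)" if "i < q" for i
      proof -
        have pi: "?p i < q" using that permutes_in_image[OF p, of i] by simp
        have "\<kappa>' (?p i) = \<kappa> (?s (?p i))" using inv_s(1)[OF pi] by simp
        also have "?s (?p i) = i" using permutes_inverses(1)[OF s] by blast
        finally have "\<kappa>' (?p i) = \<kappa> i" .
        then show ?thesis using k' pi by auto
      qed
      moreover have "?f ?p = \<kappa>'"
      proof
        fix i show "?f ?p i = \<kappa>' i"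
          using inv_s(1)[of i] k' permutes_inv_inv[OF s] by (cases "i < q") (auto simp: PiE_iff extensional_def)
      qed
      ultimately show "\<kappa>' \<in> ?f ` ?A" using p by (intro image_eqI[where x = ?p]) auto
    qed
  qed
qed

text \<open>One coefficient per set of \<open>q\<close> cells describes both the kernel and its
  integral; the factor 1 / q! is that of the symmetrisation. The second identity is stated for any
  \<open>\<nu>\<close> additive on cells, so that it applies, at a fixed outcome, to the random set
  function eta - mu.\<close>

lemma elementary_grid:
  assumes valid: "elem_valid mu q ts"
  obtains m :: nat and b and a :: "nat set \<Rightarrow> real" where
    "\<And>i. i < m \<Longrightarrow> b i \<in> sets mu" "\<And>i. i < m \<Longrightarrow> emeasure mu (b i) < \<infinity>"
    "disjoint_family_on b {..<m}"
    "\<And>\<kappa> x. inj_on \<kappa> {..<q} \<Longrightarrow> (\<And>i. i < q \<Longrightarrow> \<kappa> i < m) \<Longrightarrow> (\<And>i. i < q \<Longrightarrow> x i \<in> b (\<kappa> i))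
      \<Longrightarrow> elem_kernel q ts x = a (\<kappa> ` {..<q}) / fact q"
    "\<And>\<nu> :: 'z set \<Rightarrow> real. (\<And>K. K \<subseteq> {..<m} \<Longrightarrow> \<nu> (\<Union>k\<in>K. b k) = (\<Sum>k\<in>K. \<nu> (b k))) \<Longrightarrow>
      (\<Sum>(c, A)\<leftarrow>ts. c * (\<Prod>i<q. \<nu> (A i)))
        = (\<Sum>S\<in>{S. S \<subseteq> {..<m} \<and> card S = q}. a S * (\<Prod>k\<in>S. \<nu> (b k)))"
proof -
  define \<A> where "\<A> = (\<Union>(c, A)\<in>set ts. A ` {..<q})"
  have fin: "finite \<A>" unfolding \<A>_def by auto
  have \<A>: "A \<in> sets mu" "emeasure mu A < \<infinity>" if "A \<in> \<A>" for A
    using that valid by (fastforce simp: \<A>_def elem_valid_def)+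
  obtain m :: nat and b where b: "\<And>i. i < m \<Longrightarrow> b i \<in> sets mu" "\<And>i. i < m \<Longrightarrow> emeasure mu (b i) < \<infinity>"
    "\<And>i. i < m \<Longrightarrow> b i \<noteq> {}" "disjoint_family_on b {..<m}"
    and b_sub: "\<And>A i. A \<in> \<A> \<Longrightarrow> i < m \<Longrightarrow> b i \<subseteq> A \<or> b i \<inter> A = {}"
    and b_Un: "\<And>A. A \<in> \<A> \<Longrightarrow> A = (\<Union>i\<in>{i. i < m \<and> b i \<subseteq> A}. b i)"
    using finite_measure_atoms[OF fin \<A>] by blast
  define N where "N A S = card {\<kappa> \<in> {..<q} \<rightarrow>\<^sub>E S. bij_betw \<kappa> {..<q} S \<and> (\<forall>i<q. b (\<kappa> i) \<subseteq> A i)}"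
    for A :: "nat \<Rightarrow> 'z set" and S
  define a where "a S = (\<Sum>(c, A)\<leftarrow>ts. c * real (N A S))" for S
  have mem: "A i \<in> \<A>" if "(c, A) \<in> set ts" "i < q" for c A i
    using that by (auto simp: \<A>_def)
  show ?thesis
  proof (rule that[of m b a, OF b(1,2,4)])
    fix \<kappa> :: "nat \<Rightarrow> nat" and x
    assume \<kappa>: "inj_on \<kappa> {..<q}" "\<And>i. i < q \<Longrightarrow> \<kappa> i < m" and x: "\<And>i. i < q \<Longrightarrow> x i \<in> b (\<kappa> i)"
    have trm: "(\<Sum>p\<in>{p. p permutes {..<q}}. \<Prod>i<q. indicator (A (p i)) (x i)) = real (N A (\<kappa> ` {..<q}))"
      if cA: "(c, A) \<in> set ts" for c A
    proof -
      have "(\<Prod>i<q. indicator (A (p i)) (x i)) = (if \<forall>i<q. b (\<kappa> i) \<subseteq> A (p i) then 1 else 0 :: real)"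
        if p: "p permutes {..<q}" for p
      proof -
        have "indicator (A (p i)) (x i) = (if b (\<kappa> i) \<subseteq> A (p i) then 1 else 0 :: real)" if i: "i < q" for i
        proof -
          have "p i < q" using permutes_in_image[OF p, of i] i by simp
          then show ?thesis
            using b_sub[OF mem[OF cA], of "p i" "\<kappa> i"] \<kappa>(2)[OF i] x[OF i] by (auto simp: indicator_def)
        qed
        then have "(\<Prod>i<q. indicator (A (p i)) (x i)) = (\<Prod>i<q. if b (\<kappa> i) \<subseteq> A (p i) then 1 else 0 :: real)"
          by (intro prod.cong) auto
        also have "\<dots> = (if \<forall>i<q. b (\<kappa> i) \<subseteq> A (p i) then 1 else 0)"
          by (auto intro!: prod.neutral prod_zero)
        finally show ?thesis .
      qed
      then have "(\<Sum>p\<in>{p. p permutes {..<q}}. \<Prod>i<q. indicator (A (p i)) (x i))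
          = (\<Sum>p\<in>{p. p permutes {..<q}}. if \<forall>i<q. b (\<kappa> i) \<subseteq> A (p i) then 1 else 0 :: real)"
        by (intro sum.cong) auto
      also have "\<dots> = real (card {p. p permutes {..<q} \<and> (\<forall>i<q. b (\<kappa> i) \<subseteq> A (p i))})"
        by (simp add: sum.If_cases finite_permutations Int_def)
      also have "\<dots> = real (N A (\<kappa> ` {..<q}))"
        unfolding N_def using card_permutes_eq_card_bijections[OF \<kappa>(1), of "\<lambda>k i. b k \<subseteq> A i"] by simp
      finally show ?thesis .
    qed
    have "elem_kernel q ts x = (\<Sum>(c, A)\<leftarrow>ts. c / fact q * real (N A (\<kappa> ` {..<q})))"
      unfolding elem_kernel_def
      by (intro arg_cong[where f = sum_list] map_cong refl) (auto simp: trm)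
    also have "\<dots> = (\<Sum>(c, A)\<leftarrow>ts. (1 / fact q) * (c * real (N A (\<kappa> ` {..<q}))))"
      by (intro arg_cong[where f = sum_list] map_cong refl) auto
    also have "\<dots> = a (\<kappa> ` {..<q}) / fact q"
      unfolding a_def by (induction ts) (auto simp: field_simps split: prod.splits)
    finally show "elem_kernel q ts x = a (\<kappa> ` {..<q}) / fact q" .
  next
    fix \<nu> :: "'z set \<Rightarrow> real"
    assume \<nu>: "\<And>K. K \<subseteq> {..<m} \<Longrightarrow> \<nu> (\<Union>k\<in>K. b k) = (\<Sum>k\<in>K. \<nu> (b k))"
    let ?L = "{S. S \<subseteq> {..<m} \<and> card S = q}"
    have trm: "(\<Prod>i<q. \<nu> (A i)) = (\<Sum>S\<in>?L. real (N A S) * (\<Prod>k\<in>S. \<nu> (b k)))"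
      if cA: "(c, A) \<in> set ts" for c A
    proof -
      let ?K = "\<lambda>i. {k. k < m \<and> b k \<subseteq> A i}"
      have "\<nu> (A i) = (\<Sum>k\<in>?K i. \<nu> (b k))" if "i < q" for i
      proof -
        have "\<nu> (\<Union>k\<in>?K i. b k) = (\<Sum>k\<in>?K i. \<nu> (b k))" by (rule \<nu>) auto
        then show ?thesis using b_Un[OF mem[OF cA that]] by simp
      qed
      then have "(\<Prod>i<q. \<nu> (A i)) = (\<Prod>i<q. \<Sum>k\<in>?K i. \<nu> (b k))" by (intro prod.cong) auto
      also have "\<dots> = (\<Sum>S\<in>?L. real (card {\<kappa> \<in> {..<q} \<rightarrow>\<^sub>E S. bij_betw \<kappa> {..<q} S \<and> (\<forall>i<q. \<kappa> i \<in> ?K i)}) * (\<Prod>k\<in>S. \<nu> (b k)))"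
      proof (rule prod_sum_disjoint_cells)
        show "disjoint_family_on ?K {..<q}"
          unfolding disjoint_family_on_def
        proof (intro ballI impI)
          fix i j assume ij: "i \<in> {..<q}" "j \<in> {..<q}" "i \<noteq> j"
          have "A i \<inter> A j = {}" using valid cA ij by (fastforce simp: elem_valid_def disjoint_family_on_def)
          then show "?K i \<inter> ?K j = {}" using b(3) by blast
        qed
      qed auto
      also have "\<dots> = (\<Sum>S\<in>?L. real (N A S) * (\<Prod>k\<in>S. \<nu> (b k)))"
        unfolding N_def
        by (intro sum.cong refl arg_cong2[where f = times] arg_cong[where f = real] arg_cong[where f = card])
          (auto simp: PiE_iff)
      finally show ?thesis .
    qed
    have "(\<Sum>(c, A)\<leftarrow>ts. c * (\<Prod>i<q. \<nu> (A i)))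
        = (\<Sum>(c, A)\<leftarrow>ts. \<Sum>S\<in>?L. c * (real (N A S) * (\<Prod>k\<in>S. \<nu> (b k))))"
      by (intro arg_cong[where f = sum_list] map_cong refl) (auto simp: trm sum_distrib_left)
    also have "\<dots> = (\<Sum>x\<leftarrow>ts. \<Sum>S\<in>?L. fst x * (real (N (snd x) S) * (\<Prod>k\<in>S. \<nu> (b k))))"
      by (simp add: case_prod_unfold)
    also have "\<dots> = (\<Sum>S\<in>?L. \<Sum>x\<leftarrow>ts. fst x * (real (N (snd x) S) * (\<Prod>k\<in>S. \<nu> (b k))))"
      by (rule sum_list_sum_swap)
    also have "\<dots> = (\<Sum>S\<in>?L. a S * (\<Prod>k\<in>S. \<nu> (b k)))"
    proof (intro sum.cong refl)
      fix S
      show "(\<Sum>x\<leftarrow>ts. fst x * (real (N (snd x) S) * (\<Prod>k\<in>S. \<nu> (b k)))) = a S * (\<Prod>k\<in>S. \<nu> (b k))"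
        unfolding a_def by (induction ts) (auto simp: algebra_simps case_prod_unfold)
    qed
    finally show "(\<Sum>(c, A)\<leftarrow>ts. c * (\<Prod>i<q. \<nu> (A i))) = (\<Sum>S\<in>?L. a S * (\<Prod>k\<in>S. \<nu> (b k)))" .
  qed
qed

section \<open>Cells of the product space\<close>

text \<open>The variables are ordered as in \<open>contr\<close>: those to be integrated come first,
  the free ones after them.\<close>

definition glue :: "nat \<Rightarrow> nat \<Rightarrow> (nat \<Rightarrow> 'z) \<Rightarrow> (nat \<Rightarrow> 'z) \<Rightarrow> nat \<Rightarrow> 'z" where
  "glue q l z y = restrict (\<lambda>i. if i < l then z i else y (i - l)) {..<q}"

lemma glue_measurable [measurable]:
  assumes "l \<le> q"
  shows "(\<lambda>(y, z). glue q l z y) \<in> measurable (powM mu (q - l) \<Otimes>\<^sub>M powM mu l) (powM mu q)"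
  unfolding glue_def case_prod_unfold
proof (rule measurable_restrict)
  fix i assume i: "i \<in> {..<q}"
  show "(\<lambda>x. if i < l then snd x i else fst x (i - l)) \<in> measurable (powM mu (q - l) \<Otimes>\<^sub>M powM mu l) mu"
  proof (cases "i < l")
    case True
    have "(\<lambda>x. snd x i) \<in> measurable (powM mu (q - l) \<Otimes>\<^sub>M powM mu l) mu"
      using True by (intro measurable_compose[OF measurable_snd measurable_component_singleton]) simp
    then show ?thesis using True by simp
  next
    case False
    have "(\<lambda>x. fst x (i - l)) \<in> measurable (powM mu (q - l) \<Otimes>\<^sub>M powM mu l) mu"
      using False i by (intro measurable_compose[OF measurable_fst measurable_component_singleton]) auto
    then show ?thesis using False by simp
  qed
qed

text \<open>Tonelli, once the image of the product measure under \<open>glue\<close> is identified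
  with \<open>powM mu q\<close> through its values on boxes.\<close>

lemma nn_integral_powM_glue:
  assumes mu: "sigma_finite_measure mu" and l: "l \<le> q"
    and g [measurable]: "g \<in> borel_measurable (powM mu q)"
  shows "(\<integral>\<^sup>+x. g x \<partial>powM mu q) = (\<integral>\<^sup>+y. \<integral>\<^sup>+z. g (glue q l z y) \<partial>powM mu l \<partial>powM mu (q - l))"
proof -
  interpret sigma_finite_measure mu by fact
  interpret P: product_sigma_finite "\<lambda>_ :: nat. mu" by standard
  interpret L: sigma_finite_measure "powM mu l" by (rule P.sigma_finite) simp
  interpret R: sigma_finite_measure "powM mu (q - l)" by (rule P.sigma_finite) simp
  let ?D = "distr (powM mu (q - l) \<Otimes>\<^sub>M powM mu l) (powM mu q) (\<lambda>(y, z). glue q l z y)"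
  note [measurable] = glue_measurable[OF l, of mu]
  have "?D = powM mu q"
  proof (rule P.PiM_eqI)
    fix A :: "nat \<Rightarrow> _" assume A: "\<And>i. i \<in> {..<q} \<Longrightarrow> A i \<in> sets mu"
    have AE: "Pi\<^sub>E {..<q} A \<in> sets (powM mu q)" using A by (intro sets_PiM_I_finite) auto
    have pre: "(\<lambda>(y, z). glue q l z y) -` Pi\<^sub>E {..<q} A \<inter> space (powM mu (q - l) \<Otimes>\<^sub>M powM mu l)
        = Pi\<^sub>E {..<q - l} (\<lambda>i. A (i + l)) \<times> Pi\<^sub>E {..<l} A" (is "?X = ?Y \<times> ?Z")
    proof (intro equalityI subsetI)
      fix yz assume "yz \<in> ?X"
      then obtain y z where yz: "yz = (y, z)" "y \<in> space (powM mu (q - l))" "z \<in> space (powM mu l)"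
        and mem: "\<And>i. i < q \<Longrightarrow> (if i < l then z i else y (i - l)) \<in> A i"
        by (auto simp: space_pair_measure glue_def PiE_iff)
      have "y i \<in> A (i + l)" if "i < q - l" for i using mem[of "i + l"] that by simp
      moreover have "z i \<in> A i" if "i < l" for i using mem[of i] that l by simp
      ultimately show "yz \<in> ?Y \<times> ?Z" using yz by (auto simp: space_PiM PiE_iff)
    next
      fix yz assume "yz \<in> ?Y \<times> ?Z"
      then obtain y z where yz: "yz = (y, z)" "y \<in> ?Y" "z \<in> ?Z" by auto
      have "y \<in> space (powM mu (q - l))"
        using PiE_mem[OF yz(2)] yz(2) sets.sets_into_space[OF A]
        by (auto simp: space_PiM PiE_iff less_diff_conv) (meson lessThan_iff subsetD)
      moreover have "z \<in> space (powM mu l)"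
        using PiE_mem[OF yz(3)] yz(3) l sets.sets_into_space[OF A]
        by (auto simp: space_PiM PiE_iff) (meson lessThan_iff subsetD order_less_le_trans)
      moreover have "glue q l z y \<in> Pi\<^sub>E {..<q} A"
      proof -
        have "(if i < l then z i else y (i - l)) \<in> A i" if "i < q" for i
          using yz that PiE_mem[OF yz(2), of "i - l"] PiE_mem[OF yz(3), of i] by auto
        then show ?thesis by (auto simp: glue_def)
      qed
      ultimately show "yz \<in> ?X" using yz(1) by (simp add: space_pair_measure)
    qed
    have YZ: "?Y \<in> sets (powM mu (q - l))" "?Z \<in> sets (powM mu l)"
      using A l by (auto intro!: sets_PiM_I_finite)
    have "emeasure ?D (Pi\<^sub>E {..<q} A) = emeasure (powM mu (q - l)) ?Y * emeasure (powM mu l) ?Z"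
      using YZ by (subst emeasure_distr[OF _ AE]) (auto simp: pre L.emeasure_pair_measure_Times)
    also have "\<dots> = (\<Prod>i<q - l. emeasure mu (A (i + l))) * (\<Prod>i<l. emeasure mu (A i))"
      using A l by (subst (1 2) P.emeasure_PiM) auto
    also have "(\<Prod>i<q - l. emeasure mu (A (i + l))) = (\<Prod>i\<in>{l..<q}. emeasure mu (A i))"
      using l by (intro prod.reindex_bij_witness[of _ "\<lambda>i. i - l" "\<lambda>i. i + l"]) auto
    also have "\<dots> * (\<Prod>i<l. emeasure mu (A i)) = (\<Prod>i\<in>{l..<q} \<union> {..<l}. emeasure mu (A i))"
      by (intro prod.union_disjoint[symmetric]) auto
    also have "{l..<q} \<union> {..<l} = {..<q}" using l by auto
    finally show "emeasure ?D (Pi\<^sub>E {..<q} A) = (\<Prod>i\<in>{..<q}. emeasure mu (A i))" .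
  qed auto
  then have "(\<integral>\<^sup>+x. g x \<partial>powM mu q) = (\<integral>\<^sup>+x. g x \<partial>?D)" by simp
  also have "\<dots> = (\<integral>\<^sup>+(y, z). g (glue q l z y) \<partial>(powM mu (q - l) \<Otimes>\<^sub>M powM mu l))"
    by (subst nn_integral_distr) (auto simp: case_prod_unfold)
  also have "\<dots> = (\<integral>\<^sup>+y. \<integral>\<^sup>+z. g (glue q l z y) \<partial>powM mu l \<partial>powM mu (q - l))"
    by (subst L.nn_integral_fst[symmetric]) (auto simp: case_prod_unfold)
  finally show ?thesis .
qed

section \<open>Boxes of cells, and grid sums bounded by integrals\<close>

definition cell :: "(nat \<Rightarrow> 'z set) \<Rightarrow> nat \<Rightarrow> (nat \<Rightarrow> nat) \<Rightarrow> (nat \<Rightarrow> 'z) set" where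
  "cell b q \<kappa> = PiE {..<q} (\<lambda>i. b (\<kappa> i))"

lemma cell_sets:
  assumes "\<And>i. i < m \<Longrightarrow> b i \<in> sets mu" "\<And>i. i < q \<Longrightarrow> \<kappa> i < m"
  shows "cell b q \<kappa> \<in> sets (powM mu q)"
  unfolding cell_def using assms by (intro sets_PiM_I_finite) auto

lemma emeasure_cell:
  assumes "sigma_finite_measure mu" "\<And>i. i < m \<Longrightarrow> b i \<in> sets mu" "\<And>i. i < m \<Longrightarrow> emeasure mu (b i) < \<infinity>"
    and "\<And>i. i < q \<Longrightarrow> \<kappa> i < m" "bij_betw \<kappa> {..<q} S"
  shows "emeasure (powM mu q) (cell b q \<kappa>) = ennreal (\<Prod>k\<in>S. measure mu (b k))"
proof -
  interpret sigma_finite_measure mu by fact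
  interpret P: product_sigma_finite "\<lambda>_ :: nat. mu" by standard
  have "emeasure (powM mu q) (cell b q \<kappa>) = (\<Prod>i<q. emeasure mu (b (\<kappa> i)))"
    unfolding cell_def using assms by (subst P.emeasure_PiM) auto
  also have "\<dots> = (\<Prod>i<q. ennreal (measure mu (b (\<kappa> i))))"
    using assms(3,4) by (intro prod.cong refl emeasure_eq_ennreal_measure) (auto simp: top.not_eq_extremum)
  also have "\<dots> = (\<Prod>k\<in>S. ennreal (measure mu (b k)))"
    using assms(5) by (rule prod.reindex_bij_betw)
  also have "\<dots> = ennreal (\<Prod>k\<in>S. measure mu (b k))" by (intro prod_ennreal) simp
  finally show ?thesis .
qed

lemma cell_disjoint:
  assumes b: "disjoint_family_on b {..<m}" and "\<And>i. i < q \<Longrightarrow> \<kappa> i < m" "\<And>i. i < q \<Longrightarrow> \<kappa>' i < m"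
    and "x \<in> cell b q \<kappa>" "x \<in> cell b q \<kappa>'" "i < q"
  shows "\<kappa> i = \<kappa>' i"
proof (rule ccontr)
  assume "\<kappa> i \<noteq> \<kappa>' i"
  moreover have "x i \<in> b (\<kappa> i)" "x i \<in> b (\<kappa>' i)"
    using assms(4-6) by (auto simp: cell_def PiE_iff)
  ultimately show False using b assms(2,3)[OF \<open>i < q\<close>] by (auto simp: disjoint_family_on_def)
qed

text \<open>The boxes are disjoint, so the sum is the integral of a function with value
  \<open>u t\<close> on the box of \<open>t\<close>. This is the passage from sums over the grid to
  integrals of the original kernel.\<close>

lemma sum_cells_le:
  assumes b: "\<And>i. i < m \<Longrightarrow> b i \<in> sets mu" "disjoint_family_on b {..<m}"
    and X: "finite X" and \<kappa>: "\<And>t i. t \<in> X \<Longrightarrow> i < q \<Longrightarrow> \<kappa> t i < m"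
    and inj: "\<And>t t'. t \<in> X \<Longrightarrow> t' \<in> X \<Longrightarrow> (\<And>i. i < q \<Longrightarrow> \<kappa> t i = \<kappa> t' i) \<Longrightarrow> t = t'"
    and \<Psi>: "\<And>t x. t \<in> X \<Longrightarrow> x \<in> cell b q (\<kappa> t) \<Longrightarrow> u t \<le> \<Psi> x"
  shows "(\<Sum>t\<in>X. u t * emeasure (powM mu q) (cell b q (\<kappa> t))) \<le> (\<integral>\<^sup>+x. \<Psi> x \<partial>powM mu q)"
proof -
  have cs: "cell b q (\<kappa> t) \<in> sets (powM mu q)" if "t \<in> X" for t
    using b(1) \<kappa>[OF that] by (rule cell_sets)
  have "(\<Sum>t\<in>X. u t * emeasure (powM mu q) (cell b q (\<kappa> t)))
      = (\<integral>\<^sup>+x. (\<Sum>t\<in>X. u t * indicator (cell b q (\<kappa> t)) x) \<partial>powM mu q)"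
    using cs by (subst nn_integral_sum) (auto simp: nn_integral_cmult_indicator)
  also have "\<dots> \<le> (\<integral>\<^sup>+x. \<Psi> x \<partial>powM mu q)"
  proof (rule nn_integral_mono)
    fix x
    show "(\<Sum>t\<in>X. u t * indicator (cell b q (\<kappa> t)) x) \<le> \<Psi> x"
    proof (cases "\<exists>t\<in>X. x \<in> cell b q (\<kappa> t)")
      case True
      then obtain t where t: "t \<in> X" "x \<in> cell b q (\<kappa> t)" by auto
      have "x \<notin> cell b q (\<kappa> t')" if "t' \<in> X - {t}" for t'
      proof
        assume x': "x \<in> cell b q (\<kappa> t')"
        have "t = t'"
          using that by (intro inj t(1) cell_disjoint[OF b(2) \<kappa>[OF t(1)] \<kappa> t(2) x']) auto
        then show False using that by simp
      qed
      then have "(\<Sum>t\<in>X. u t * indicator (cell b q (\<kappa> t)) x) = u t"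
        using t X by (subst sum.remove[of _ t]) auto
      then show ?thesis using \<Psi>[OF t] by simp
    next
      case False
      then have "(\<Sum>t\<in>X. u t * indicator (cell b q (\<kappa> t)) x) = 0" by (intro sum.neutral) auto
      then show ?thesis by simp
    qed
  qed
  finally show ?thesis .
qed

lemma elem_kernel_measurable:
  assumes "elem_valid mu q ts"
  shows "elem_kernel q ts \<in> borel_measurable (powM mu q)"
proof -
  have trm: "(\<lambda>x. \<Prod>i<q. indicator (A (p i)) (x i) :: real) \<in> borel_measurable (powM mu q)"
    if "(c, A) \<in> set ts" "p permutes {..<q}" for c A p
  proof (intro borel_measurable_prod)
    fix i assume i: "i \<in> {..<q}"
    then have "p i < q" using permutes_in_image[OF that(2), of i] by simp
    then have "A (p i) \<in> sets mu" using assms that(1) by (fastforce simp: elem_valid_def)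
    then show "(\<lambda>x. indicator (A (p i)) (x i) :: real) \<in> borel_measurable (powM mu q)"
      using i by (intro measurable_compose[OF measurable_component_singleton borel_measurable_indicator]) auto
  qed
  have "(\<lambda>x. \<Sum>(c, A)\<leftarrow>us. c / fact q * (\<Sum>p\<in>{p. p permutes {..<q}}. \<Prod>i<q. indicator (A (p i)) (x i)))
      \<in> borel_measurable (powM mu q)" if "set us \<subseteq> set ts" for us :: "(real \<times> (nat \<Rightarrow> 'a set)) list"
    using that
  proof (induction us)
    case (Cons cA us)
    obtain c A where cA: "cA = (c, A)" by (cases cA)
    have "(\<lambda>x. c / fact q * (\<Sum>p\<in>{p. p permutes {..<q}}. \<Prod>i<q. indicator (A (p i)) (x i)))
        \<in> borel_measurable (powM mu q)"
      using Cons.prems cA by (intro borel_measurable_times borel_measurable_const borel_measurable_sum trm) auto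
    then show ?case using Cons by (simp add: cA)
  qed simp
  then show ?thesis unfolding elem_kernel_def by simp
qed

section \<open>Rounding to 0 or 1\<close>

lemma round_dist_le:
  fixes s :: real
  shows "(s - (if s > 1/2 then 1 else 0))\<^sup>2 \<le> 4 * (s * (1 - s))\<^sup>2"
proof (cases "s > 1/2")
  case True
  \<comment> \<open>The distance to the rounded value is the modulus of one of \<open>s\<close> and
    \<open>1 - s\<close>; the other one, here \<open>s\<close>, is at least 1/2. Hence the constant
    4.\<close>
  have "1\<^sup>2 \<le> (2 * s)\<^sup>2" using True by (intro power_mono) auto
  then have "1\<^sup>2 * (1 - s)\<^sup>2 \<le> (2 * s)\<^sup>2 * (1 - s)\<^sup>2" by (rule mult_right_mono) simp
  then show ?thesis using True by (simp add: power2_commute power_mult_distrib)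
next
  case False
  have "1\<^sup>2 \<le> (2 * (1 - s))\<^sup>2" using False by (intro power_mono) auto
  then have "1 * s\<^sup>2 \<le> (2 * (1 - s))\<^sup>2 * s\<^sup>2" by (intro mult_right_mono) auto
  then show ?thesis using False by (simp add: power2_eq_square algebra_simps)
qed

text \<open>Rounding \<open>K * e\<close> picks a nearest point of {0, 1}, so replacing its rounded
  value by that of \<open>K * f\<close> can only increase the distance. This leaves the distance of
  \<open>K * f\<close> to its own rounding, which \<open>round_dist_le\<close> controls.\<close>

lemma round_sq_le:
  fixes K e f :: real
  shows "(K * e - (if K * e > 1/2 then 1 else 0))\<^sup>2 \<le> 2 * K\<^sup>2 * (f - e)\<^sup>2 + 8 * K\<^sup>2 * (f - K * f\<^sup>2)\<^sup>2"
proof -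
  define t :: real where "t = (if K * f > 1/2 then 1 else 0)"
  have "(K * e - (if K * e > 1/2 then 1 else 0))\<^sup>2 \<le> (K * e - t)\<^sup>2"
    by (auto simp: t_def power2_eq_square algebra_simps)
  also have "\<dots> \<le> 2 * (K * e - K * f)\<^sup>2 + 2 * (K * f - t)\<^sup>2"
    using zero_le_power2[of "(K * e - K * f) - (K * f - t)"] by (simp add: power2_eq_square algebra_simps)
  also have "(K * f - t)\<^sup>2 \<le> 4 * (K * f * (1 - K * f))\<^sup>2"
    unfolding t_def by (rule round_dist_le)
  finally show ?thesis by (simp add: power2_eq_square algebra_simps)
qed

text \<open>Selects one ordering of the cells, hence one of the q! boxes belonging to a set of
  \<open>q\<close> cells, since the weights count every set once.\<close>

definition listing :: "'a set \<Rightarrow> nat \<Rightarrow> 'a" where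
  "listing S = (SOME h. bij_betw h {..<card S} S)"

lemma listing_bij: "finite S \<Longrightarrow> bij_betw (listing S) {..<card S} S"
  unfolding listing_def using ex_bij_betw_nat_finite[of S]
  by (intro someI_ex[of "\<lambda>h. bij_betw h {..<card S} S"]) (simp add: lessThan_atLeast0)

lemma listing_mem: "finite S \<Longrightarrow> i < card S \<Longrightarrow> listing S i \<in> S"
  using bij_betwE[OF listing_bij, of S] by simp

lemma listing_inj:
  assumes "finite S" "finite T" "card S = card T" "\<And>i. i < card S \<Longrightarrow> listing S i = listing T i"
  shows "S = T"
proof -
  have "S = listing S ` {..<card S}" using listing_bij[OF assms(1)] by (simp add: bij_betw_def)
  also have "\<dots> = listing T ` {..<card T}" using assms by (intro image_cong) auto
  also have "\<dots> = T" using listing_bij[OF assms(2)] by (simp add: bij_betw_def)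
  finally show ?thesis .
qed

text \<open>The cells of \<open>J\<close> occupy the last coordinates, those that
  \<open>glue\<close> takes from \<open>y\<close>.\<close>

lemma glue_cell_bij:
  assumes "finite S" "J \<subseteq> S" "card S = q" "card J = q - l" "l \<le> q"
  shows "bij_betw (\<lambda>i. if i < l then listing (S - J) i else listing J (i - l)) {..<q} S"
proof -
  have fJ: "finite J" using assms finite_subset by auto
  have cd: "card (S - J) = l" using assms fJ by (simp add: card_Diff_subset)
  have "bij_betw (\<lambda>i. if i < l then listing (S - J) i else listing J (i - l)) {..<l} (S - J)"
    by (rule bij_betw_cong[THEN iffD1, rotated, OF listing_bij[of "S - J", unfolded cd]]) (auto simp: assms)
  moreover have "bij_betw (\<lambda>i. if i < l then listing (S - J) i else listing J (i - l)) {l..<q} J"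
  proof -
    have "bij_betw (\<lambda>i. i - l) {l..<q} {..<q - l}"
      using assms(5) by (intro bij_betw_byWitness[where f' = "\<lambda>i. i + l"]) auto
    from bij_betw_trans[OF this listing_bij[OF fJ, unfolded assms(4)]]
    show ?thesis by (rule bij_betw_cong[THEN iffD1, rotated]) auto
  qed
  ultimately have "bij_betw (\<lambda>i. if i < l then listing (S - J) i else listing J (i - l)) ({..<l} \<union> {l..<q}) ((S - J) \<union> J)"
    by (rule bij_betw_combine) auto
  moreover have "{..<l} \<union> {l..<q} = {..<q}" "(S - J) \<union> J = S" using assms by auto
  ultimately show ?thesis by simp
qed

text \<open>With r = q both factors have the same arguments, so the contraction integrates f^2 over
  the first \<open>l\<close> variables. Finiteness ensures that the Bochner integral is not the
  default 0.\<close>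

lemma contr_top_eq:
  assumes l: "l \<le> q" and f: "f \<in> borel_measurable (powM mu q)"
    and fin: "contr_abs_finite mu q q q l f f y" and y: "y \<in> space (powM mu (q - l))"
  shows "(\<integral>\<^sup>+z. ennreal ((f (glue q l z y))\<^sup>2) \<partial>powM mu l) = ennreal (contr mu q q q l f f y)"
proof -
  have eq: "restrict (\<lambda>i. if i < l then z i else if i < q then y (i - l) else y (i - q + (q - l))) {..<q}
      = glue q l z y" for z
    unfolding glue_def by (rule restrict_ext) auto
  have contr: "contr mu q q q l f f y = (\<integral>z. (f (glue q l z y))\<^sup>2 \<partial>powM mu l)"
    unfolding contr_def eq by (simp add: glue_def power2_eq_square)
  have fin': "(\<integral>\<^sup>+z. ennreal ((f (glue q l z y))\<^sup>2) \<partial>powM mu l) < \<infinity>"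
    using fin unfolding contr_abs_finite_def eq
    by (simp add: glue_def power2_eq_square abs_mult[symmetric])
  have "(\<lambda>z. (y, z)) \<in> measurable (powM mu l) (powM mu (q - l) \<Otimes>\<^sub>M powM mu l)"
    using y by simp
  from measurable_compose[OF this glue_measurable[OF l, of mu]]
  have [measurable]: "(\<lambda>z. glue q l z y) \<in> measurable (powM mu l) (powM mu q)" by simp
  note [measurable] = f
  have "integrable (powM mu l) (\<lambda>z. (f (glue q l z y))\<^sup>2)"
    using fin' by (intro integrableI_nonneg) auto
  then show "(\<integral>\<^sup>+z. ennreal ((f (glue q l z y))\<^sup>2) \<partial>powM mu l) = ennreal (contr mu q q q l f f y)"
    unfolding contr by (rule nn_integral_eq_integral) auto
qed

section \<open>Error estimates for an elementary kernel on a grid\<close>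

locale kernel_grid =
  fixes mu :: "'z measure" and q :: nat and f e :: "(nat \<Rightarrow> 'z) \<Rightarrow> real"
    and m :: nat and b :: "nat \<Rightarrow> 'z set" and a :: "nat set \<Rightarrow> real" and \<tau> :: real
  assumes sf: "sigma_finite_measure mu"
    and f_meas [measurable]: "f \<in> borel_measurable (powM mu q)"
    and e_meas [measurable]: "e \<in> borel_measurable (powM mu q)"
    and b_sets: "\<And>i. i < m \<Longrightarrow> b i \<in> sets mu" and b_fin: "\<And>i. i < m \<Longrightarrow> emeasure mu (b i) < \<infinity>"
    and b_disj: "disjoint_family_on b {..<m}"
    and e_cell: "\<And>\<kappa> x. inj_on \<kappa> {..<q} \<Longrightarrow> (\<And>i. i < q \<Longrightarrow> \<kappa> i < m) \<Longrightarrow> (\<And>i. i < q \<Longrightarrow> x i \<in> b (\<kappa> i))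
      \<Longrightarrow> e x = a (\<kappa> ` {..<q}) / fact q"
    and \<tau>: "0 \<le> \<tau>" "(\<integral>\<^sup>+x. ennreal ((f x - e x)\<^sup>2) \<partial>powM mu q) \<le> ennreal \<tau>"
begin

sublocale poisson_vector "{..<m}" "\<lambda>i. measure mu (b i)"
  by standard auto

lemma cell_w:
  assumes "bij_betw \<kappa> {..<n} S" "S \<subseteq> {..<m}"
  shows "emeasure (powM mu n) (cell b n \<kappa>) = ennreal (w S)"
  unfolding w_def
proof (rule emeasure_cell[OF sf b_sets b_fin])
  show "\<kappa> i < m" if "i < n" for i using bij_betwE[OF assms(1)] assms(2) that by auto
qed (use assms in auto)

lemma e_on_cell:
  assumes "bij_betw \<kappa> {..<q} S" "S \<subseteq> {..<m}" "x \<in> cell b q \<kappa>"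
  shows "e x = a S / fact q"
proof -
  have "e x = a (\<kappa> ` {..<q}) / fact q"
    using assms by (intro e_cell) (auto simp: bij_betw_def cell_def PiE_iff)
  then show ?thesis using assms(1) by (simp add: bij_betw_def)
qed

lemma layer_finite: "S \<in> layer n \<Longrightarrow> finite S \<and> S \<subseteq> {..<m} \<and> card S = n"
  using finite_subset[of S "{..<m}"] by (auto simp: layer_def)

text \<open>On the box of \<open>S\<close> the coefficient \<open>a S\<close> equals q! e, so
  \<open>round_sq_le\<close> with K = q! holds at each of its points and is summed over disjoint
  boxes.\<close>

lemma rounding_error:
  assumes \<Delta>: "0 \<le> \<Delta>" "(\<integral>\<^sup>+x. ennreal ((f x - fact q * (f x)\<^sup>2)\<^sup>2) \<partial>powM mu q) \<le> ennreal \<Delta>"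
  shows "(\<Sum>S\<in>layer q. w S * (a S - (if a S > 1/2 then 1 else 0))\<^sup>2) \<le> 2 * (fact q)\<^sup>2 * \<tau> + 8 * (fact q)\<^sup>2 * \<Delta>"
proof -
  let ?u = "\<lambda>S. (a S - (if a S > 1/2 then 1 else 0))\<^sup>2" and ?K = "fact q :: real"
  have "ennreal (\<Sum>S\<in>layer q. w S * ?u S) = (\<Sum>S\<in>layer q. ennreal (?u S) * emeasure (powM mu q) (cell b q (listing S)))"
    unfolding sum_ennreal[OF mult_nonneg_nonneg[OF w_nonneg zero_le_power2], symmetric]
  proof (rule sum.cong)
    fix S assume "S \<in> layer q"
    then have "emeasure (powM mu q) (cell b q (listing S)) = ennreal (w S)"
      using layer_finite[of S q] listing_bij[of S] by (intro cell_w) auto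
    then show "ennreal (w S * ?u S) = ennreal (?u S) * emeasure (powM mu q) (cell b q (listing S))"
      by (simp add: ennreal_mult w_nonneg mult.commute)
  qed simp
  also have "\<dots> \<le> (\<integral>\<^sup>+x. ennreal (2 * ?K\<^sup>2 * (f x - e x)\<^sup>2 + 8 * ?K\<^sup>2 * (f x - ?K * (f x)\<^sup>2)\<^sup>2) \<partial>powM mu q)"
  proof (rule sum_cells_le[OF b_sets b_disj finite_layer])
    show "listing S i < m" if "S \<in> layer q" "i < q" for S i
      using layer_finite[OF that(1)] listing_mem[of S i] that(2) by auto
    show "S = S'" if "S \<in> layer q" "S' \<in> layer q" "\<And>i. i < q \<Longrightarrow> listing S i = listing S' i" for S S'
      using layer_finite[OF that(1)] layer_finite[OF that(2)] that(3) by (intro listing_inj) auto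
    fix S x assume S: "S \<in> layer q" and x: "x \<in> cell b q (listing S)"
    have "e x = a S / ?K"
      using layer_finite[OF S] listing_bij[of S] x by (intro e_on_cell) auto
    then have "a S = ?K * e x" by simp
    then show "ennreal (?u S) \<le> ennreal (2 * ?K\<^sup>2 * (f x - e x)\<^sup>2 + 8 * ?K\<^sup>2 * (f x - ?K * (f x)\<^sup>2)\<^sup>2)"
      using round_sq_le[of ?K "e x" "f x"] by (intro ennreal_leI) simp
  qed
  also have "\<dots> = (\<integral>\<^sup>+x. ennreal (2 * ?K\<^sup>2) * ennreal ((f x - e x)\<^sup>2)
      + ennreal (8 * ?K\<^sup>2) * ennreal ((f x - ?K * (f x)\<^sup>2)\<^sup>2) \<partial>powM mu q)"
    by (intro nn_integral_cong) (simp only: ennreal_mult'[symmetric] ennreal_plus[symmetric] zero_le_power2 mult_nonneg_nonneg zero_le_numeral)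
  also have "\<dots> = ennreal (2 * ?K\<^sup>2) * (\<integral>\<^sup>+x. ennreal ((f x - e x)\<^sup>2) \<partial>powM mu q)
      + ennreal (8 * ?K\<^sup>2) * (\<integral>\<^sup>+x. ennreal ((f x - ?K * (f x)\<^sup>2)\<^sup>2) \<partial>powM mu q)"
    by (subst nn_integral_add) (auto simp: nn_integral_cmult)
  also have "\<dots> \<le> ennreal (2 * ?K\<^sup>2) * ennreal \<tau> + ennreal (8 * ?K\<^sup>2) * ennreal \<Delta>"
    using \<tau> \<Delta> by (intro add_mono mult_left_mono) auto
  also have "\<dots> = ennreal (2 * ?K\<^sup>2 * \<tau> + 8 * ?K\<^sup>2 * \<Delta>)"
    using \<tau> \<Delta> by (simp add: ennreal_mult ennreal_plus)
  finally show ?thesis using \<tau> \<Delta> by (subst (asm) ennreal_le_iff) auto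
qed

text \<open>The heavy sets of size \<open>j\<close> cover a region of measure at most \<open>Q / \<epsilon>\<close>, where \<open>Q\<close> is the left-hand
  side. Bounding the integral of the contraction over that region by AM-GM gives back \<open>Q / 2\<close>, which
  is absorbed.\<close>

lemma heavy_mass:
  assumes j: "1 \<le> j" "j < q" and \<epsilon>: "0 < \<epsilon>"
    and fin: "\<And>y. y \<in> space (powM mu j) \<Longrightarrow> contr_abs_finite mu q q q (q - j) f f y"
    and contr_meas: "contr mu q q q (q - j) f f \<in> borel_measurable (powM mu j)"
    and \<Phi>: "0 \<le> \<Phi>" "(\<integral>\<^sup>+y. ennreal ((contr mu q q q (q - j) f f y)\<^sup>2) \<partial>powM mu j) \<le> ennreal \<Phi>"
  shows "(\<Sum>J\<in>{J \<in> heavy q a \<epsilon>. card J = j}. w J * H (upper q a) J)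
    \<le> 64 * (fact q) ^ 4 * \<Phi> / \<epsilon> + 16 * (fact q)\<^sup>2 * \<tau>"
proof -
  let ?K = "fact q :: real"
  define l where "l = q - j"
  have l: "l \<le> q" "q - l = j" using j by (auto simp: l_def)
  define G where "G = {J \<in> heavy q a \<epsilon>. card J = j}"
  have G: "finite J \<and> J \<subseteq> {..<m} \<and> card J = j \<and> H (upper q a) J > \<epsilon>" if "J \<in> G" for J
    using that finite_subset[of J "{..<m}"] by (auto simp: G_def heavy_def mid_def)
  have finG: "finite G" unfolding G_def heavy_def using finite_mid by simp
  have upper: "upper q a \<subseteq> Pow {..<m}" "finite (upper q a)" "upper q a \<subseteq> layer q"
    using finite_layer[of q] by (auto simp: upper_def layer_def)
  \<comment> \<open>Pairs of a heavy set and a member above it. Summing \<open>w\<close> of the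
    member over the pairs gives \<open>Q\<close>, a member being counted once for each set of
    \<open>G\<close> inside it.\<close>
  define X where "X = (SIGMA J:G. {S\<in>upper q a. J \<subseteq> S})"
  have finX: "finite X" unfolding X_def using finG upper by auto
  define Q where "Q = (\<Sum>J\<in>G. w J * H (upper q a) J)"
  have Q_nonneg: "0 \<le> Q" unfolding Q_def by (intro sum_nonneg mult_nonneg_nonneg w_nonneg H_nonneg)
  have Q_X: "Q = (\<Sum>t\<in>X. w (snd t))"
    unfolding Q_def X_def sum_w_H[OF upper(1)] using finG upper by (subst sum.Sigma) (auto simp: case_prod_unfold)
  \<comment> \<open>The box of a pair lists \<open>J\<close> last, so its tail lies in
    \<open>E\<close>. The pair can be read off from the ordering, so pairs with the same
    \<open>S\<close> but different \<open>J\<close> still have disjoint boxes.\<close>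
  define \<kappa> where "\<kappa> t i = (if i < l then listing (snd t - fst t) i else listing (fst t) (i - l))"
    for t :: "nat set \<times> nat set" and i
  have \<kappa>_bij: "bij_betw (\<kappa> t) {..<q} (snd t)" "snd t \<subseteq> {..<m}" "snd t \<in> upper q a" "fst t \<in> G" "fst t \<subseteq> snd t"
    if "t \<in> X" for t
  proof -
    have t: "fst t \<in> G" "snd t \<in> upper q a" "fst t \<subseteq> snd t" using that by (auto simp: X_def)
    then have "snd t \<in> layer q" using upper(3) by auto
    from layer_finite[OF this] show "bij_betw (\<kappa> t) {..<q} (snd t)" "snd t \<subseteq> {..<m}" "snd t \<in> upper q a" "fst t \<in> G" "fst t \<subseteq> snd t"
      using t G[of "fst t"] l unfolding \<kappa>_def by (auto intro!: glue_cell_bij)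
  qed
  define E where "E = (\<Union>J\<in>G. cell b j (listing J))"
  have E_cell: "cell b j (listing J) \<in> sets (powM mu j)" if "J \<in> G" for J
    using G[OF that] listing_mem[of J] b_sets by (intro cell_sets[where m = m]) auto
  have E_sets: "E \<in> sets (powM mu j)" unfolding E_def using finG E_cell by auto
  have E_measure: "emeasure (powM mu j) E \<le> ennreal (Q / \<epsilon>)"
  proof -
    have "emeasure (powM mu j) E \<le> (\<Sum>J\<in>G. emeasure (powM mu j) (cell b j (listing J)))"
      unfolding E_def using finG E_cell by (intro emeasure_subadditive_finite) auto
    also have "\<dots> = (\<Sum>J\<in>G. ennreal (w J))"
      using G listing_bij by (intro sum.cong refl cell_w) auto
    also have "\<dots> = ennreal (\<Sum>J\<in>G. w J)" by (intro sum_ennreal w_nonneg)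
    also have "\<dots> \<le> ennreal (Q / \<epsilon>)"
    proof (rule ennreal_leI)
      have "(\<Sum>J\<in>G. w J) * \<epsilon> \<le> Q"
        unfolding Q_def sum_distrib_right using G by (intro sum_mono mult_left_mono w_nonneg) fastforce
      then show "(\<Sum>J\<in>G. w J) \<le> Q / \<epsilon>" using \<epsilon> by (simp add: field_simps)
    qed
    finally show ?thesis .
  qed
  define tail where "tail x = restrict (\<lambda>i. x (i + l)) {..<j}" for x :: "nat \<Rightarrow> 'z"
  have [measurable]: "tail \<in> measurable (powM mu q) (powM mu j)"
    unfolding tail_def using l j by (intro measurable_restrict measurable_component_singleton) (auto simp: l_def)
  have tail_glue: "tail (glue q l z y) = y" if "y \<in> space (powM mu j)" for z y
    using that l j by (auto simp: tail_def glue_def space_PiM PiE_iff extensional_def l_def fun_eq_iff)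
  have [measurable]: "(\<lambda>x. indicator E (tail x) :: ennreal) \<in> borel_measurable (powM mu q)"
    using E_sets by measurable
  let ?M = "powM mu q"
  define T where "T = (\<integral>\<^sup>+x. ennreal ((f x)\<^sup>2) * indicator E (tail x) \<partial>?M)"
  \<comment> \<open>On each box q! e = \<open>a S\<close> exceeds 1/2, and e^2 is at most 2 f^2 + 2
    (f - e)^2; together they give the constant 8 (q!)^2. The approximation error is integrated over
    the whole space, so only f^2 keeps the indicator of \<open>E\<close>.\<close>
  have Q1: "ennreal Q \<le> ennreal (8 * ?K\<^sup>2) * (T + ennreal \<tau>)"
  proof -
    have "ennreal Q = (\<Sum>t\<in>X. 1 * emeasure ?M (cell b q (\<kappa> t)))"
      unfolding Q_X sum_ennreal[OF w_nonneg, symmetric]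
      by (intro sum.cong refl) (simp only: cell_w[OF \<kappa>_bij(1,2)] mult_1)
    also have "\<dots> \<le> (\<integral>\<^sup>+x. ennreal (8 * ?K\<^sup>2) * (ennreal ((f x)\<^sup>2) * indicator E (tail x)
        + ennreal ((f x - e x)\<^sup>2)) \<partial>?M)"
    proof (rule sum_cells_le[OF b_sets b_disj finX])
      show "\<kappa> t i < m" if "t \<in> X" "i < q" for t i
        using \<kappa>_bij[OF that(1)] that(2) by (auto simp: bij_betw_def)
      show "t = t'" if t: "t \<in> X" "t' \<in> X" and eq: "\<And>i. i < q \<Longrightarrow> \<kappa> t i = \<kappa> t' i" for t t'
      proof -
        have "snd t = \<kappa> t ` {..<q}" using \<kappa>_bij[OF t(1)] by (simp add: bij_betw_def)
        also have "\<dots> = \<kappa> t' ` {..<q}" using eq by (intro image_cong) auto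
        also have "\<dots> = snd t'" using \<kappa>_bij[OF t(2)] by (simp add: bij_betw_def)
        finally have "snd t = snd t'" .
        moreover have "fst t = fst t'"
        proof (rule listing_inj)
          show "finite (fst t)" "finite (fst t')" "card (fst t) = card (fst t')"
            using G[OF \<kappa>_bij(4)[OF t(1)]] G[OF \<kappa>_bij(4)[OF t(2)]] by auto
          fix i assume "i < card (fst t)"
          then have "i + l < q" using G[OF \<kappa>_bij(4)[OF t(1)]] l j by (simp add: l_def)
          from eq[OF this] show "listing (fst t) i = listing (fst t') i" by (simp add: \<kappa>_def)
        qed
        ultimately show ?thesis by (rule prod_eqI[rotated])
      qed
      fix t x assume t: "t \<in> X" and x: "x \<in> cell b q (\<kappa> t)"
      have ex: "e x = a (snd t) / ?K" using e_on_cell[OF \<kappa>_bij(1,2)[OF t] x] .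
      have "a (snd t) > 1/2" using \<kappa>_bij(3)[OF t] by (simp add: upper_def)
      then have "1/2 < ?K * e x" using ex by simp
      then have "(1/2)\<^sup>2 \<le> (?K * e x)\<^sup>2" by (intro power_mono) auto
      also have "(?K * e x)\<^sup>2 \<le> ?K\<^sup>2 * (2 * ((f x)\<^sup>2 + (f x - e x)\<^sup>2))"
      proof -
        have "(e x)\<^sup>2 \<le> 2 * ((f x)\<^sup>2 + (f x - e x)\<^sup>2)"
          using zero_le_power2[of "2 * f x - e x"] by (simp add: power2_eq_square algebra_simps)
        then show ?thesis by (simp add: power_mult_distrib mult_left_mono)
      qed
      finally have ge: "1 \<le> 8 * ?K\<^sup>2 * ((f x)\<^sup>2 + (f x - e x)\<^sup>2)" by (simp add: power2_eq_square algebra_simps)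
      have "tail x \<in> cell b j (listing (fst t))"
        unfolding tail_def cell_def
      proof (intro PiE_I)
        fix i assume i: "i \<in> {..<j}"
        then have "i + l < q" using j by (simp add: l_def)
        then have "x (i + l) \<in> b (\<kappa> t (i + l))"
          using PiE_mem[OF x[unfolded cell_def], of "i + l"] by simp
        then show "restrict (\<lambda>i. x (i + l)) {..<j} i \<in> b (listing (fst t) i)"
          using i by (simp add: \<kappa>_def)
      qed auto
      then have "tail x \<in> E" using \<kappa>_bij(4)[OF t] by (auto simp: E_def)
      then have "ennreal (8 * ?K\<^sup>2) * (ennreal ((f x)\<^sup>2) * indicator E (tail x) + ennreal ((f x - e x)\<^sup>2))
          = ennreal (8 * ?K\<^sup>2 * ((f x)\<^sup>2 + (f x - e x)\<^sup>2))"
        by (simp add: ennreal_mult ennreal_plus)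
      then show "1 \<le> ennreal (8 * ?K\<^sup>2) * (ennreal ((f x)\<^sup>2) * indicator E (tail x) + ennreal ((f x - e x)\<^sup>2))"
        using ge by simp
    qed
    also have "\<dots> = ennreal (8 * ?K\<^sup>2) * (T + (\<integral>\<^sup>+x. ennreal ((f x - e x)\<^sup>2) \<partial>?M))"
      unfolding T_def by (subst nn_integral_cmult) (auto simp: nn_integral_add)
    also have "\<dots> \<le> ennreal (8 * ?K\<^sup>2) * (T + ennreal \<tau>)"
      using \<tau> by (intro mult_left_mono add_mono) auto
    finally show ?thesis .
  qed
  \<comment> \<open>Chosen so that the term 8 (q!)^2 \<theta> Q / \<epsilon> below is exactly Q / 2
    and can be moved to the left, which doubles the other constants 32 and 8.\<close>
  define \<theta> where "\<theta> = \<epsilon> / (16 * ?K\<^sup>2)"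
  have \<theta>: "0 < \<theta>" using \<epsilon> by (simp add: \<theta>_def)
  let ?c = "contr mu q q q l f f"
  have c_meas [measurable]: "?c \<in> borel_measurable (powM mu j)" using contr_meas by (simp add: l_def)
  have "T = (\<integral>\<^sup>+y. \<integral>\<^sup>+z. ennreal ((f (glue q l z y))\<^sup>2) * indicator E (tail (glue q l z y)) \<partial>powM mu l \<partial>powM mu (q - l))"
    unfolding T_def by (rule nn_integral_powM_glue[OF sf l(1)]) measurable
  \<comment> \<open>The indicator depends on the free variables only, so integrating the others
    turns f^2 into the contraction.\<close>
  also have "\<dots> = (\<integral>\<^sup>+y. ennreal (?c y) * indicator E y \<partial>powM mu j)"
    unfolding l(2)
  proof (rule nn_integral_cong)
    fix y assume y: "y \<in> space (powM mu j)"
    have fin': "contr_abs_finite mu q q q l f f y" using fin[OF y] by (simp add: l_def)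
    have "(\<lambda>z. (y, z)) \<in> measurable (powM mu l) (powM mu (q - l) \<Otimes>\<^sub>M powM mu l)"
      using y l by simp
    from measurable_compose[OF this glue_measurable[OF l(1), of mu]]
    have [measurable]: "(\<lambda>z. glue q l z y) \<in> measurable (powM mu l) (powM mu q)" by simp
    show "(\<integral>\<^sup>+z. ennreal ((f (glue q l z y))\<^sup>2) * indicator E (tail (glue q l z y)) \<partial>powM mu l)
        = ennreal (?c y) * indicator E y"
      using contr_top_eq[OF l(1) f_meas fin'] y
      by (simp add: tail_glue l(2) nn_integral_multc)
  qed
  also have "\<dots> \<le> (\<integral>\<^sup>+y. ennreal \<theta> * indicator E y + ennreal (1 / (4 * \<theta>)) * ennreal ((?c y)\<^sup>2) \<partial>powM mu j)"
  proof (rule nn_integral_mono)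
    fix y
    have "?c y \<le> \<theta> + 1 / (4 * \<theta>) * (?c y)\<^sup>2"
      using \<theta> zero_le_power2[of "2 * \<theta> - ?c y"] by (simp add: field_simps power2_eq_square)
    then have "ennreal (?c y) \<le> ennreal (\<theta> + 1 / (4 * \<theta>) * (?c y)\<^sup>2)" by (rule ennreal_leI)
    also have "\<dots> = ennreal \<theta> + ennreal (1 / (4 * \<theta>)) * ennreal ((?c y)\<^sup>2)"
      using \<theta> by (simp add: ennreal_plus ennreal_mult[symmetric])
    finally show "ennreal (?c y) * indicator E y \<le> ennreal \<theta> * indicator E y + ennreal (1 / (4 * \<theta>)) * ennreal ((?c y)\<^sup>2)"
      by (auto simp: indicator_def)
  qed
  also have "\<dots> = ennreal \<theta> * emeasure (powM mu j) E + ennreal (1 / (4 * \<theta>)) * (\<integral>\<^sup>+y. ennreal ((?c y)\<^sup>2) \<partial>powM mu j)"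
    using E_sets by (subst nn_integral_add) (auto simp: nn_integral_cmult)
  also have "\<dots> \<le> ennreal \<theta> * ennreal (Q / \<epsilon>) + ennreal (1 / (4 * \<theta>)) * ennreal \<Phi>"
    using E_measure \<Phi> by (intro add_mono mult_left_mono) (auto simp: l_def)
  also have "\<dots> = ennreal (\<theta> * (Q / \<epsilon>) + 1 / (4 * \<theta>) * \<Phi>)"
  proof -
    have "ennreal \<theta> * ennreal (Q / \<epsilon>) = ennreal (\<theta> * (Q / \<epsilon>))"
      "ennreal (1 / (4 * \<theta>)) * ennreal \<Phi> = ennreal (1 / (4 * \<theta>) * \<Phi>)"
      by (rule ennreal_mult[symmetric]; use \<theta> Q_nonneg \<epsilon> \<Phi> in simp)+
    moreover have "0 \<le> \<theta> * (Q / \<epsilon>)" "0 \<le> 1 / (4 * \<theta>) * \<Phi>" using \<theta> Q_nonneg \<epsilon> \<Phi> by auto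
    ultimately show ?thesis by (simp only: ennreal_plus)
  qed
  finally have T: "T \<le> ennreal (\<theta> * (Q / \<epsilon>) + 1 / (4 * \<theta>) * \<Phi>)" .
  have pos: "0 \<le> \<theta> * (Q / \<epsilon>) + 1 / (4 * \<theta>) * \<Phi>" using \<theta> Q_nonneg \<epsilon> \<Phi> by simp
  have "ennreal Q \<le> ennreal (8 * ?K\<^sup>2) * (ennreal (\<theta> * (Q / \<epsilon>) + 1 / (4 * \<theta>) * \<Phi>) + ennreal \<tau>)"
    by (rule order_trans[OF Q1 mult_left_mono[OF add_right_mono[OF T]]]) simp
  also have "\<dots> = ennreal (8 * ?K\<^sup>2 * (\<theta> * (Q / \<epsilon>) + 1 / (4 * \<theta>) * \<Phi> + \<tau>))"
    using pos \<tau>(1) by (subst ennreal_mult) (auto simp: ennreal_plus simp del: times_divide_eq_right times_divide_eq_left)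
  finally have "Q \<le> 8 * ?K\<^sup>2 * (\<theta> * (Q / \<epsilon>) + 1 / (4 * \<theta>) * \<Phi> + \<tau>)"
    using \<theta> Q_nonneg \<epsilon> \<Phi> \<tau> by (subst (asm) ennreal_le_iff) auto
  also have "\<dots> = Q / 2 + 32 * ?K ^ 4 * \<Phi> / \<epsilon> + 8 * ?K\<^sup>2 * \<tau>"
    using \<epsilon> by (simp add: \<theta>_def field_simps power2_eq_square power4_eq_xxxx)
  finally have "Q \<le> 64 * ?K ^ 4 * \<Phi> / \<epsilon> + 16 * ?K\<^sup>2 * \<tau>" by (simp add: field_simps)
  then show ?thesis by (simp add: Q_def G_def)
qed

end

section \<open>Approximation by a U-statistic\<close>

lemma nn_integral_add_sq_le:
  fixes k g h :: "'a \<Rightarrow> real"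
  assumes [measurable]: "g \<in> borel_measurable M" "h \<in> borel_measurable M"
    and gh: "\<And>x. k x = g x + h x"
    and A: "0 \<le> A" "(\<integral>\<^sup>+x. ennreal ((g x)\<^sup>2) \<partial>M) \<le> ennreal A"
    and B: "0 \<le> B" "(\<integral>\<^sup>+x. ennreal ((h x)\<^sup>2) \<partial>M) \<le> ennreal B"
  shows "(\<integral>\<^sup>+x. ennreal ((k x)\<^sup>2) \<partial>M) \<le> ennreal (2 * A + 2 * B)"
proof -
  have "(\<integral>\<^sup>+x. ennreal ((k x)\<^sup>2) \<partial>M) \<le> (\<integral>\<^sup>+x. ennreal 2 * ennreal ((g x)\<^sup>2) + ennreal 2 * ennreal ((h x)\<^sup>2) \<partial>M)"
  proof (rule nn_integral_mono)
    fix x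
    have "(k x)\<^sup>2 \<le> 2 * (g x)\<^sup>2 + 2 * (h x)\<^sup>2"
      using zero_le_power2[of "g x - h x"] unfolding gh by (simp add: power2_eq_square algebra_simps)
    then have "ennreal ((k x)\<^sup>2) \<le> ennreal (2 * (g x)\<^sup>2 + 2 * (h x)\<^sup>2)" by (rule ennreal_leI)
    also have "\<dots> = ennreal 2 * ennreal ((g x)\<^sup>2) + ennreal 2 * ennreal ((h x)\<^sup>2)"
      by (subst ennreal_plus) (auto simp: ennreal_mult)
    finally show "ennreal ((k x)\<^sup>2) \<le> ennreal 2 * ennreal ((g x)\<^sup>2) + ennreal 2 * ennreal ((h x)\<^sup>2)" .
  qed
  also have "\<dots> = ennreal 2 * (\<integral>\<^sup>+x. ennreal ((g x)\<^sup>2) \<partial>M) + ennreal 2 * (\<integral>\<^sup>+x. ennreal ((h x)\<^sup>2) \<partial>M)"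
    by (subst nn_integral_add) (auto simp: nn_integral_cmult)
  also have "\<dots> \<le> ennreal 2 * ennreal A + ennreal 2 * ennreal B"
    using A B by (intro add_mono mult_left_mono) auto
  also have "\<dots> = ennreal (2 * A + 2 * B)"
    using A B by (subst ennreal_plus) (auto simp: ennreal_mult)
  finally show ?thesis .
qed

text \<open>The first 2 \<tau> is the cost of passing from the multiple integral to an elementary
  one. The rest is twice the bound of \<open>sparse_approx\<close>, with
  \<open>rounding_error\<close> and, for at most \<open>q\<close> sizes of heavy sets,
  \<open>heavy_mass\<close> inserted.\<close>

definition approx_err :: "nat \<Rightarrow> real \<Rightarrow> real \<Rightarrow> real \<Rightarrow> real \<Rightarrow> real" where
  "approx_err q \<tau> \<Delta> \<Phi> \<epsilon> = 2 * \<tau> + 2 * (2 * (2 * (fact q)\<^sup>2 * \<tau> + 8 * (fact q)\<^sup>2 * \<Delta>)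
     + 2 * (real q * (64 * (fact q) ^ 4 * \<Phi> / \<epsilon> + 16 * (fact q)\<^sup>2 * \<tau>)))"

text \<open>\<open>N\<close> is the count of the pruned family, \<open>V\<close> its top chaos
  component and \<open>lam\<close> its mean. \<open>V\<close> is kept as a link: it is close to
  \<open>X\<close> through the kernels, close to \<open>N - lam\<close> through the excess, and its
  second moment \<open>lam\<close> ties the mean to the second moment of \<open>X\<close>.\<close>

lemma poisson_U_statistic_approx:
  fixes M :: "'w measure" and mu :: "'z measure"
  assumes pm: "poisson_measure M mu eta" and sf: "sigma_finite_measure mu" and q: "1 \<le> q"
    and f_meas: "f \<in> borel_measurable (powM mu q)" and X: "is_mwi M mu eta q f X"
    and \<Delta>: "0 \<le> \<Delta>" "(\<integral>\<^sup>+x. ennreal ((f x - fact q * (f x)\<^sup>2)\<^sup>2) \<partial>powM mu q) \<le> ennreal \<Delta>"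
    and fin: "\<And>j y. j \<in> {1..<q} \<Longrightarrow> y \<in> space (powM mu j) \<Longrightarrow> contr_abs_finite mu q q q (q - j) f f y"
    and contr_meas: "\<And>j. j \<in> {1..<q} \<Longrightarrow> contr mu q q q (q - j) f f \<in> borel_measurable (powM mu j)"
    and \<Phi>: "0 \<le> \<Phi>" "\<And>j. j \<in> {1..<q} \<Longrightarrow> (\<integral>\<^sup>+y. ennreal ((contr mu q q q (q - j) f f y)\<^sup>2) \<partial>powM mu j) \<le> ennreal \<Phi>"
    and \<epsilon>: "0 < \<epsilon>" and \<tau>: "0 < \<tau>"
  obtains N :: "'w \<Rightarrow> nat" and V :: "'w \<Rightarrow> real" and lam :: real where
    "N \<in> measurable M (count_space UNIV)" "V \<in> borel_measurable M" "0 \<le> lam"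
    "(\<integral>\<^sup>+\<omega>. ennreal ((X \<omega> - V \<omega>)\<^sup>2) \<partial>M) \<le> ennreal (approx_err q \<tau> \<Delta> \<Phi> \<epsilon>)"
    "(\<integral>\<^sup>+\<omega>. ennreal ((V \<omega>)\<^sup>2) \<partial>M) = ennreal lam"
    "(\<integral>\<^sup>+\<omega>. ennreal ((real (N \<omega>) - lam - V \<omega>)\<^sup>2) \<partial>M) \<le> ennreal (\<epsilon> * 2 ^ q * lam)"
    "\<And>k. \<bar>real (Suc k) * measure M {\<omega>\<in>space M. N \<omega> = Suc k} - lam * measure M {\<omega>\<in>space M. N \<omega> = k}\<bar>
       \<le> \<epsilon> * 2 ^ q * lam"
proof -
  have X_meas [measurable]: "X \<in> borel_measurable M" using X by (simp add: is_mwi_def)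
  obtain ts where valid: "\<And>j. elem_valid mu q (ts j)"
    and lim1: "(\<lambda>j. \<integral>\<^sup>+x. ennreal ((f x - elem_kernel q (ts j) x)\<^sup>2) \<partial>powM mu q) \<longlonglongrightarrow> 0"
    and lim2: "(\<lambda>j. \<integral>\<^sup>+\<omega>. ennreal ((X \<omega> - elem_int mu eta q (ts j) \<omega>)\<^sup>2) \<partial>M) \<longlonglongrightarrow> 0"
    using X by (auto simp: is_mwi_def)
  \<comment> \<open>One index has to serve both limits, since the kernel and its integral come from
    the same list.\<close>
  have "\<forall>\<^sub>F j in sequentially. (\<integral>\<^sup>+x. ennreal ((f x - elem_kernel q (ts j) x)\<^sup>2) \<partial>powM mu q) < ennreal \<tau>
      \<and> (\<integral>\<^sup>+\<omega>. ennreal ((X \<omega> - elem_int mu eta q (ts j) \<omega>)\<^sup>2) \<partial>M) < ennreal \<tau>"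
    using order_tendstoD(2)[OF lim1, of "ennreal \<tau>"] order_tendstoD(2)[OF lim2, of "ennreal \<tau>"] \<tau>
    by (intro eventually_conj) auto
  then obtain j0 where j0: "(\<integral>\<^sup>+x. ennreal ((f x - elem_kernel q (ts j0) x)\<^sup>2) \<partial>powM mu q) \<le> ennreal \<tau>"
    "(\<integral>\<^sup>+\<omega>. ennreal ((X \<omega> - elem_int mu eta q (ts j0) \<omega>)\<^sup>2) \<partial>M) \<le> ennreal \<tau>"
    using eventually_happens'[OF sequentially_bot] less_imp_le by blast
  obtain m :: nat and b and a :: "nat set \<Rightarrow> real" where
    b: "\<And>i. i < m \<Longrightarrow> b i \<in> sets mu" "\<And>i. i < m \<Longrightarrow> emeasure mu (b i) < \<infinity>" "disjoint_family_on b {..<m}"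
    and ker: "\<And>\<kappa> x. inj_on \<kappa> {..<q} \<Longrightarrow> (\<And>i. i < q \<Longrightarrow> \<kappa> i < m) \<Longrightarrow> (\<And>i. i < q \<Longrightarrow> x i \<in> b (\<kappa> i))
      \<Longrightarrow> elem_kernel q (ts j0) x = a (\<kappa> ` {..<q}) / fact q"
    and int: "\<And>\<nu> :: 'z set \<Rightarrow> real. (\<And>K. K \<subseteq> {..<m} \<Longrightarrow> \<nu> (\<Union>k\<in>K. b k) = (\<Sum>k\<in>K. \<nu> (b k))) \<Longrightarrow>
      (\<Sum>(c, A)\<leftarrow>ts j0. c * (\<Prod>i<q. \<nu> (A i)))
        = (\<Sum>S\<in>{S. S \<subseteq> {..<m} \<and> card S = q}. a S * (\<Prod>k\<in>S. \<nu> (b k)))"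
    apply (rule elementary_grid[OF valid[of j0]])
    subgoal premises p for m b a by (rule p(1)) (fact p)+
    done
  interpret kernel_grid mu q f "elem_kernel q (ts j0)" m b a \<tau>
    by (rule kernel_grid.intro) (fact sf f_meas elem_kernel_measurable[OF valid] b ker j0(1) less_imp_le[OF \<tau>])+
  define C where "C = counts eta b m"
  have C_meas [measurable]: "C \<in> measurable M (count_space UNIV)"
    unfolding C_def by (rule counts_measurable[OF pm b])
  have C_distr: "distr M (count_space UNIV) C = measure_pmf P"
    unfolding C_def P_def by (rule counts_distr[OF pm b])
  have C_AE: "AE \<omega> in M. \<forall>i<m. emeasure (eta \<omega>) (b i) = of_nat (C \<omega> i)"
    unfolding C_def by (rule counts_AE[OF pm b])
  have transfer: "(\<integral>\<^sup>+\<omega>. g (C \<omega>) \<partial>M) = (\<integral>\<^sup>+v. g v \<partial>P)" for g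
    unfolding C_distr[symmetric] by (subst nn_integral_distr) auto
  have C_borel [measurable]: "(\<lambda>\<omega>. g (C \<omega>)) \<in> borel_measurable M" for g :: "(nat \<Rightarrow> nat) \<Rightarrow> real"
    by (rule measurable_compose[OF C_meas]) simp
  define \<A> where "\<A> = sparse q a \<epsilon>"
  have \<A>: "S \<subseteq> {..<m} \<and> card S = q" if "S \<in> \<A>" for S
    using that by (auto simp: \<A>_def sparse_def upper_def layer_def)
  have \<A>_sub: "\<A> \<subseteq> Pow {..<m}" "\<A> \<subseteq> layer q" using \<A> by (auto simp: layer_def)
  define lam where "lam = sum w \<A>"
  define Y where "Y v = (\<Sum>S\<in>layer q. a S * cprod S v)" for v
  define V where "V v = (\<Sum>S\<in>\<A>. cprod S v)" for v
  have lam0: "0 \<le> lam" unfolding lam_def by (intro sum_nonneg w_nonneg)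
  have exc: "excess \<A> q \<le> \<epsilon> * 2 ^ q * lam"
    unfolding \<A>_def lam_def using \<epsilon> by (intro excess_sparse) simp
  \<comment> \<open>Outside a null set all cells have finite integer mass, so the real-valued eta -
    mu is additive on unions of cells, as the grid identity demands.\<close>
  have Y_AE: "AE \<omega> in M. elem_int mu eta q (ts j0) \<omega> = Y (C \<omega>)"
    using C_AE AE_space
  proof eventually_elim
    case (elim \<omega>)
    have eta_sets: "sets (eta \<omega>) = sets mu" using pm elim(2) by (simp add: poisson_measure_def)
    have add: "measure N (\<Union>k\<in>K. b k) = (\<Sum>k\<in>K. measure N (b k))"
      if "K \<subseteq> {..<m}" "sets N = sets mu" "\<And>k. k < m \<Longrightarrow> emeasure N (b k) \<noteq> \<infinity>" for K and N :: "'z measure"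
      using that b finite_subset[OF that(1)] disjoint_family_on_mono[OF that(1) b(3)]
      by (intro measure_finite_Union) auto
    have "elem_int mu eta q (ts j0) \<omega> = (\<Sum>S\<in>layer q. a S * (\<Prod>k\<in>S. measure (eta \<omega>) (b k) - measure mu (b k)))"
      unfolding elem_int_def layer_def
    proof (subst int[where \<nu> = "\<lambda>A. measure (eta \<omega>) A - measure mu A", symmetric])
      fix K assume K: "K \<subseteq> {..<m}"
      have "measure (eta \<omega>) (\<Union>k\<in>K. b k) = (\<Sum>k\<in>K. measure (eta \<omega>) (b k))"
        using elim(1) by (intro add K eta_sets) auto
      moreover have "measure mu (\<Union>k\<in>K. b k) = (\<Sum>k\<in>K. measure mu (b k))"
        using b(2) by (intro add K refl) fastforce
      ultimately show "measure (eta \<omega>) (\<Union>k\<in>K. b k) - measure mu (\<Union>k\<in>K. b k)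
          = (\<Sum>k\<in>K. measure (eta \<omega>) (b k) - measure mu (b k))"
        by (simp add: sum_subtractf)
    qed (simp add: measure_def)
    also have "\<dots> = Y (C \<omega>)"
      unfolding Y_def cprod_def
    proof (intro sum.cong refl arg_cong2[where f = times] prod.cong)
      fix S k assume "S \<in> layer q" "k \<in> S"
      then have "k < m" by (auto simp: layer_def)
      then show "measure (eta \<omega>) (b k) - measure mu (b k) = real (C \<omega> k) - measure mu (b k)"
        using elim(1) by (simp add: measure_def ennreal_of_nat_eq_real_of_nat)
    qed
    finally show ?case .
  qed
  have XY: "(\<integral>\<^sup>+\<omega>. ennreal ((X \<omega> - Y (C \<omega>))\<^sup>2) \<partial>M) \<le> ennreal \<tau>"
  proof -
    have "(\<integral>\<^sup>+\<omega>. ennreal ((X \<omega> - Y (C \<omega>))\<^sup>2) \<partial>M)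
        = (\<integral>\<^sup>+\<omega>. ennreal ((X \<omega> - elem_int mu eta q (ts j0) \<omega>)\<^sup>2) \<partial>M)"
      by (rule nn_integral_cong_AE) (use Y_AE in eventually_elim, simp)
    then show ?thesis using j0(2) by simp
  qed
  have iso: "(\<integral>\<^sup>+v. ennreal ((\<Sum>S\<in>\<S>. c S * cprod S v)\<^sup>2) \<partial>P) = ennreal (\<Sum>S\<in>\<S>. w S * (c S)\<^sup>2)"
    if "\<S> \<subseteq> Pow {..<m}" for \<S> c
    using chaos_isometry[OF that, of c] by (subst nn_integral_eq_integral) auto
  let ?K = "fact q :: real"
  let ?B = "2 * (2 * ?K\<^sup>2 * \<tau> + 8 * ?K\<^sup>2 * \<Delta>) + 2 * (real q * (64 * ?K ^ 4 * \<Phi> / \<epsilon> + 16 * ?K\<^sup>2 * \<tau>))"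
  have heavy: "(\<Sum>J\<in>heavy q a \<epsilon>. w J * H (upper q a) J) \<le> real q * (64 * ?K ^ 4 * \<Phi> / \<epsilon> + 16 * ?K\<^sup>2 * \<tau>)"
  proof -
    have "(\<Sum>J\<in>heavy q a \<epsilon>. w J * H (upper q a) J)
        = (\<Sum>j\<in>{1..<q}. \<Sum>J\<in>{J \<in> heavy q a \<epsilon>. card J = j}. w J * H (upper q a) J)"
      using finite_mid by (intro sum.group[symmetric]) (auto simp: heavy_def mid_def)
    also have "\<dots> \<le> (\<Sum>j\<in>{1..<q}. 64 * ?K ^ 4 * \<Phi> / \<epsilon> + 16 * ?K\<^sup>2 * \<tau>)"
      using fin contr_meas \<Phi> \<epsilon> by (intro sum_mono heavy_mass) auto
    also have "\<dots> \<le> real q * (64 * ?K ^ 4 * \<Phi> / \<epsilon> + 16 * ?K\<^sup>2 * \<tau>)"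
      using \<Phi> \<epsilon> \<tau> by (simp only: sum_constant, intro mult_right_mono) auto
    finally show ?thesis .
  qed
  have YV: "(\<integral>\<^sup>+\<omega>. ennreal ((Y (C \<omega>) - V (C \<omega>))\<^sup>2) \<partial>M) \<le> ennreal ?B"
  proof -
    \<comment> \<open>Both are combinations of orthogonal products of order \<open>q\<close>, so
      their squared distance is the weighted sum of the squared coefficient differences.\<close>
    have "Y v - V v = (\<Sum>S\<in>layer q. (a S - indicator \<A> S) * cprod S v)" for v
    proof -
      have "V v = (\<Sum>S\<in>layer q. indicator \<A> S * cprod S v)"
        unfolding V_def using \<A>_sub finite_layer
        by (intro sum.mono_neutral_cong_left) (auto simp: indicator_def)
      then show ?thesis by (simp add: Y_def sum_subtractf left_diff_distrib)
    qed
    then have "(\<integral>\<^sup>+\<omega>. ennreal ((Y (C \<omega>) - V (C \<omega>))\<^sup>2) \<partial>M) = ennreal (\<Sum>S\<in>layer q. w S * (a S - indicator \<A> S)\<^sup>2)"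
      unfolding transfer[of "\<lambda>v. ennreal ((Y v - V v)\<^sup>2)"] by (simp add: iso layer_def subset_iff)
    also have "\<dots> \<le> ennreal ?B"
      unfolding \<A>_def
      by (rule ennreal_leI[OF order_trans[OF sparse_approx add_mono[OF
              mult_left_mono[OF rounding_error[OF \<Delta>]] mult_left_mono[OF heavy]]]]) simp_all
    finally show ?thesis .
  qed
  show ?thesis
  proof (rule that[of "\<lambda>\<omega>. U \<A> (C \<omega>)" "\<lambda>\<omega>. V (C \<omega>)" lam])
    show "(\<lambda>\<omega>. U \<A> (C \<omega>)) \<in> measurable M (count_space UNIV)"
      by (rule measurable_compose[OF C_meas]) simp
    show "(\<lambda>\<omega>. V (C \<omega>)) \<in> borel_measurable M" by simp
    show "0 \<le> lam" by (rule lam0)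
    show "(\<integral>\<^sup>+\<omega>. ennreal ((X \<omega> - V (C \<omega>))\<^sup>2) \<partial>M) \<le> ennreal (approx_err q \<tau> \<Delta> \<Phi> \<epsilon>)"
      unfolding approx_err_def
    proof (rule nn_integral_add_sq_le[where g = "\<lambda>\<omega>. X \<omega> - Y (C \<omega>)" and h = "\<lambda>\<omega>. Y (C \<omega>) - V (C \<omega>)", OF _ _ _ _ XY _ YV])
      show "0 \<le> ?B" using \<Phi> \<epsilon> \<tau> \<Delta> by (intro add_nonneg_nonneg mult_nonneg_nonneg divide_nonneg_nonneg) auto
    qed (use \<tau> in auto)
    show "(\<integral>\<^sup>+\<omega>. ennreal ((V (C \<omega>))\<^sup>2) \<partial>M) = ennreal lam"
      using transfer[of "\<lambda>v. ennreal ((V v)\<^sup>2)"] iso[OF \<A>_sub(1), of "\<lambda>_. 1"] by (simp add: V_def lam_def)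
    show "(\<integral>\<^sup>+\<omega>. ennreal ((real (U \<A> (C \<omega>)) - lam - V (C \<omega>))\<^sup>2) \<partial>M) \<le> ennreal (\<epsilon> * 2 ^ q * lam)"
    proof -
      have "mid q \<subseteq> Pow {..<m}" by (auto simp: mid_def)
      then have "(\<integral>\<^sup>+\<omega>. ennreal ((real (U \<A> (C \<omega>)) - lam - V (C \<omega>))\<^sup>2) \<partial>M) = ennreal (excess \<A> q)"
        using transfer[of "\<lambda>v. ennreal ((real (U \<A> v) - lam - V v)\<^sup>2)"]
        by (simp add: lam_def V_def U_centered[OF \<A> q] iso excess_def)
      then show ?thesis using exc by (simp add: ennreal_leI)
    qed
    fix k
    have "measure M {\<omega>\<in>space M. U \<A> (C \<omega>) = i} = measure P {v. U \<A> v = i}" for i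
      unfolding C_distr[symmetric] by (subst measure_distr) (auto simp: vimage_def Int_def conj_commute)
    then show "\<bar>real (Suc k) * measure M {\<omega>\<in>space M. U \<A> (C \<omega>) = Suc k} - lam * measure M {\<omega>\<in>space M. U \<A> (C \<omega>) = k}\<bar>
       \<le> \<epsilon> * 2 ^ q * lam"
      using stein_chen_U[where \<S> = \<A> and k = k, OF \<A> q] exc unfolding lam_def by simp
  qed
qed

section \<open>Convergence to the Poisson law\<close>

text \<open>In the limit the recursion determines the weights up to the factor \<open>p n 0\<close>.
  The uniform bound on the missing mass prevents escape to infinity and forces this factor to tend
  to exp (- c).\<close>

lemma poisson_limit_pmf:
  fixes p :: "nat \<Rightarrow> nat \<Rightarrow> real"
  assumes c: "0 < c"
    and p0: "\<And>n k. 0 \<le> p n k" and p1: "\<And>n k. p n k \<le> 1"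
    and stein: "\<And>k. (\<lambda>n. real (Suc k) * p n (Suc k) - c * p n k) \<longlonglongrightarrow> 0"
    and tight: "\<And>n K. \<bar>(\<Sum>k\<le>K. p n k) - 1\<bar> \<le> C / real (Suc K)"
  shows "(\<lambda>n. p n k) \<longlonglongrightarrow> c ^ k / fact k * exp (- c)"
proof -
  have rel: "(\<lambda>n. p n k - p n 0 * (c ^ k / fact k)) \<longlonglongrightarrow> 0" for k
  proof (induction k)
    case (Suc k)
    have "(\<lambda>n. ((real (Suc k) * p n (Suc k) - c * p n k) + c * (p n k - p n 0 * (c ^ k / fact k))) / real (Suc k))
        \<longlonglongrightarrow> (0 + c * 0) / real (Suc k)"
      by (intro tendsto_intros stein Suc) simp
    moreover have "((real (Suc k) * p n (Suc k) - c * p n k) + c * (p n k - p n 0 * (c ^ k / fact k))) / real (Suc k)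
        = p n (Suc k) - p n 0 * (c ^ Suc k / fact (Suc k))" for n
      by (simp add: field_simps del: of_nat_Suc)
    ultimately show ?case by (simp only: mult_zero_right add_0_left div_0)
  qed simp
  define s where "s K = (\<Sum>k\<le>K. c ^ k / fact k)" for K
  have s_lim: "s \<longlonglongrightarrow> exp c"
    using exp_converges[of c] unfolding sums_def_le s_def by (simp add: divide_inverse mult.commute)
  have s_le: "s K \<le> exp c" for K
    using c by (intro incseq_le[OF _ s_lim]) (auto simp: incseq_Suc_iff s_def)
  have "(\<lambda>n. p n 0 * exp c) \<longlonglongrightarrow> 1"
  proof (rule LIMSEQ_I)
    fix e :: real assume e: "0 < e"
    have "(\<lambda>K. C / real (Suc K) + (exp c - s K)) \<longlonglongrightarrow> 0 + (exp c - exp c)"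
      by (intro tendsto_intros s_lim LIMSEQ_Suc[OF lim_const_over_n])
    then have "\<forall>\<^sub>F K in sequentially. C / real (Suc K) + (exp c - s K) < e / 2"
      using e by (intro order_tendstoD(2)) auto
    then obtain K where K: "C / real (Suc K) + (exp c - s K) < e / 2"
      using eventually_happens'[OF sequentially_bot] by blast
    \<comment> \<open>\<open>K\<close> is fixed first, uniformly in \<open>n\<close>; only then are
      the finitely many errors up to \<open>K\<close> made small.\<close>
    have "(\<lambda>n. \<Sum>k\<le>K. p n k - p n 0 * (c ^ k / fact k)) \<longlonglongrightarrow> (\<Sum>k\<le>K. 0)"
      by (intro tendsto_sum rel)
    from tendstoD[OF this, of "e / 2"]
    have "\<forall>\<^sub>F n in sequentially. \<bar>\<Sum>k\<le>K. p n k - p n 0 * (c ^ k / fact k)\<bar> < e / 2"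
      using e by (simp only: dist_real_def sum.neutral_const diff_zero half_gt_zero_iff)
    then obtain n0 where n0: "\<And>n. n \<ge> n0 \<Longrightarrow> \<bar>\<Sum>k\<le>K. p n k - p n 0 * (c ^ k / fact k)\<bar> < e / 2"
      by (auto simp: eventually_sequentially)
    show "\<exists>n0. \<forall>n\<ge>n0. norm (p n 0 * exp c - 1) < e"
    proof (intro exI allI impI)
      fix n assume n: "n \<ge> n0"
      have 1: "\<bar>(\<Sum>k\<le>K. p n k) - p n 0 * s K\<bar> < e / 2"
        using n0[OF n] by (simp add: sum_subtractf s_def sum_distrib_left)
      have 2: "0 \<le> p n 0 * (exp c - s K)" "p n 0 * (exp c - s K) \<le> exp c - s K"
        using p0[of n 0] p1[of n 0] s_le[of K] by (auto simp: mult_left_le_one_le)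
      have "p n 0 * exp c - 1 = p n 0 * (exp c - s K) - ((\<Sum>k\<le>K. p n k) - p n 0 * s K) + ((\<Sum>k\<le>K. p n k) - 1)"
        by (simp add: algebra_simps)
      then show "norm (p n 0 * exp c - 1) < e"
        using 1 2 K tight[of K n] tight[of n K] unfolding real_norm_def by linarith
    qed
  qed
  then have "(\<lambda>n. (p n k - p n 0 * (c ^ k / fact k)) + p n 0 * exp c * (c ^ k / fact k * exp (- c)))
      \<longlonglongrightarrow> 0 + 1 * (c ^ k / fact k * exp (- c))"
    by (intro tendsto_intros rel)
  moreover have "(p n k - p n 0 * (c ^ k / fact k)) + p n 0 * exp c * (c ^ k / fact k * exp (- c)) = p n k" for n
    by (simp add: exp_minus)
  ultimately show ?thesis by (simp only: add_0_left mult_1_left)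
qed

section \<open>Total variation distance and tightness\<close>

lemma d_TV_le:
  fixes p :: "nat pmf"
  assumes "prob_space P" "sets P = UNIV"
  shows "0 \<le> d_TV P p" and "d_TV P p \<le> (\<Sum>k\<le>K. \<bar>measure P {k} - pmf p k\<bar>) + measure P {K<..} + measure p {K<..}"
proof -
  interpret prob_space P by fact
  have [simp]: "A \<in> sets P" for A using assms(2) by simp
  \<comment> \<open>An arbitrary event is cut at \<open>K\<close>: point masses are compared up to
    \<open>K\<close>, and beyond it only the two tail masses are used.\<close>
  have bound: "\<bar>measure P A - measure p A\<bar> \<le> (\<Sum>k\<le>K. \<bar>measure P {k} - pmf p k\<bar>) + measure P {K<..} + measure p {K<..}" for A K
  proof -
    have fin: "finite (A \<inter> {..K})" by simp
    have split: "A = (A \<inter> {..K}) \<union> (A \<inter> {K<..})" by auto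
    have PA: "measure P A = (\<Sum>k\<in>A \<inter> {..K}. measure P {k}) + measure P (A \<inter> {K<..})"
      by (subst split, subst finite_measure_Union) (auto simp: finite_measure_eq_sum_singleton[OF fin])
    have pA: "measure p A = (\<Sum>k\<in>A \<inter> {..K}. pmf p k) + measure p (A \<inter> {K<..})"
      by (subst split, subst measure_pmf.finite_measure_Union) (auto simp: measure_measure_pmf_finite)
    have "measure P (A \<inter> {K<..}) \<le> measure P {K<..}" "measure p (A \<inter> {K<..}) \<le> measure p {K<..}"
      by (intro finite_measure_mono measure_pmf.finite_measure_mono; simp)+
    moreover have "\<bar>\<Sum>k\<in>A \<inter> {..K}. measure P {k} - pmf p k\<bar> \<le> (\<Sum>k\<le>K. \<bar>measure P {k} - pmf p k\<bar>)"
      by (rule order_trans[OF sum_abs sum_mono2]) auto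
    moreover have "measure P A - measure p A = (\<Sum>k\<in>A \<inter> {..K}. measure P {k} - pmf p k)
        + measure P (A \<inter> {K<..}) - measure p (A \<inter> {K<..})"
      unfolding PA pA sum_subtractf by simp
    ultimately show ?thesis
      using measure_nonneg[of P "A \<inter> {K<..}"] measure_nonneg[of p "A \<inter> {K<..}"] by linarith
  qed
  show "d_TV P p \<le> (\<Sum>k\<le>K. \<bar>measure P {k} - pmf p k\<bar>) + measure P {K<..} + measure p {K<..}"
    unfolding d_TV_def by (rule cSUP_least) (auto intro: bound)
  have "bdd_above (range (\<lambda>A. \<bar>measure P A - measure p A\<bar>))"
    using bound[of _ K] by (intro bdd_aboveI) auto
  from cSUP_upper[OF UNIV_I this, of "{}"] show "0 \<le> d_TV P p" unfolding d_TV_def by simp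
qed

text \<open>Markov's inequality at level \<open>Suc K\<close>, the least value beyond
  \<open>K\<close>.\<close>

lemma tail_le:
  fixes F :: "'w \<Rightarrow> nat"
  assumes "prob_space M" and F: "F \<in> measurable M (count_space UNIV)"
    and mean: "(\<integral>\<^sup>+\<omega>. of_nat (F \<omega>) \<partial>M) \<le> ennreal C" and C: "0 \<le> C"
  shows "measure (distr M (count_space UNIV) F) {K<..} \<le> C / real (Suc K)"
proof -
  interpret prob_space M by fact
  note [measurable] = F
  let ?A = "{\<omega>\<in>space M. K < F \<omega>}"
  have "ennreal (real (Suc K) * measure M ?A) = (\<integral>\<^sup>+\<omega>. of_nat (Suc K) * indicator ?A \<omega> \<partial>M)"
    by (subst nn_integral_cmult_indicator)
      (auto simp: ennreal_mult emeasure_eq_measure ennreal_of_nat_eq_real_of_nat simp del: of_nat_Suc)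
  also have "\<dots> \<le> (\<integral>\<^sup>+\<omega>. of_nat (F \<omega>) \<partial>M)"
  proof (rule nn_integral_mono)
    fix \<omega>
    have "(of_nat (Suc K) :: ennreal) \<le> of_nat (F \<omega>)" if "K < F \<omega>" using that by (intro of_nat_mono) simp
    then show "of_nat (Suc K) * indicator ?A \<omega> \<le> (of_nat (F \<omega>) :: ennreal)"
      by (auto simp: indicator_def simp del: of_nat_Suc)
  qed
  finally have "real (Suc K) * measure M ?A \<le> C"
    using mean C by (metis ennreal_le_iff order_trans)
  moreover have "measure (distr M (count_space UNIV) F) {K<..} = measure M ?A"
    by (subst measure_distr) (auto simp: vimage_def Int_def conj_commute)
  ultimately show ?thesis by (simp add: field_simps del: of_nat_Suc)
qed

lemma poisson_tv_limit:
  fixes F :: "nat \<Rightarrow> 'w \<Rightarrow> nat"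
  assumes c: "0 < c" and M: "\<And>n. prob_space (M n)" and F: "\<And>n. F n \<in> measurable (M n) (count_space UNIV)"
    and mean: "\<And>n. (\<integral>\<^sup>+\<omega>. of_nat (F n \<omega>) \<partial>M n) \<le> ennreal C" and C: "0 \<le> C"
    and stein: "\<And>k. (\<lambda>n. real (Suc k) * measure (M n) {\<omega>\<in>space (M n). F n \<omega> = Suc k}
        - c * measure (M n) {\<omega>\<in>space (M n). F n \<omega> = k}) \<longlonglongrightarrow> 0"
  shows "(\<lambda>n. d_TV (distr (M n) (count_space UNIV) (F n)) (measure_pmf (poisson_pmf c))) \<longlonglongrightarrow> 0"
proof -
  define P where "P n = distr (M n) (count_space UNIV) (F n)" for n
  define p where "p n k = measure (P n) {k}" for n k
  have P: "prob_space (P n)" "sets (P n) = UNIV" for n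
    using prob_space.prob_space_distr[OF M F] by (auto simp: P_def)
  have p_eq: "p n k = measure (M n) {\<omega>\<in>space (M n). F n \<omega> = k}" for n k
    unfolding p_def P_def using F by (subst measure_distr) (auto simp: vimage_def Int_def conj_commute)
  have tail: "measure (P n) {K<..} \<le> C / real (Suc K)" for n K
    unfolding P_def by (rule tail_le[OF M F mean C])
  have tight: "\<bar>(\<Sum>k\<le>K. p n k) - 1\<bar> \<le> C / real (Suc K)" for n K
  proof -
    interpret prob_space "P n" by (rule P)
    have "(\<Sum>k\<le>K. p n k) = measure (P n) {..K}"
      unfolding p_def using P by (subst finite_measure_eq_sum_singleton) auto
    moreover have "measure (P n) ({..K} \<union> {K<..}) = measure (P n) {..K} + measure (P n) {K<..}"
      using P by (intro finite_measure_Union) auto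
    moreover have "{..K} \<union> {K<..} = space (P n)" by (auto simp: P_def)
    ultimately show ?thesis 
      using tail[of n K] prob_space measure_nonneg[of "P n" "{K<..}"] by (simp del: measure_nonneg)
  qed
  let ?Q = "poisson_pmf c"
  have pk: "(\<lambda>n. p n k) \<longlonglongrightarrow> pmf ?Q k" for k
  proof -
    have "(\<lambda>n. p n k) \<longlonglongrightarrow> c ^ k / fact k * exp (- c)"
      using c stein tight prob_space.prob_le_1[OF P(1)]
      by (intro poisson_limit_pmf[where C = C]) (auto simp: p_eq[symmetric], auto simp: p_def)
    then show ?thesis using c by simp
  qed
  have Q_tail: "(\<lambda>K. measure ?Q {K<..}) \<longlonglongrightarrow> 0"
  proof -
    have "(\<lambda>K. measure ?Q {K<..}) \<longlonglongrightarrow> measure ?Q (\<Inter>K. {K<..})"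
      by (intro measure_pmf.finite_Lim_measure_decseq) (auto simp: decseq_def)
    moreover have "(\<Inter>K::nat. {K<..}) = {}" by auto
    ultimately show ?thesis by simp
  qed
  have "(\<lambda>n. d_TV (P n) ?Q) \<longlonglongrightarrow> 0"
  proof (rule LIMSEQ_I)
    fix e :: real assume e: "0 < e"
    have "(\<lambda>K. C / real (Suc K) + measure ?Q {K<..}) \<longlonglongrightarrow> 0 + 0"
      by (intro tendsto_intros Q_tail LIMSEQ_Suc[OF lim_const_over_n])
    then have "\<forall>\<^sub>F K in sequentially. C / real (Suc K) + measure ?Q {K<..} < e / 2"
      using e by (intro order_tendstoD(2)) auto
    then obtain K where K: "C / real (Suc K) + measure ?Q {K<..} < e / 2"
      using eventually_happens'[OF sequentially_bot] by blast
    have "(\<lambda>n. \<Sum>k\<le>K. \<bar>p n k - pmf ?Q k\<bar>) \<longlonglongrightarrow> (\<Sum>k\<le>K. \<bar>pmf ?Q k - pmf ?Q k\<bar>)"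
      by (intro tendsto_intros pk)
    then have "\<forall>\<^sub>F n in sequentially. (\<Sum>k\<le>K. \<bar>p n k - pmf ?Q k\<bar>) < e / 2"
      using e by (intro order_tendstoD(2)) auto
    then obtain n0 where n0: "\<And>n. n \<ge> n0 \<Longrightarrow> (\<Sum>k\<le>K. \<bar>p n k - pmf ?Q k\<bar>) < e / 2"
      by (auto simp: eventually_sequentially)
    show "\<exists>n0. \<forall>n\<ge>n0. norm (d_TV (P n) ?Q - 0) < e"
    proof (intro exI allI impI)
      fix n assume "n \<ge> n0"
      then show "norm (d_TV (P n) ?Q - 0) < e"
        using d_TV_le(1)[OF P, of n ?Q] d_TV_le(2)[OF P, of n ?Q K] n0[of n] K tail[of n K]
        unfolding p_def real_norm_def by linarith
    qed
  qed
  then show ?thesis by (simp add: P_def)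
qed

section \<open>Transfer of the recursion and of the mean\<close>

lemma stein_transfer:
  fixes F N :: "'w \<Rightarrow> nat"
  assumes "prob_space M"
    and F [measurable]: "F \<in> measurable M (count_space UNIV)" and N [measurable]: "N \<in> measurable M (count_space UNIV)"
    and FN: "(\<integral>\<^sup>+\<omega>. ennreal ((real (F \<omega>) - real (N \<omega>))\<^sup>2) \<partial>M) \<le> ennreal d" and d: "0 \<le> d"
    and stein: "\<bar>real (Suc k) * measure M {\<omega>\<in>space M. N \<omega> = Suc k} - lam * measure M {\<omega>\<in>space M. N \<omega> = k}\<bar> \<le> r"
    and c: "0 \<le> c"
  shows "\<bar>real (Suc k) * measure M {\<omega>\<in>space M. F \<omega> = Suc k} - c * measure M {\<omega>\<in>space M. F \<omega> = k}\<bar>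
    \<le> (real (Suc k) + c) * d + \<bar>lam - c\<bar> + r"
proof -
  interpret prob_space M by fact
  let ?f = "\<lambda>i. measure M {\<omega>\<in>space M. F \<omega> = i}" and ?g = "\<lambda>i. measure M {\<omega>\<in>space M. N \<omega> = i}"
  let ?D = "{\<omega>\<in>space M. F \<omega> \<noteq> N \<omega>}"
  have [measurable]: "(\<lambda>\<omega>. real (F \<omega>)) \<in> borel_measurable M" "(\<lambda>\<omega>. real (N \<omega>)) \<in> borel_measurable M"
    by (rule measurable_compose[OF F] measurable_compose[OF N], simp)+
  have "{\<omega>\<in>space M. real (F \<omega>) \<noteq> real (N \<omega>)} \<in> sets M" by measurable
  then have D_sets: "?D \<in> sets M" by simp
  have "emeasure M ?D = (\<integral>\<^sup>+\<omega>. indicator ?D \<omega> \<partial>M)"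
    using D_sets by (rule nn_integral_indicator[symmetric])
  also have "\<dots> \<le> (\<integral>\<^sup>+\<omega>. ennreal ((real (F \<omega>) - real (N \<omega>))\<^sup>2) \<partial>M)"
  proof (rule nn_integral_mono)
    fix \<omega>
    have "1 \<le> (real (F \<omega>) - real (N \<omega>))\<^sup>2" if "F \<omega> \<noteq> N \<omega>"
    proof -
      have "1\<^sup>2 \<le> \<bar>real (F \<omega>) - real (N \<omega>)\<bar>\<^sup>2" using that by (intro power_mono) auto
      then show ?thesis by simp
    qed
    then show "indicator ?D \<omega> \<le> ennreal ((real (F \<omega>) - real (N \<omega>))\<^sup>2)"
      by (auto simp: indicator_def)
  qed
  also note FN
  finally have D: "measure M ?D \<le> d" using d by (simp add: emeasure_eq_measure)
  have diff: "\<bar>?f i - ?g i\<bar> \<le> d" for i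
  proof -
    have "?f i \<le> measure M ({\<omega>\<in>space M. N \<omega> = i} \<union> ?D)" "?g i \<le> measure M ({\<omega>\<in>space M. F \<omega> = i} \<union> ?D)"
      using D_sets by (intro finite_measure_mono; auto)+
    then show ?thesis
      using D D_sets measure_Un_le[of "{\<omega>\<in>space M. N \<omega> = i}" M ?D] measure_Un_le[of "{\<omega>\<in>space M. F \<omega> = i}" M ?D]
      by (simp add: abs_le_iff)
  qed
  have 1: "\<bar>real (Suc k) * (?f (Suc k) - ?g (Suc k))\<bar> \<le> real (Suc k) * d"
    using diff[of "Suc k"] by (simp only: abs_mult abs_of_nat, intro mult_left_mono) auto
  have 2: "\<bar>c * (?f k - ?g k)\<bar> \<le> c * d"
    using diff[of k] c by (simp only: abs_mult abs_of_nonneg, intro mult_left_mono) auto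
  have 3: "\<bar>(lam - c) * ?g k\<bar> \<le> \<bar>lam - c\<bar>"
    unfolding abs_mult by (rule mult_left_le) auto
  \<comment> \<open>The sources of error are separated: exchanging \<open>F\<close> for
    \<open>N\<close> in both probabilities, exchanging \<open>lam\<close> for \<open>c\<close>, and
    the defect of \<open>N\<close> itself.\<close>
  have "real (Suc k) * ?f (Suc k) - c * ?f k = real (Suc k) * (?f (Suc k) - ?g (Suc k)) - c * (?f k - ?g k)
      + (lam - c) * ?g k + (real (Suc k) * ?g (Suc k) - lam * ?g k)"
    by (simp add: algebra_simps)
  then show ?thesis using 1 2 3 stein unfolding distrib_right by linarith
qed

text \<open>With d = X - V one has V^2 - X^2 = d^2 - 2 X d, and 2 |X d| is at most t X^2 + d^2 / t.
  The parameter \<open>t\<close> stays free because it will have to vanish more slowly than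
  \<open>s\<close>.\<close>

lemma second_moment_close:
  fixes X V :: "'w \<Rightarrow> real"
  assumes [measurable]: "X \<in> borel_measurable M" "V \<in> borel_measurable M"
    and XV: "(\<integral>\<^sup>+\<omega>. ennreal ((X \<omega> - V \<omega>)\<^sup>2) \<partial>M) \<le> ennreal s" and s: "0 \<le> s"
    and V: "(\<integral>\<^sup>+\<omega>. ennreal ((V \<omega>)\<^sup>2) \<partial>M) = ennreal lam" and lam: "0 \<le> lam" and t: "0 < t"
  shows "integrable M (\<lambda>\<omega>. (X \<omega>)\<^sup>2)"
    and "\<bar>lam - (\<integral>\<omega>. (X \<omega>)\<^sup>2 \<partial>M)\<bar> \<le> t * (\<integral>\<omega>. (X \<omega>)\<^sup>2 \<partial>M) + (1 + 1 / t) * s"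
proof -
  have "(\<integral>\<^sup>+\<omega>. ennreal ((X \<omega>)\<^sup>2) \<partial>M) \<le> ennreal (2 * s + 2 * lam)"
    by (rule nn_integral_add_sq_le[where g = "\<lambda>\<omega>. X \<omega> - V \<omega>" and h = V]) (use XV V s lam in auto)
  then show int_X: "integrable M (\<lambda>\<omega>. (X \<omega>)\<^sup>2)"
    by (intro integrableI_nonneg) (auto intro: le_less_trans)
  have V': "has_bochner_integral M (\<lambda>\<omega>. (V \<omega>)\<^sup>2) lam"
    using V lam by (intro has_bochner_integral_nn_integral) auto
  have int_D: "integrable M (\<lambda>\<omega>. (X \<omega> - V \<omega>)\<^sup>2)"
    using XV by (intro integrableI_nonneg) (auto intro: le_less_trans)
  have D_le: "(\<integral>\<omega>. (X \<omega> - V \<omega>)\<^sup>2 \<partial>M) \<le> s"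
    using XV s nn_integral_eq_integral[OF int_D] by simp
  have "\<bar>lam - (\<integral>\<omega>. (X \<omega>)\<^sup>2 \<partial>M)\<bar> = \<bar>\<integral>\<omega>. (V \<omega>)\<^sup>2 - (X \<omega>)\<^sup>2 \<partial>M\<bar>"
    using V' int_X by (simp add: has_bochner_integral_iff)
  also have "\<dots> \<le> (\<integral>\<omega>. \<bar>(V \<omega>)\<^sup>2 - (X \<omega>)\<^sup>2\<bar> \<partial>M)"
    by (rule integral_abs_bound)
  also have "\<dots> \<le> (\<integral>\<omega>. t * (X \<omega>)\<^sup>2 + (1 + 1 / t) * (X \<omega> - V \<omega>)\<^sup>2 \<partial>M)"
  proof (rule integral_mono)
    show "integrable M (\<lambda>\<omega>. \<bar>(V \<omega>)\<^sup>2 - (X \<omega>)\<^sup>2\<bar>)"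
      using V' int_X by (auto simp: has_bochner_integral_iff)
    show "integrable M (\<lambda>\<omega>. t * (X \<omega>)\<^sup>2 + (1 + 1 / t) * (X \<omega> - V \<omega>)\<^sup>2)"
      using int_X int_D by auto
    fix \<omega>
    let ?x = "X \<omega>" and ?d = "X \<omega> - V \<omega>"
    have "2 * (?x * ?d) \<le> t * ?x\<^sup>2 + 1 / t * ?d\<^sup>2" "- (2 * (?x * ?d)) \<le> t * ?x\<^sup>2 + 1 / t * ?d\<^sup>2"
    proof -
      have "0 \<le> (t * ?x - ?d)\<^sup>2 / t" "0 \<le> (t * ?x + ?d)\<^sup>2 / t" using t by auto
      moreover have "(t * ?x - ?d)\<^sup>2 / t = t * ?x\<^sup>2 + 1 / t * ?d\<^sup>2 - 2 * (?x * ?d)"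
        "(t * ?x + ?d)\<^sup>2 / t = t * ?x\<^sup>2 + 1 / t * ?d\<^sup>2 + 2 * (?x * ?d)"
        using t by (simp_all add: power2_eq_square field_simps)
      ultimately show "2 * (?x * ?d) \<le> t * ?x\<^sup>2 + 1 / t * ?d\<^sup>2" "- (2 * (?x * ?d)) \<le> t * ?x\<^sup>2 + 1 / t * ?d\<^sup>2"
        by linarith+
    qed
    moreover have "(V \<omega>)\<^sup>2 - ?x\<^sup>2 = ?d\<^sup>2 - 2 * (?x * ?d)" by (simp add: power2_eq_square algebra_simps)
    moreover have "0 \<le> ?d\<^sup>2" by simp
    ultimately show "\<bar>(V \<omega>)\<^sup>2 - ?x\<^sup>2\<bar> \<le> t * ?x\<^sup>2 + (1 + 1 / t) * ?d\<^sup>2"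
      unfolding distrib_right mult_1_left by linarith
  qed
  also have "\<dots> = t * (\<integral>\<omega>. (X \<omega>)\<^sup>2 \<partial>M) + (1 + 1 / t) * (\<integral>\<omega>. (X \<omega> - V \<omega>)\<^sup>2 \<partial>M)"
    using int_X int_D by simp
  also have "\<dots> \<le> t * (\<integral>\<omega>. (X \<omega>)\<^sup>2 \<partial>M) + (1 + 1 / t) * s"
    using D_le t by (intro add_left_mono mult_left_mono) auto
  finally show "\<bar>lam - (\<integral>\<omega>. (X \<omega>)\<^sup>2 \<partial>M)\<bar> \<le> t * (\<integral>\<omega>. (X \<omega>)\<^sup>2 \<partial>M) + (1 + 1 / t) * s" .
qed

text \<open>For K = q! the integrand in hypothesis (iii) is the square of f - K f^2. The
  fourth-moment bound makes it integrable, the cube being controlled by 2 |y|^3 \<le> y^2 + y^4, so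
  the Bochner integral is not a default value.\<close>

lemma kernel_deviation:
  assumes [measurable]: "f \<in> borel_measurable M" and f2: "integrable M (\<lambda>x. (f x)\<^sup>2)"
    and f4: "(\<integral>\<^sup>+x. ennreal ((f x) ^ 4) \<partial>M) \<le> ennreal C"
  shows "(\<integral>\<^sup>+x. ennreal ((f x - K * (f x)\<^sup>2)\<^sup>2) \<partial>M)
      = ennreal (\<integral>x. (f x)\<^sup>2 + K\<^sup>2 * (f x) ^ 4 - 2 * K * (f x) ^ 3 \<partial>M)"
    and "0 \<le> (\<integral>x. (f x)\<^sup>2 + K\<^sup>2 * (f x) ^ 4 - 2 * K * (f x) ^ 3 \<partial>M)"
proof -
  have f4': "integrable M (\<lambda>x. (f x) ^ 4)"
    using f4 by (intro integrableI_nonneg) (auto intro: le_less_trans)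
  have f3: "integrable M (\<lambda>x. (f x) ^ 3)"
  proof (rule Bochner_Integration.integrable_bound[OF Bochner_Integration.integrable_add[OF f2 f4']])
    show "AE x in M. norm ((f x) ^ 3) \<le> norm ((f x)\<^sup>2 + (f x) ^ 4)"
    proof (rule AE_I2)
      fix x
      have "2 * \<bar>y ^ 3\<bar> \<le> y\<^sup>2 + y ^ 4" for y :: real
        using zero_le_power2[of "\<bar>y\<bar> - y\<^sup>2"]
        by (simp add: power2_eq_square power3_eq_cube power4_eq_xxxx abs_mult algebra_simps)
      from this[of "f x"] show "norm ((f x) ^ 3) \<le> norm ((f x)\<^sup>2 + (f x) ^ 4)"
        unfolding real_norm_def by linarith
    qed
  qed simp
  have eq: "(f x - K * (f x)\<^sup>2)\<^sup>2 = (f x)\<^sup>2 + K\<^sup>2 * (f x) ^ 4 - 2 * K * (f x) ^ 3" for x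
    by (simp add: power2_eq_square power3_eq_cube power4_eq_xxxx algebra_simps)
  have int: "integrable M (\<lambda>x. (f x - K * (f x)\<^sup>2)\<^sup>2)"
    unfolding eq using f2 f3 f4' by auto
  show "(\<integral>\<^sup>+x. ennreal ((f x - K * (f x)\<^sup>2)\<^sup>2) \<partial>M)
      = ennreal (\<integral>x. (f x)\<^sup>2 + K\<^sup>2 * (f x) ^ 4 - 2 * K * (f x) ^ 3 \<partial>M)"
    unfolding eq[symmetric] by (rule nn_integral_eq_integral[OF int]) simp
  show "0 \<le> (\<integral>x. (f x)\<^sup>2 + K\<^sup>2 * (f x) ^ 4 - 2 * K * (f x) ^ 3 \<partial>M)"
    unfolding eq[symmetric] by simp
qed

lemma L2norm_tendsto_0:
  assumes L2: "\<And>n. L2 (M n) (g n)" and lim: "(\<lambda>n. L2norm (M n) (g n)) \<longlonglongrightarrow> 0"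
  shows "(\<lambda>n. \<integral>x. (g n x)\<^sup>2 \<partial>M n) \<longlonglongrightarrow> 0"
proof -
  have "(\<integral>\<^sup>+x. ennreal ((g n x)\<^sup>2) \<partial>M n) = ennreal (\<integral>x. (g n x)\<^sup>2 \<partial>M n)" for n
    using L2 by (intro nn_integral_eq_integral) (auto simp: L2_def)
  then have "L2norm (M n) (g n) = ennreal (sqrt (\<integral>x. (g n x)\<^sup>2 \<partial>M n))" for n
    by (simp add: L2norm_def ennsqrt_def)
  then have "(\<lambda>n. ennreal (sqrt (\<integral>x. (g n x)\<^sup>2 \<partial>M n))) \<longlonglongrightarrow> ennreal 0" using lim by simp
  from tendsto_enn2real[OF this] have "(\<lambda>n. sqrt (\<integral>x. (g n x)\<^sup>2 \<partial>M n)) \<longlonglongrightarrow> 0" by simp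
  from tendsto_power[OF this, of 2] show ?thesis by simp
qed

section \<open>Assembling the estimates along the sequence\<close>

theorem theorem4p10:
  fixes c :: real and q :: nat
    and M :: "nat \<Rightarrow> 'w measure"
    and mu :: "nat \<Rightarrow> ('z::polish_space) measure"
    and eta :: "nat \<Rightarrow> 'w \<Rightarrow> 'z measure"
    and F :: "nat \<Rightarrow> 'w \<Rightarrow> nat"
    and x :: "nat \<Rightarrow> real"
    and B :: "nat \<Rightarrow> 'w \<Rightarrow> real"
    and f :: "nat \<Rightarrow> (nat \<Rightarrow> 'z) \<Rightarrow> real"
    and X :: "nat \<Rightarrow> 'w \<Rightarrow> real"
  assumes c_pos: "c > 0"
    and q_ge: "q \<ge> 2"
    and mu_borel: "\<And>n. sets (mu n) = sets (borel :: 'z measure)"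
    and mu_sf: "\<And>n. sigma_finite_measure (mu n)"
    and mu_na: "\<And>n. non_atomic (mu n)"
    and eta_pm: "\<And>n. poisson_measure (M n) (mu n) (eta n)"
    and F_meas: "\<And>n. F n \<in> measurable (M n) (count_space UNIV)"
    and x_pos: "\<And>n. x n > 0"
    and f_L2s: "\<And>n. sym_L2 (mu n) q (f n)"
    and X_mwi: "\<And>n. is_mwi (M n) (mu n) (eta n) q (f n) (X n)"
    and F_eq: "\<And>n. AE \<omega> in M n. real (F n \<omega>) = x n + B n \<omega> + X n \<omega>"
    and B_svp: "smooth_vanishing_perturbation M mu eta B"
    and x_lim: "x \<longlonglongrightarrow> c"
    and var_lim: "(\<lambda>n. \<integral>\<omega>. (X n \<omega>)\<^sup>2 \<partial>M n) \<longlonglongrightarrow> c"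
    and hyp_i: "\<And>n. integrand_assumption (mu n) q (f n)"
    and hyp_ii: "\<And>r l. r \<in> {1..q} \<Longrightarrow> l \<in> {1..min r (q - 1)} \<Longrightarrow>
        (\<lambda>n. L2norm (powM (mu n) (2*q - r - l)) (contr (mu n) q q r l (f n) (f n))) \<longlonglongrightarrow> 0"
    and hyp_iii_bdd: "\<exists>C::real. \<forall>n. (\<integral>\<^sup>+y. ennreal ((f n y) ^ 4) \<partial>powM (mu n) q) \<le> ennreal C"
    and hyp_iii_lim: "(\<lambda>n. \<integral>y. (f n y)\<^sup>2 + (fact q)\<^sup>2 * (f n y) ^ 4 - 2 * fact q * (f n y) ^ 3
                         \<partial>powM (mu n) q) \<longlonglongrightarrow> 0"
  shows "(\<lambda>n. d_TV (distr (M n) (count_space UNIV) (F n)) (measure_pmf (poisson_pmf c)))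
           \<longlonglongrightarrow> 0"
proof -
  \<comment> \<open>Any positive null sequence would do. It is the accuracy of the elementary
    approximation, and it keeps \<epsilon> and \<open>t\<close> strictly positive where \<Phi> or
    \<open>s\<close> vanishes.\<close>
  define \<tau> where "\<tau> n = 1 / real (Suc n)" for n
  have \<tau>: "\<And>n. 0 < \<tau> n" "\<tau> \<longlonglongrightarrow> 0"
    using LIMSEQ_Suc[OF lim_const_over_n[of 1]] by (auto simp: \<tau>_def[abs_def])
  have ps: "prob_space (M n)" for n using eta_pm[of n] by (simp add: poisson_measure_def)
  have f_meas: "f n \<in> borel_measurable (powM (mu n) q)" and f2: "integrable (powM (mu n) q) (\<lambda>y. (f n y)\<^sup>2)" for n
    using f_L2s[of n] by (auto simp: sym_L2_def)
  obtain C where C: "\<And>n. (\<integral>\<^sup>+y. ennreal ((f n y) ^ 4) \<partial>powM (mu n) q) \<le> ennreal C" using hyp_iii_bdd by auto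
  define \<Delta> where "\<Delta> n = (\<integral>y. (f n y)\<^sup>2 + (fact q)\<^sup>2 * (f n y) ^ 4 - 2 * fact q * (f n y) ^ 3 \<partial>powM (mu n) q)" for n
  have \<Delta>: "0 \<le> \<Delta> n" "(\<integral>\<^sup>+y. ennreal ((f n y - fact q * (f n y)\<^sup>2)\<^sup>2) \<partial>powM (mu n) q) \<le> ennreal (\<Delta> n)" for n
    unfolding \<Delta>_def using kernel_deviation[OF f_meas f2 C, of n "fact q"] by auto
  have \<Delta>_lim: "\<Delta> \<longlonglongrightarrow> 0" using hyp_iii_lim by (simp add: \<Delta>_def[abs_def])
  define \<phi> where "\<phi> j n = (\<integral>y. (contr (mu n) q q q (q - j) (f n) (f n) y)\<^sup>2 \<partial>powM (mu n) j)" for j n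
  have contr_L2: "L2 (powM (mu n) j) (contr (mu n) q q q (q - j) (f n) (f n))" if "j \<in> {1..<q}" for j n
    using hyp_i[of n] that by (auto simp: integrand_assumption_def)
  have contr_fin: "contr_abs_finite (mu n) q q q (q - j) (f n) (f n) y"
    if "j \<in> {1..<q}" "y \<in> space (powM (mu n) j)" for j n y
  proof -
    have "\<forall>y\<in>space (powM (mu n) (2*q - q - (q - j))). contr_abs_finite (mu n) q q q (q - j) (f n) (f n) y"
      using hyp_i[of n] that(1) q_ge unfolding integrand_assumption_def by auto
    moreover have "2*q - q - (q - j) = j" using that(1) by auto
    ultimately show ?thesis using that(2) by simp
  qed
  have \<phi>_lim: "\<phi> j \<longlonglongrightarrow> 0" if "j \<in> {1..<q}" for j
  proof -
    \<comment> \<open>The instance r = q, l = q - j, which leaves \<open>j\<close> free variables; l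
      stays below \<open>q\<close> because j \<ge> 1.\<close>
    have "q \<in> {1..q}" "q - j \<in> {1..min q (q - 1)}" using that by auto
    note hyp_ii[OF this]
    moreover have "2*q - q - (q - j) = j" using that by auto
    ultimately have "(\<lambda>n. L2norm (powM (mu n) j) (contr (mu n) q q q (q - j) (f n) (f n))) \<longlonglongrightarrow> 0"
      by (simp only:)
    from L2norm_tendsto_0[OF contr_L2[OF that] this] show ?thesis by (simp add: \<phi>_def[abs_def])
  qed
  have \<phi>0: "0 \<le> \<phi> j n" for j n unfolding \<phi>_def by simp
  define \<Phi> where "\<Phi> n = (\<Sum>j\<in>{1..<q}. \<phi> j n)" for n
  have \<Phi>0: "0 \<le> \<Phi> n" for n unfolding \<Phi>_def by (intro sum_nonneg \<phi>0)
  have \<Phi>_lim: "\<Phi> \<longlonglongrightarrow> 0"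
    using tendsto_sum[of "{1..<q}" \<phi> "\<lambda>_. 0" sequentially] \<phi>_lim by (simp add: \<Phi>_def[abs_def])
  have \<Phi>_ge: "(\<integral>\<^sup>+y. ennreal ((contr (mu n) q q q (q - j) (f n) (f n) y)\<^sup>2) \<partial>powM (mu n) j) \<le> ennreal (\<Phi> n)"
    if "j \<in> {1..<q}" for j n
  proof -
    have "(\<integral>\<^sup>+y. ennreal ((contr (mu n) q q q (q - j) (f n) (f n) y)\<^sup>2) \<partial>powM (mu n) j) = ennreal (\<phi> j n)"
      unfolding \<phi>_def using contr_L2[OF that, of n] by (intro nn_integral_eq_integral) (auto simp: L2_def)
    moreover have "\<phi> j n \<le> \<Phi> n" unfolding \<Phi>_def using that \<phi>0 by (intro member_le_sum) auto
    ultimately show ?thesis by (simp add: ennreal_leI)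
  qed
  \<comment> \<open>The pruning threshold has to vanish while \<Phi> / \<epsilon> vanishes too; the
    square root achieves both.\<close>
  define \<epsilon> where "\<epsilon> n = sqrt (\<Phi> n) + \<tau> n" for n
  have \<epsilon>0: "0 < \<epsilon> n" for n unfolding \<epsilon>_def using \<tau>(1)[of n] \<Phi>0[of n] by (simp add: add_nonneg_pos)
  have sqrt\<Phi>: "(\<lambda>n. sqrt (\<Phi> n)) \<longlonglongrightarrow> 0" using tendsto_real_sqrt[OF \<Phi>_lim] by simp
  have \<epsilon>_lim: "\<epsilon> \<longlonglongrightarrow> 0" unfolding \<epsilon>_def[abs_def] using tendsto_add[OF sqrt\<Phi> \<tau>(2)] by simp
  \<comment> \<open>The quotient is at most sqrt (u n). It serves twice, for \<Phi> against
    \<epsilon> and for \<open>s\<close> against \<open>t\<close>.\<close>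
  have ratio: "(\<lambda>n. u n / (sqrt (u n) + \<tau> n)) \<longlonglongrightarrow> 0"
    if u: "\<And>n. 0 \<le> u n" "u \<longlonglongrightarrow> 0" for u
  proof (rule tendsto_sandwich[OF _ _ tendsto_const])
    show "(\<lambda>n. sqrt (u n)) \<longlonglongrightarrow> 0" using tendsto_real_sqrt[OF u(2)] by simp
    show "\<forall>\<^sub>F n in sequentially. 0 \<le> u n / (sqrt (u n) + \<tau> n)"
      using u(1) \<tau>(1) by (intro always_eventually allI divide_nonneg_nonneg add_nonneg_nonneg) (auto simp: less_imp_le)
    show "\<forall>\<^sub>F n in sequentially. u n / (sqrt (u n) + \<tau> n) \<le> sqrt (u n)"
    proof (intro always_eventually allI)
      fix n
      have "u n = sqrt (u n) * sqrt (u n)" using u(1)[of n] by simp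
      also have "\<dots> \<le> sqrt (u n) * (sqrt (u n) + \<tau> n)" using u(1)[of n] \<tau>(1)[of n] by (intro mult_left_mono) auto
      finally show "u n / (sqrt (u n) + \<tau> n) \<le> sqrt (u n)"
        using u(1)[of n] \<tau>(1)[of n] by (simp add: pos_divide_le_eq add_nonneg_pos)
    qed
  qed
  define s where "s n = approx_err q (\<tau> n) (\<Delta> n) (\<Phi> n) (\<epsilon> n)" for n
  have s0: "0 \<le> s n" for n
    unfolding s_def approx_err_def using less_imp_le[OF \<tau>(1)[of n]] \<Delta>(1)[of n] \<Phi>0[of n] less_imp_le[OF \<epsilon>0[of n]]
    by (intro add_nonneg_nonneg mult_nonneg_nonneg divide_nonneg_nonneg) auto
  have s_lim: "s \<longlonglongrightarrow> 0"
  proof -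
    have "s = (\<lambda>n. 2 * \<tau> n + 2 * (2 * (2 * (fact q)\<^sup>2 * \<tau> n + 8 * (fact q)\<^sup>2 * \<Delta> n)
        + 2 * (real q * (64 * (fact q) ^ 4 * (\<Phi> n / \<epsilon> n) + 16 * (fact q)\<^sup>2 * \<tau> n))))"
      by (auto simp: s_def approx_err_def)
    also have "\<dots> \<longlonglongrightarrow> 2 * 0 + 2 * (2 * (2 * (fact q)\<^sup>2 * 0 + 8 * (fact q)\<^sup>2 * 0)
        + 2 * (real q * (64 * (fact q) ^ 4 * 0 + 16 * (fact q)\<^sup>2 * 0)))"
      using ratio[OF \<Phi>0 \<Phi>_lim] by (intro tendsto_add tendsto_mult tendsto_const \<tau> \<Delta>_lim) (simp add: \<epsilon>_def)
    finally show ?thesis by simp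
  qed
  \<comment> \<open>All properties are bundled in one predicate, so that a single choice over
    \<open>n\<close> yields the three sequences \<open>N\<close>, \<open>V\<close> and
    \<open>lam\<close> together.\<close>
  define Q where "Q n N V lam \<longleftrightarrow> N \<in> measurable (M n) (count_space UNIV) \<and> V \<in> borel_measurable (M n) \<and> 0 \<le> lam \<and>
      (\<integral>\<^sup>+\<omega>. ennreal ((X n \<omega> - V \<omega>)\<^sup>2) \<partial>M n) \<le> ennreal (s n) \<and>
      (\<integral>\<^sup>+\<omega>. ennreal ((V \<omega>)\<^sup>2) \<partial>M n) = ennreal lam \<and>
      (\<integral>\<^sup>+\<omega>. ennreal ((real (N \<omega>) - lam - V \<omega>)\<^sup>2) \<partial>M n) \<le> ennreal (\<epsilon> n * 2 ^ q * lam) \<and>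
      (\<forall>k. \<bar>real (Suc k) * measure (M n) {\<omega>\<in>space (M n). N \<omega> = Suc k}
          - lam * measure (M n) {\<omega>\<in>space (M n). N \<omega> = k}\<bar> \<le> \<epsilon> n * 2 ^ q * lam)"
    for n and N :: "'w \<Rightarrow> nat" and V :: "'w \<Rightarrow> real" and lam :: real
  have "\<exists>N V lam. Q n N V lam" for n
  proof -
    have q1: "1 \<le> q" using q_ge by simp
    have cm: "contr (mu n) q q q (q - j) (f n) (f n) \<in> borel_measurable (powM (mu n) j)" if "j \<in> {1..<q}" for j
      using contr_L2[OF that] by (simp add: L2_def)
    show ?thesis
      unfolding Q_def s_def
      by (rule poisson_U_statistic_approx[OF eta_pm[of n] mu_sf q1 f_meas X_mwi \<Delta> contr_fin cm \<Phi>0 \<Phi>_ge \<epsilon>0[of n] \<tau>(1)[of n]])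
        (assumption | intro exI conjI allI)+
  qed
  then obtain N V lam where Q: "\<And>n. Q n (N n) (V n) (lam n)" by metis
  have N: "N n \<in> measurable (M n) (count_space UNIV)"
    and V: "V n \<in> borel_measurable (M n)" and lam0: "0 \<le> lam n"
    and XV: "(\<integral>\<^sup>+\<omega>. ennreal ((X n \<omega> - V n \<omega>)\<^sup>2) \<partial>M n) \<le> ennreal (s n)"
    and V2: "(\<integral>\<^sup>+\<omega>. ennreal ((V n \<omega>)\<^sup>2) \<partial>M n) = ennreal (lam n)"
    and NV: "(\<integral>\<^sup>+\<omega>. ennreal ((real (N n \<omega>) - lam n - V n \<omega>)\<^sup>2) \<partial>M n) \<le> ennreal (\<epsilon> n * 2 ^ q * lam n)"
    and stein: "\<bar>real (Suc k) * measure (M n) {\<omega>\<in>space (M n). N n \<omega> = Suc k}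
          - lam n * measure (M n) {\<omega>\<in>space (M n). N n \<omega> = k}\<bar> \<le> \<epsilon> n * 2 ^ q * lam n" for n k
    using Q[of n, unfolded Q_def] by blast+
  have X_meas: "X n \<in> borel_measurable (M n)" for n using X_mwi[of n] by (simp add: is_mwi_def)
  define v where "v n = (\<integral>\<omega>. (X n \<omega>)\<^sup>2 \<partial>M n)" for n
  define t where "t n = sqrt (s n) + \<tau> n" for n
  have t0: "0 < t n" for n unfolding t_def using \<tau>(1)[of n] s0[of n] by (simp add: add_nonneg_pos)
  have v_lim: "v \<longlonglongrightarrow> c" using var_lim by (simp add: v_def[abs_def])
  note smc = second_moment_close[OF X_meas V XV s0 V2 lam0 t0]
  \<comment> \<open>The second moment of \<open>V\<close> is \<open>lam\<close>, that of
    \<open>X\<close> tends to \<open>c\<close>, and X - V vanishes in L2; this identifies the limit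
    of the means.\<close>
  have lam_lim: "lam \<longlonglongrightarrow> c"
  proof -
    have "t \<longlonglongrightarrow> 0" unfolding t_def[abs_def] using tendsto_add[OF tendsto_real_sqrt[OF s_lim] \<tau>(2)] by simp
    then have "(\<lambda>n. t n * v n + (s n + s n / t n)) \<longlonglongrightarrow> 0 * c + (0 + 0)"
      using ratio[OF s0 s_lim, folded t_def] by (intro tendsto_add tendsto_mult v_lim s_lim)
    then have lim: "(\<lambda>n. t n * v n + (s n + s n / t n)) \<longlonglongrightarrow> 0" by simp
    have "\<bar>lam n - v n\<bar> \<le> t n * v n + (s n + s n / t n)" for n
      using smc(2)[of n] unfolding v_def distrib_right by simp
    then have "(\<lambda>n. lam n - v n) \<longlonglongrightarrow> 0"
      by (intro Lim_null_comparison[OF _ lim] always_eventually allI) simp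
    from tendsto_add[OF this v_lim] show ?thesis by simp
  qed
  obtain g DB DLB where B_L2: "\<And>n. chaos_dec (M n) (mu n) (eta n) (B n) (g n)"
    and B_lim: "(\<lambda>n. \<integral>\<^sup>+\<omega>. ennreal ((B n \<omega>)\<^sup>2) \<partial>M n) \<longlonglongrightarrow> 0"
    using B_svp unfolding smooth_vanishing_perturbation_def by fast
  have B_meas: "B n \<in> borel_measurable (M n)" and B_int: "integrable (M n) (\<lambda>\<omega>. (B n \<omega>)\<^sup>2)" for n
    using B_L2[of n] by (auto simp: chaos_dec_def L2_def)
  define \<beta> where "\<beta> n = (\<integral>\<omega>. (B n \<omega>)\<^sup>2 \<partial>M n)" for n
  have \<beta>: "(\<integral>\<^sup>+\<omega>. ennreal ((B n \<omega>)\<^sup>2) \<partial>M n) = ennreal (\<beta> n)" for n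
    unfolding \<beta>_def by (rule nn_integral_eq_integral[OF B_int]) simp
  have \<beta>0: "0 \<le> \<beta> n" for n by (simp add: \<beta>_def)
  have \<beta>_lim: "\<beta> \<longlonglongrightarrow> 0"
    using tendsto_enn2real[OF B_lim[unfolded \<beta>, folded ennreal_0]] \<beta>0 by simp
  have const: "(\<integral>\<^sup>+\<omega>. ennreal (y\<^sup>2) \<partial>M n) \<le> ennreal (y\<^sup>2)" for y n
    using prob_space.emeasure_space_1[OF ps] by simp
  have N_real: "(\<lambda>\<omega>. real (N n \<omega>)) \<in> borel_measurable (M n)" for n
    by (rule measurable_compose[OF N]) simp
  \<comment> \<open>Comes from writing F - N as (x - lam) + B + ((X - V) - (N - lam - V)) and
    splitting the square of a sum twice.\<close>
  define d where "d n = 2 * (2 * (x n - lam n)\<^sup>2 + 2 * \<beta> n) + 2 * (2 * s n + 2 * (\<epsilon> n * 2 ^ q * lam n))" for n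
  have FN: "(\<integral>\<^sup>+\<omega>. ennreal ((real (F n \<omega>) - real (N n \<omega>))\<^sup>2) \<partial>M n) \<le> ennreal (d n)" and d0: "0 \<le> d n" for n
  proof -
    note [measurable] = X_meas[of n] V[of n] B_meas[of n] N_real[of n]
    have e0: "0 \<le> \<epsilon> n * 2 ^ q * lam n" using \<epsilon>0[of n] lam0[of n] by simp
    have "(\<integral>\<^sup>+\<omega>. ennreal ((real (F n \<omega>) - real (N n \<omega>))\<^sup>2) \<partial>M n)
        = (\<integral>\<^sup>+\<omega>. ennreal (((x n - lam n) + B n \<omega> + ((X n \<omega> - V n \<omega>) - (real (N n \<omega>) - lam n - V n \<omega>)))\<^sup>2) \<partial>M n)"
      by (rule nn_integral_cong_AE) (use F_eq[of n] in \<open>eventually_elim, simp add: algebra_simps\<close>)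
    also have "\<dots> \<le> ennreal (d n)"
      unfolding d_def
    proof (rule nn_integral_add_sq_le[where g = "\<lambda>\<omega>. (x n - lam n) + B n \<omega>"
          and h = "\<lambda>\<omega>. (X n \<omega> - V n \<omega>) - (real (N n \<omega>) - lam n - V n \<omega>)"])
      show "(\<integral>\<^sup>+\<omega>. ennreal (((x n - lam n) + B n \<omega>)\<^sup>2) \<partial>M n) \<le> ennreal (2 * (x n - lam n)\<^sup>2 + 2 * \<beta> n)"
        by (rule nn_integral_add_sq_le[where g = "\<lambda>_. x n - lam n" and h = "B n"])
          (use const \<beta> \<beta>0 in auto)
      show "(\<integral>\<^sup>+\<omega>. ennreal (((X n \<omega> - V n \<omega>) - (real (N n \<omega>) - lam n - V n \<omega>))\<^sup>2) \<partial>M n)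
          \<le> ennreal (2 * s n + 2 * (\<epsilon> n * 2 ^ q * lam n))"
        by (rule nn_integral_add_sq_le[where g = "\<lambda>\<omega>. X n \<omega> - V n \<omega>" and h = "\<lambda>\<omega>. - (real (N n \<omega>) - lam n - V n \<omega>)", OF _ _ _ s0 XV e0])
          (use NV[of n] in \<open>simp_all only: power2_minus, auto\<close>)
    qed (use \<beta>0[of n] s0[of n] e0 in auto)
    finally show "(\<integral>\<^sup>+\<omega>. ennreal ((real (F n \<omega>) - real (N n \<omega>))\<^sup>2) \<partial>M n) \<le> ennreal (d n)" .
    show "0 \<le> d n" unfolding d_def using \<beta>0[of n] s0[of n] e0 by simp
  qed
  have \<epsilon>lam: "(\<lambda>n. \<epsilon> n * 2 ^ q * lam n) \<longlonglongrightarrow> 0"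
    using tendsto_mult[OF tendsto_mult[OF \<epsilon>_lim tendsto_const] lam_lim, of "2 ^ q"] by simp
  have d_lim: "d \<longlonglongrightarrow> 0"
  proof -
    have "d \<longlonglongrightarrow> 2 * (2 * (c - c)\<^sup>2 + 2 * 0) + 2 * (2 * 0 + 2 * 0)"
      unfolding d_def[abs_def] by (intro tendsto_intros x_lim lam_lim \<beta>_lim s_lim \<epsilon>lam)
    then show ?thesis by simp
  qed
  have stein_F: "(\<lambda>n. real (Suc k) * measure (M n) {\<omega>\<in>space (M n). F n \<omega> = Suc k}
      - c * measure (M n) {\<omega>\<in>space (M n). F n \<omega> = k}) \<longlonglongrightarrow> 0" for k
  proof (rule Lim_null_comparison)
    show "\<forall>\<^sub>F n in sequentially. norm (real (Suc k) * measure (M n) {\<omega>\<in>space (M n). F n \<omega> = Suc k}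
        - c * measure (M n) {\<omega>\<in>space (M n). F n \<omega> = k}) \<le> (real (Suc k) + c) * d n + \<bar>lam n - c\<bar> + \<epsilon> n * 2 ^ q * lam n"
      unfolding real_norm_def using c_pos
      by (intro always_eventually allI stein_transfer[OF ps F_meas N FN d0 stein]) simp
    have "(\<lambda>n. (real (Suc k) + c) * d n + \<bar>lam n - c\<bar> + \<epsilon> n * 2 ^ q * lam n) \<longlonglongrightarrow> (real (Suc k) + c) * 0 + \<bar>c - c\<bar> + 0"
      by (intro tendsto_add tendsto_mult tendsto_rabs tendsto_diff tendsto_const d_lim lam_lim \<epsilon>lam)
    then show "(\<lambda>n. (real (Suc k) + c) * d n + \<bar>lam n - c\<bar> + \<epsilon> n * 2 ^ q * lam n) \<longlonglongrightarrow> 0" by simp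
  qed
  \<comment> \<open>Bounds the second moment of \<open>F\<close>, hence also its mean, a natural
    number being at most its square. \<open>R\<close> converges, so the bound is uniform in
    \<open>n\<close>, as tightness requires.\<close>
  define R where "R n = 2 * (2 * (x n)\<^sup>2 + 2 * \<beta> n) + 2 * v n" for n
  have mean: "(\<integral>\<^sup>+\<omega>. of_nat (F n \<omega>) \<partial>M n) \<le> ennreal (R n)" for n
  proof -
    note [measurable] = X_meas[of n] B_meas[of n]
    have v: "0 \<le> v n" "(\<integral>\<^sup>+\<omega>. ennreal ((X n \<omega>)\<^sup>2) \<partial>M n) = ennreal (v n)"
      unfolding v_def using nn_integral_eq_integral[OF smc(1)] by auto
    have "(\<integral>\<^sup>+\<omega>. of_nat (F n \<omega>) \<partial>M n) \<le> (\<integral>\<^sup>+\<omega>. ennreal ((real (F n \<omega>))\<^sup>2) \<partial>M n)"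
    proof (rule nn_integral_mono)
      fix \<omega>
      have "F n \<omega> \<le> (F n \<omega>)\<^sup>2" by (simp add: power2_eq_square)
      then have "real (F n \<omega>) \<le> (real (F n \<omega>))\<^sup>2" by (metis of_nat_le_iff of_nat_power)
      then show "of_nat (F n \<omega>) \<le> ennreal ((real (F n \<omega>))\<^sup>2)"
        by (simp add: ennreal_of_nat_eq_real_of_nat ennreal_leI)
    qed
    also have "\<dots> = (\<integral>\<^sup>+\<omega>. ennreal ((x n + B n \<omega> + X n \<omega>)\<^sup>2) \<partial>M n)"
      by (rule nn_integral_cong_AE) (use F_eq[of n] in \<open>eventually_elim, simp\<close>)
    also have "\<dots> \<le> ennreal (R n)"
      unfolding R_def
    proof (rule nn_integral_add_sq_le[where g = "\<lambda>\<omega>. x n + B n \<omega>" and h = "X n"])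
      show "(\<integral>\<^sup>+\<omega>. ennreal ((x n + B n \<omega>)\<^sup>2) \<partial>M n) \<le> ennreal (2 * (x n)\<^sup>2 + 2 * \<beta> n)"
        by (rule nn_integral_add_sq_le[where g = "\<lambda>_. x n" and h = "B n"]) (use const \<beta> \<beta>0 in auto)
    qed (use v \<beta>0[of n] in auto)
    finally show ?thesis .
  qed
  have "R \<longlonglongrightarrow> 2 * (2 * c\<^sup>2 + 2 * 0) + 2 * c"
    unfolding R_def[abs_def] by (intro tendsto_intros x_lim \<beta>_lim v_lim)
  then obtain D where D: "0 < D" "\<And>n. norm (R n) \<le> D"
    using convergent_imp_Bseq[OF convergentI] by (metis BseqE)
  have "(\<integral>\<^sup>+\<omega>. of_nat (F n \<omega>) \<partial>M n) \<le> ennreal D" for n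
  proof (rule order_trans[OF mean ennreal_leI])
    show "R n \<le> D" using D(2)[of n] by (simp add: abs_le_iff)
  qed
  from poisson_tv_limit[OF c_pos ps F_meas this less_imp_le[OF D(1)] stein_F] show ?thesis .
qed

end
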